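(* Let $G$ be a finite abelian group, with (contracted) generalized character algebra $\mathbb{Q}(\widetilde G)$ for the chain $1\subset G$. The primitive central idempotents of $\mathbb{Q}(\widetilde G)$ are precisely the elements $\psi(G,H)\,\check\epsilon(G,N)$ for subgroups $H\le N\le G$ with $H\neq G$ such that $G/N$ is cyclic.
   Context: $\mathbb{Q}(\widetilde G)$ is the commutative $\mathbb{Q}$-algebra obtained from the semigroup algebra of the nonempty subsets of $G$ (basis $\chi_A$, $\emptyset\neq A\subset G$, product $\chi_A\chi_B=\chi_{AB}$ with $AB=\{ab:a\in A,b\in B\}$, unit $\chi_{\{1\}}$) by passing to the contracted algebra, i.e. dividing out $\mathbb{Q}\chi_G$, so that $\chi_G=0$. For a subgroup $N\le G$, $\mathcal{M}(G/N)$ denotes the set of minimal nontrivial subgroups of $G/N$; for $\overline L\in\mathcal{M}(G/N)$, $L$ is the subgroup of $G$ containing $N$ with $L/N=\overline L$. For a proper subgroup $H<G$, $$\psi(G,H)=\prod_{\overline{H'}\in\mathcal{M}(G/H)}(\chi_H-\chi_{H'}).$$ For nonempty $A\subset G$, $\check A=\frac1{|A|}\sum_{g\in A}\chi_{\{g\}}\in\mathbb{Q}(\widetilde G)$, and $$\check\epsilon(G,N)=\check N\prod_{\overline L\in\mathcal{M}(G/N)}(1-\check L)\in\mathbb{Q}(\widetilde G),$$ with empty products equal to $1$. *)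

theory Defs
  imports Complex_Main "HOL-Algebra.Module" "HOL-Algebra.QuotRing" "HOL-Algebra.Elementary_Groups"
begin

definition subset_monoid :: "('a, 'm) monoid_scheme \<Rightarrow> 'a set monoid" where
  "subset_monoid G =
    \<lparr>carrier = Pow (carrier G) - {{}}, mult = (<#>\<^bsub>G\<^esub>), one = {\<one>\<^bsub>G\<^esub>}\<rparr>"

text \<open>An element of the algebra \<open>\<rat>S\<close> is the finitely supported family of its coefficients.\<close>

definition monoid_algebra :: "('s, 'm) monoid_scheme \<Rightarrow> (rat, 's \<Rightarrow> rat) module" where
  "monoid_algebra S =
    \<lparr>carrier = {f. finite {s. f s \<noteq> 0} \<and> {s. f s \<noteq> 0} \<subseteq> carrier S},
     mult = (\<lambda>f g u. \<Sum>(s, t) | f s \<noteq> 0 \<and> g t \<noteq> 0 \<and> s \<otimes>\<^bsub>S\<^esub> t = u. f s * g t),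
     one = (\<lambda>u. if u = \<one>\<^bsub>S\<^esub> then 1 else 0),
     zero = (\<lambda>_. 0),
     add = (\<lambda>f g u. f u + g u),
     smult = (\<lambda>c f u. c * f u)\<rparr>"

definition basis_elem :: "'s \<Rightarrow> 's \<Rightarrow> rat" where
  "basis_elem s = (\<lambda>u. if u = s then 1 else 0)"

definition contraction_ideal :: "('a, 'm) monoid_scheme \<Rightarrow> ('a set \<Rightarrow> rat) set" where
  "contraction_ideal G =
    range (\<lambda>c. c \<odot>\<^bsub>monoid_algebra (subset_monoid G)\<^esub> basis_elem (carrier G))"

text \<open>The quotient ring by \<open>\<rat>\<chi>\<^sub>G\<close>, together with the induced scalar multiplication
  \<open>c (I + x) = I + c x\<close>, which \<^const>\<open>FactRing\<close> does not provide.\<close>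

definition gen_char_algebra ::
    "('a, 'm) monoid_scheme \<Rightarrow> (rat, ('a set \<Rightarrow> rat) set) module" where
  "gen_char_algebra G =
    (let A = monoid_algebra (subset_monoid G); I = contraction_ideal G in
     ring.extend (A Quot I)
       (module.fields (\<lambda>c X. \<Union>x\<in>X. I +>\<^bsub>A\<^esub> (c \<odot>\<^bsub>A\<^esub> x))))"

definition chi :: "('a, 'm) monoid_scheme \<Rightarrow> 'a set \<Rightarrow> ('a set \<Rightarrow> rat) set" where
  "chi G A = contraction_ideal G +>\<^bsub>monoid_algebra (subset_monoid G)\<^esub> basis_elem A"

definition minimal_subgroups :: "('a, 'm) monoid_scheme \<Rightarrow> 'a set set" where
  "minimal_subgroups G =
    {K. subgroup K G \<and> K \<noteq> {\<one>\<^bsub>G\<^esub>} \<and>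
        (\<forall>K'. subgroup K' G \<and> K' \<noteq> {\<one>\<^bsub>G\<^esub>} \<and> K' \<subseteq> K \<longrightarrow> K' = K)}"

text \<open>Elements of \<^term>\<open>G Mod N\<close> are cosets of \<open>N\<close>, so the subgroup \<open>L\<close> with \<open>L/N = K\<close>
  is the union \<open>\<Union>K\<close> of the cosets in \<open>K\<close>.\<close>

definition psi :: "('a, 'm) monoid_scheme \<Rightarrow> 'a set \<Rightarrow> ('a set \<Rightarrow> rat) set" where
  "psi G H =
    (\<Otimes>\<^bsub>gen_char_algebra G\<^esub>K\<in>minimal_subgroups (G Mod H).
       chi G H \<ominus>\<^bsub>gen_char_algebra G\<^esub> chi G (\<Union>K))"

definition check_elem :: "('a, 'm) monoid_scheme \<Rightarrow> 'a set \<Rightarrow> ('a set \<Rightarrow> rat) set" where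
  "check_elem G A =
    (1 / of_nat (card A)) \<odot>\<^bsub>gen_char_algebra G\<^esub> (\<Oplus>\<^bsub>gen_char_algebra G\<^esub>g\<in>A. chi G {g})"

definition check_epsilon :: "('a, 'm) monoid_scheme \<Rightarrow> 'a set \<Rightarrow> ('a set \<Rightarrow> rat) set" where
  "check_epsilon G N =
    check_elem G N \<otimes>\<^bsub>gen_char_algebra G\<^esub>
    (\<Otimes>\<^bsub>gen_char_algebra G\<^esub>K\<in>minimal_subgroups (G Mod N).
       \<one>\<^bsub>gen_char_algebra G\<^esub> \<ominus>\<^bsub>gen_char_algebra G\<^esub> check_elem G (\<Union>K))"

definition central_idempotent :: "('r, 'm) ring_scheme \<Rightarrow> 'r \<Rightarrow> bool" where
  "central_idempotent R e \<longleftrightarrow>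
    e \<in> carrier R \<and> e \<otimes>\<^bsub>R\<^esub> e = e \<and> (\<forall>x\<in>carrier R. e \<otimes>\<^bsub>R\<^esub> x = x \<otimes>\<^bsub>R\<^esub> e)"

definition primitive_central_idempotent :: "('r, 'm) ring_scheme \<Rightarrow> 'r \<Rightarrow> bool" where
  "primitive_central_idempotent R e \<longleftrightarrow>
    central_idempotent R e \<and> e \<noteq> \<zero>\<^bsub>R\<^esub> \<and>
    \<not> (\<exists>e1 e2. central_idempotent R e1 \<and> central_idempotent R e2 \<and>
          e1 \<noteq> \<zero>\<^bsub>R\<^esub> \<and> e2 \<noteq> \<zero>\<^bsub>R\<^esub> \<and>
          e1 \<otimes>\<^bsub>R\<^esub> e2 = \<zero>\<^bsub>R\<^esub> \<and> e = e1 \<oplus>\<^bsub>R\<^esub> e2)"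

end

theory Submission
  imports Defs "HOL-Number_Theory.Residues"
begin

text \<open>Every idempotent \<open>e\<close> of the rational algebra of a finite commutative monoid is fixed by the
  endomorphism \<open>s \<mapsto> s\<^sup>p\<close> for each prime \<open>p\<close> not dividing its denominators: \<open>e = e\<^sup>p\<close> is congruent
  to its image modulo \<open>p\<close>, and congruent idempotents agree. Hence \<open>e\<close> is fixed by \<open>s \<mapsto> s\<^sup>k\<close> for
  all \<open>k\<close> coprime to some \<open>D\<close>. For the monoid of nonempty subsets of \<open>G\<close> and large \<open>k\<close>,
  multiplication by \<open>\<psi>(G, H)\<close> kills \<open>\<chi>\<close> of \<open>B\<^sup>k\<close> unless \<open>B\<close> lies in a coset \<open>aH\<close>, where it
  becomes \<open>a\<^sup>k\<close>; and a sum of \<open>a\<^sup>k\<close> over the units \<open>k\<close> modulo \<open>|G|\<close> acts on \<open>\<epsilon>(G, N)\<close> as a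
  rational scalar, because the power sums over cyclic groups not inside \<open>N\<close> annihilate it. So
  \<open>e \<psi>(G, H) \<epsilon>(G, N)\<close> is a rational multiple of \<open>\<psi>(G, H) \<epsilon>(G, N)\<close>, which is therefore zero or
  primitive; no cyclotomic irreducibility is needed. If \<open>G/N\<close> is not cyclic then
  \<open>\<epsilon>(G, N) = 0\<close>; if it is cyclic and \<open>H \<subseteq> N\<close>, a complex character of \<open>G\<close> with kernel \<open>N\<close> extends
  to the algebra and takes the value 1 on the product. Choosing first \<open>H\<close> and then \<open>N\<close> maximal
  shows that every nonzero \<open>e\<close> meets one of these products.\<close>

section \<open>Arithmetic and group-theoretic preliminaries\<close>

text \<open>The core is a rationality statement. A priori an idempotent acts on one component of the
  algebra only by an element of a cyclotomic field. The scalar is rational because the sum of a^k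
  over the units k modulo |G| is Galois-stable; on the component of N it is a Ramanujan sum,
  obtained here by induction over gcd classes. What shapes the details is the choice of k. It has to
  lie in a prescribed unit class modulo |G|, be prime to the denominators of e, and be so large that
  B^k has become a coset of a subgroup. Therefore invariance of e is established for composite k as
  well, by composing prime steps, and a suitable k is reached by an explicit shift of the residue.
  Idempotents are first lifted to the uncontracted algebra, where the monoid elements are a basis
  and coefficients can be compared modulo p. On the other side, H different from G makes the
  extended character vanish at G, so that it descends to the contracted algebra.\<close>

lemma coprime_shift:
  fixes k m D :: nat
  assumes "coprime k m" and "D > 0"
  shows "\<exists>j. coprime (k + m * j) D"
proof -
  let ?P = "{p. prime p \<and> p dvd D \<and> \<not> p dvd k}"
  have fin: "finite ?P"
    by (rule finite_subset[OF _ finite_divisors_nat[OF assms(2)]]) auto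
  \<comment> \<open>The shift is the product of the primes of D that do not divide k. A prime of D
    dividing k divides neither m nor the product; any other prime of D divides the product but not
    k. So none divides the sum.\<close>
  have "coprime (k + m * \<Prod>?P) D"
  proof (rule ccontr)
    assume "\<not> coprime (k + m * \<Prod>?P) D"
    then have "gcd (k + m * \<Prod>?P) D \<noteq> 1" by (simp only: coprime_iff_gcd_eq_1 not_False_eq_True)
    then obtain p where "prime p" "p dvd gcd (k + m * \<Prod>?P) D"
      using prime_factor_nat by blast
    then have p: "prime p" "p dvd k + m * \<Prod>?P" "p dvd D" by (auto intro: dvd_trans)
    show False
    proof (cases "p dvd k")
      case True
      then have "p dvd m * \<Prod>?P"
        using p(2) by (simp add: dvd_add_right_iff)
      moreover have "\<not> p dvd m"
        using True assms(1) p(1) by (meson coprime_common_divisor not_prime_unit)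
      ultimately have "p dvd \<Prod>?P"
        using p(1) by (simp add: prime_dvd_mult_iff)
      then obtain q where "q \<in> ?P" "p dvd q"
        using fin p(1) by (auto simp: prime_dvd_prod_iff)
      with True p(1) show False
        by (metis (lifting) mem_Collect_eq primes_dvd_imp_eq)
    next
      case False
      with p have "p \<in> ?P" by simp
      then have "p dvd \<Prod>?P" using fin dvd_prodI[OF fin, of p "\<lambda>x. x"] by simp
      with p(2) False show False
        by (meson dvd_add_left_iff dvd_mult)
    qed
  qed
  then show ?thesis ..
qed

text \<open>Supplies the exponents of the main argument: above a threshold, prime to a denominator
  D, in a given unit class modulo |G|. The summand m * B secures the size before the coprimality
  shift is applied.\<close>

lemma coprime_shift_ge:
  fixes k m D B :: nat
  assumes "coprime k m" and "D > 0" and "m > 0"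
  obtains k' where "k' \<ge> B" "coprime k' D" "k' mod m = k mod m"
proof -
  have "coprime (k + m * B) m"
    using assms(1) gcd_add_mult[of m B k]
    by (simp only: coprime_iff_gcd_eq_1 gcd.commute[of _ m] add.commute[of k] mult.commute[of m])
  then obtain j where "coprime (k + m * B + m * j) D"
    using coprime_shift assms(2) by blast
  moreover have "k + m * B + m * j \<ge> B"
    using assms(3) by (simp add: trans_le_add1 trans_le_add2)
  moreover have "(k + m * B + m * j) mod m = k mod m"
    by (simp add: mod_add_eq)
  ultimately show ?thesis using that by blast
qed

text \<open>The ideal \<open>p\<^sup>i\<close> of the localization of the integers at \<open>p\<close>.\<close>

definition ploc :: "nat \<Rightarrow> nat \<Rightarrow> rat set" where
  "ploc p i = {of_int (int p ^ i * a) / of_int b | a b. \<not> int p dvd b}"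

lemma plocI: "\<not> int p dvd b \<Longrightarrow> of_int (int p ^ i * a) / of_int b \<in> ploc p i"
  unfolding ploc_def by blast

lemma zero_in_ploc: "prime p \<Longrightarrow> 0 \<in> ploc p i"
  using plocI[of p 1 i 0] by (auto simp: prime_nat_iff)

lemma ploc_add:
  assumes p: "prime p" and "x \<in> ploc p i" "y \<in> ploc p i"
  shows "x + y \<in> ploc p i"
proof -
  obtain a b where x: "x = of_int (int p ^ i * a) / of_int b" "\<not> int p dvd b"
    using assms(2) unfolding ploc_def by blast
  obtain c d where y: "y = of_int (int p ^ i * c) / of_int d" "\<not> int p dvd d"
    using assms(3) unfolding ploc_def by blast
  have nz: "b \<noteq> 0" "d \<noteq> 0" using x y by auto
  have "\<not> int p dvd b * d" using x y p by (simp add: prime_dvd_mult_iff)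
  moreover have "x + y = of_int (int p ^ i * (a * d + c * b)) / of_int (b * d)"
    using x y nz by (simp add: field_simps)
  ultimately show ?thesis using plocI by metis
qed

lemma ploc_mult:
  assumes p: "prime p" and "x \<in> ploc p i" "y \<in> ploc p j"
  shows "x * y \<in> ploc p (i + j)"
proof -
  obtain a b where x: "x = of_int (int p ^ i * a) / of_int b" "\<not> int p dvd b"
    using assms(2) unfolding ploc_def by blast
  obtain c d where y: "y = of_int (int p ^ j * c) / of_int d" "\<not> int p dvd d"
    using assms(3) unfolding ploc_def by blast
  have "\<not> int p dvd b * d" using x y p by (simp add: prime_dvd_mult_iff)
  moreover have "x * y = of_int (int p ^ (i + j) * (a * c)) / of_int (b * d)"
    using x y by (simp add: field_simps power_add)
  ultimately show ?thesis using plocI by metis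
qed

lemma of_int_ploc: "prime p \<Longrightarrow> int p ^ i dvd a \<Longrightarrow> of_int a \<in> ploc p i"
  using plocI[of p 1 i] by (auto simp: prime_nat_iff elim!: dvdE)

lemma ploc_uminus: "prime p \<Longrightarrow> x \<in> ploc p i \<Longrightarrow> - x \<in> ploc p i"
  using ploc_mult[of p "of_int (-1)" 0 x i] of_int_ploc[of p 0 "-1"] by simp

lemma ploc_diff: "prime p \<Longrightarrow> x \<in> ploc p i \<Longrightarrow> y \<in> ploc p i \<Longrightarrow> x - y \<in> ploc p i"
  using ploc_add[of p x i "-y"] ploc_uminus by simp

lemma ploc_sum: "prime p \<Longrightarrow> (\<And>x. x \<in> A \<Longrightarrow> f x \<in> ploc p i) \<Longrightarrow> sum f A \<in> ploc p i"
  by (induction A rule: infinite_finite_induct) (auto simp: zero_in_ploc ploc_add)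

lemma ploc_antimono:
  assumes p: "prime p" and "x \<in> ploc p i" "j \<le> i" shows "x \<in> ploc p j"
proof -
  obtain a b where x: "x = of_int (int p ^ i * a) / of_int b" "\<not> int p dvd b"
    using assms(2) unfolding ploc_def by blast
  have "int p ^ i * a = int p ^ j * (int p ^ (i - j) * a)"
    using assms(3) by (simp flip: mult.assoc power_add)
  then show ?thesis using x plocI by metis
qed

lemma int_fermat:
  assumes "prime p" shows "int p dvd a ^ p - a"
proof (cases "int p dvd a")
  case True
  then have "int p dvd a ^ p" using prime_gt_0_nat[OF assms] by (metis dvd_power dvd_trans)
  with True show ?thesis by simp
next
  case False
  define c where "c = nat (a mod int p)"
  have c: "int c = a mod int p"
    using prime_gt_0_nat[OF assms] by (simp add: c_def)
  then have "\<not> p dvd c" using False by (metis dvd_mod_iff dvd_refl int_dvd_int_iff)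
  then have "[int c ^ (p - 1) = 1] (mod int p)"
    using fermat_theorem[OF assms] by (metis cong_int_iff of_nat_1 of_nat_power)
  then have "[a ^ (p - 1) = 1] (mod int p)"
    unfolding c by (simp add: cong_def power_mod)
  then have "int p dvd a ^ (p - 1) - 1" by (simp add: cong_iff_dvd_diff)
  then have "int p dvd a * (a ^ (p - 1) - 1)" by simp
  moreover have "a * a ^ (p - 1) = a ^ p"
    using prime_gt_0_nat[OF assms] by (simp flip: power_Suc)
  ultimately show ?thesis by (simp add: algebra_simps)
qed

lemma ploc_fermat:
  assumes p: "prime p" and "x \<in> ploc p 0" shows "x ^ p - x \<in> ploc p 1"
proof -
  obtain a b where x: "x = of_int a / of_int b" "\<not> int p dvd b"
    using assms(2) unfolding ploc_def by auto
  have b: "b \<noteq> 0" using x by auto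
  \<comment> \<open>Over the denominator b^(p+1) the numerator of x^p - x is a^p b - a b^p. Adding
    and subtracting a b lets Fermat apply to a and b separately.\<close>
  have "int p dvd b * (a ^ p - a) - a * (b ^ p - b)"
    by (intro dvd_diff dvd_mult int_fermat[OF p])
  then obtain c where c: "b * (a ^ p - a) - a * (b ^ p - b) = int p * c" by (elim dvdE)
  have "\<not> int p dvd b ^ p * b"
    using x p by (auto simp: prime_dvd_mult_iff prime_dvd_power_iff prime_gt_0_nat)
  moreover have "x ^ p - x = of_int (a ^ p * b - a * b ^ p) / of_int (b ^ p * b)"
    using b unfolding x by (simp add: field_simps)
  moreover have "a ^ p * b - a * b ^ p = int p ^ 1 * c" using c by (simp add: algebra_simps)
  ultimately show ?thesis using plocI by metis
qed

text \<open>Krull intersection for a discrete valuation ring: a nonzero numerator u would be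
  divisible by p^i for every i, in particular for i = |u|, although p^|u| > |u|.\<close>

lemma ploc_Inter:
  assumes p: "prime p" and x: "\<And>i. x \<in> ploc p i" shows "x = 0"
proof (rule ccontr)
  assume "x \<noteq> 0"
  obtain u v where uv: "x = of_int u / of_int v" "v > 0"
    by (metis quotient_of_denom_pos quotient_of_div surj_pair)
  have "u \<noteq> 0" using \<open>x \<noteq> 0\<close> uv by auto
  have dvd: "int p ^ i dvd u" for i
  proof -
    obtain a b where ab: "x = of_int (int p ^ i * a) / of_int b" "\<not> int p dvd b"
      using x[of i] unfolding ploc_def by blast
    then have "of_int (u * b) = (of_int (int p ^ i * a * v) :: rat)"
      using uv by (auto simp: field_simps)
    then have "u * b = int p ^ i * a * v" by (simp only: of_int_eq_iff)
    then have "int p ^ i dvd u * b" by simp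
    moreover have "coprime (int p ^ i) b"
      using ab p by (auto intro!: coprime_power_left_iff[THEN iffD2] prime_imp_coprime)
    ultimately show ?thesis by (simp add: coprime_dvd_mult_left_iff)
  qed
  have "int p ^ nat \<bar>u\<bar> \<le> \<bar>u\<bar>"
    using dvd_imp_le_int[OF \<open>u \<noteq> 0\<close> dvd] by (simp add: power_abs)
  moreover have "nat \<bar>u\<bar> < p ^ nat \<bar>u\<bar>"
    using p by (intro power_gt_expt) (use prime_gt_1_nat in force)
  ultimately show False
    by (metis \<open>u \<noteq> 0\<close> leD nat_less_iff of_nat_power zero_le_power abs_ge_zero int_nat_eq of_nat_less_iff)
qed

section \<open>A cyclicity criterion for finite abelian groups\<close>

lemma (in group) range_pow_eq:
  assumes "finite (carrier G)" "a \<in> carrier G"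
  shows "range (\<lambda>n::int. a [^] n) = range (\<lambda>n::nat. a [^] n)"
proof
  show "range (\<lambda>n::nat. a [^] n) \<subseteq> range (\<lambda>n::int. a [^] n)"
    by (metis int_pow_int range_subsetD rangeI image_subsetI)
  show "range (\<lambda>n::int. a [^] n) \<subseteq> range (\<lambda>n::nat. a [^] n)"
  proof clarify
    fix n :: int
    have "ord a > 0" using assms ord_ge_1[of a] by simp
    then have "a [^] n = a [^] (n mod int (ord a))"
      using assms(2) int_pow_eq[of a] by (simp add: mod_eq_dvd_iff[symmetric])
    also have "\<dots> = a [^] nat (n mod int (ord a))"
      using \<open>ord a > 0\<close> by (metis int_pow_int nat_int pos_mod_sign of_nat_0_less_iff nat_0_le)
    finally show "a [^] n \<in> range (\<lambda>n::nat. a [^] n)" by simp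
  qed
qed

text \<open>A cyclic subgroup of maximal order is everything: an element \<open>x\<close> outside it, taken with
  \<open>x\<^sup>p = a\<^sup>k\<close> in it, either has a translate generating a larger cyclic subgroup, or yields a
  second subgroup of order \<open>p\<close>.\<close>

lemma (in comm_group) cyclic_group_if_unique_prime_order:
  assumes fin: "finite (carrier G)"
    and uniq: "\<And>p x y. \<lbrakk>prime p; x \<in> carrier G; y \<in> carrier G; x [^] (p::nat) = \<one>; y [^] p = \<one>; y \<noteq> \<one>\<rbrakk>
      \<Longrightarrow> x \<in> range (\<lambda>n::nat. y [^] n)"
  shows "cyclic_group G"
proof -
  define C where "C a = range (\<lambda>n::nat. a [^] n)" for a
  have C_sub: "C a \<subseteq> carrier G" if "a \<in> carrier G" for a
    using that unfolding C_def by auto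
  have C_pow: "C b \<subseteq> C a" if "b \<in> C a" "a \<in> carrier G" for a b
    using that unfolding C_def by (auto simp: nat_pow_pow)
  have self: "a \<in> C a" if "a \<in> carrier G" for a
    unfolding C_def using that by (metis nat_pow_eone rangeI)
  have bdd: "card (C a) \<le> card (carrier G)" if "a \<in> carrier G" for a
    using C_sub fin that by (simp add: card_mono)
  obtain a where a: "a \<in> carrier G" and max: "\<And>b. b \<in> carrier G \<Longrightarrow> card (C b) \<le> card (C a)"
  proof -
    have "finite ((\<lambda>b. card (C b)) ` carrier G)" "(\<lambda>b. card (C b)) ` carrier G \<noteq> {}"
      using fin by auto
    then obtain a where "a \<in> carrier G" "card (C a) = Max ((\<lambda>b. card (C b)) ` carrier G)"
      by (metis (no_types, lifting) Max_in imageE)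
    then show ?thesis using that fin by (metis Max_ge finite_imageI imageI)
  qed
  have C_mult: "b \<otimes> c \<in> C a" if "b \<in> C a" "c \<in> C a" for b c
    using that a unfolding C_def by (auto simp: nat_pow_mult)
  have maximal: "b \<in> C a" if b: "b \<in> carrier G" "a \<in> C b" for b
  proof -
    have "C a \<subseteq> C b" using C_pow that by blast
    moreover have "finite (C b)" using C_sub b fin finite_subset by blast
    ultimately have "C a = C b" using max[OF b(1)] by (simp add: card_seteq)
    then show ?thesis using self b by blast
  qed
  define n where "n = ord a"
  have n: "n > 0" "a [^] n = \<one>" using a fin using ord_ge_1[of a] by (simp_all add: n_def pow_ord_eq_1 Suc_le_eq)
  have C_inv: "\<exists>c\<in>C a. b \<otimes> c = \<one>" if "b \<in> C a" for b
  proof -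
    obtain k :: nat where k: "b = a [^] k" using \<open>b \<in> C a\<close> unfolding C_def by auto
    have "b \<otimes> a [^] (n * k - k) = a [^] (n * k)"
      using a n unfolding k by (simp add: nat_pow_mult)
    also have "\<dots> = \<one>" using a n by (metis nat_pow_one nat_pow_pow)
    finally show ?thesis unfolding C_def by blast
  qed
  have C_cancel: "x \<in> C a" if "x \<in> carrier G" "x \<otimes> b \<in> C a" "b \<in> C a" for x b
  proof -
    obtain c where c: "c \<in> C a" "b \<otimes> c = \<one>" using C_inv \<open>b \<in> C a\<close> by blast
    have "x = x \<otimes> b \<otimes> c"
      using that c C_sub[OF a] by (metis m_assoc r_one subsetD)
    then show ?thesis using C_mult c that by metis
  qed
  have "C a = carrier G"
  proof (rule ccontr)
    assume "C a \<noteq> carrier G"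
    then obtain x0 where x0: "x0 \<in> carrier G" "x0 \<notin> C a" using C_sub a by blast
    \<comment> \<open>The least positive power of \<open>x0\<close> lying in \<open>C a\<close>.
      Lowering it by a prime factor p yields x outside \<open>C a\<close> with x^p inside.\<close>
    define m where "m = (LEAST m::nat. m > 0 \<and> x0 [^] m \<in> C a)"
    have "x0 [^] order G = \<one>" "order G > 0" using x0 fin by (simp_all add: pow_order_eq_1 order_gt_0_iff_finite)
    moreover have "\<one> \<in> C a" unfolding C_def by (metis nat_pow_0 rangeI)
    ultimately have ex: "order G > 0 \<and> x0 [^] order G \<in> C a" by simp
    have m: "m > 0" "x0 [^] m \<in> C a" using LeastI[of "\<lambda>m. m > 0 \<and> x0 [^] m \<in> C a", OF ex]
      unfolding m_def by auto
    have least: "x0 [^] j \<notin> C a" if "j > 0" "j < m" for j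
      using not_less_Least[of j "\<lambda>m. m > 0 \<and> x0 [^] m \<in> C a"] that unfolding m_def by auto
    have "m \<noteq> 1" using m x0 by auto
    then obtain p where p: "prime p" "p dvd m" using prime_factor_nat by blast
    define x where "x = x0 [^] (m div p)"
    have x: "x \<in> carrier G" "x \<notin> C a"
      using x0 least[of "m div p"] p m prime_gt_1_nat[of p] by (auto simp: x_def div_greater_zero_iff dvd_imp_le)
    have "x [^] p = x0 [^] m" using x0 p by (simp add: x_def nat_pow_pow)
    then obtain k0 :: nat where k0: "x [^] p = a [^] k0" using m unfolding C_def by auto
    \<comment> \<open>When k + p j is prime to n = ord a, the p-th power of b = x a^j generates
      \<open>C a\<close>. So a is a power of b, and \<open>maximal\<close> puts b, hence x, into
      \<open>C a\<close>.\<close>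
    have case1: False if k: "x [^] p = a [^] k" "\<not> p dvd k" for k :: nat
    proof -
      have "coprime k p" using k p by (metis coprime_commute prime_imp_coprime)
      then obtain j where j: "coprime (k + p * j) n" using coprime_shift n by blast
      define b where "b = x \<otimes> a [^] j"
      have b: "b \<in> carrier G" using x a by (simp add: b_def)
      have bp: "b [^] p = a [^] (k + p * j)"
        using x a k by (simp add: b_def nat_pow_distrib nat_pow_pow nat_pow_mult mult.commute)
      obtain l where l: "[(k + p * j) * l = 1] (mod n)" using j cong_solve_coprime_nat by auto
      have "int (ord a) dvd int ((k + p * j) * l) - 1"
        using l by (simp add: n_def cong_iff_dvd_diff flip: cong_int_iff)
      then have "a [^] ((k + p * j) * l) = a [^] (1::nat)"
        using int_pow_eq[OF a, of 1 "int ((k + p * j) * l)"] a by (simp add: int_pow_int del: of_nat_mult of_nat_add)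
      then have "b [^] (p * l) = a" using a b bp by (metis nat_pow_eone nat_pow_pow)
      then have "a \<in> C b" unfolding C_def by blast
      then have "b \<in> C a" using maximal b by blast
      moreover have "a [^] j \<in> C a" unfolding C_def by blast
      ultimately show False using C_cancel x unfolding b_def by blast
    qed
    have pk0: "p dvd k0" using case1 k0 by blast
    show False
    proof (cases "p dvd n")
      case False
      \<comment> \<open>Adding n leaves the power unchanged; since p divides \<open>k0\<close> but
        not n, the new exponent is prime to p and \<open>case1\<close> applies.\<close>
      have "x [^] p = a [^] (k0 + n)" using a n k0 by (simp flip: nat_pow_mult)
      moreover have "\<not> p dvd k0 + n" using False pk0 by (simp add: dvd_add_right_iff)
      ultimately show False using case1 by blast
    next
      case True
      obtain q where q: "k0 = p * q" using pk0 by blast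
      \<comment> \<open>c is the inverse of a^q, so (x c)^p = 1. As a^(n/p) is nontrivial with p-th
        power 1, uniqueness makes x c one of its powers, which lie in \<open>C a\<close>.\<close>
      obtain c where c: "c \<in> C a" "a [^] q \<otimes> c = \<one>" using C_inv[of "a [^] q"] unfolding C_def by auto
      have cc: "c \<in> carrier G" using c C_sub a by blast
      have "(x \<otimes> c) [^] p = (a [^] q \<otimes> c) [^] p"
        using x cc a k0 q by (simp add: nat_pow_distrib nat_pow_pow mult.commute)
      then have "(x \<otimes> c) [^] p = \<one>" using c by simp
      moreover have "(a [^] (n div p)) [^] p = \<one>" using True a n by (simp add: nat_pow_pow)
      moreover have "a [^] (n div p) \<noteq> \<one>"
      proof
        assume "a [^] (n div p) = \<one>"
        then have "n dvd n div p" using a n_def pow_eq_id by blast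
        then have "n \<le> n div p" using True n p by (metis dvd_imp_le div_greater_zero_iff prime_gt_0_nat)
        then show False using n p prime_gt_1_nat by (meson div_less_dividend leD)
      qed
      ultimately have "x \<otimes> c \<in> range (\<lambda>i::nat. (a [^] (n div p)) [^] i)"
        using uniq[OF p(1)] x cc a by simp
      then have "x \<otimes> c \<in> C a" using a unfolding C_def by (auto simp: nat_pow_pow)
      then show False using C_cancel c x by blast
    qed
  qed
  then show ?thesis using a range_pow_eq[OF fin a] unfolding cyclic_group C_def by metis
qed

section \<open>Idempotents of rational monoid algebras\<close>

lemma (in cring) binomial_expansion:
  assumes x: "x \<in> carrier R" and y: "y \<in> carrier R"
  shows "(x \<oplus> y) [^] (n::nat) = (\<Oplus>k\<in>{..n}. [(n choose k)] \<cdot> (x [^] k \<otimes> y [^] (n - k)))"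
proof (induction n)
  case 0
  show ?case using x y by (simp add: add.nat_pow_eone)
next
  case (Suc n)
  \<comment> \<open>The coefficient stays at n while the exponents follow m. One half of Pascal's
    rule is then \<open>T n k\<close> times x; the other is a term of \<open>T (Suc n)\<close>,
    whose sum is that of \<open>T n\<close> times y because n choose n + 1 is 0.\<close>
  define T where "T m j = [(n choose j)] \<cdot> (x [^] j \<otimes> y [^] (m - j))" for m j
  have T: "T m j \<in> carrier R" for m j
    using x y by (simp add: T_def)
  have "(\<Oplus>k\<in>{..Suc n}. [(Suc n choose k)] \<cdot> (x [^] k \<otimes> y [^] (Suc n - k)))
      = (\<Oplus>k\<in>{..n}. [(n choose k)] \<cdot> (x [^] Suc k \<otimes> y [^] (n - k)) \<oplus> T (Suc n) (Suc k)) \<oplus> T (Suc n) 0"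
    using x y by (subst finsum_Suc2) (auto simp: T_def add.nat_pow_mult intro!: arg_cong2[where f = "(\<oplus>)"] add.finprod_cong')
  also have "\<dots> = (\<Oplus>k\<in>{..n}. [(n choose k)] \<cdot> (x [^] Suc k \<otimes> y [^] (n - k)))
      \<oplus> ((\<Oplus>k\<in>{..n}. T (Suc n) (Suc k)) \<oplus> T (Suc n) 0)"
    using x y T by (subst finsum_addf) (auto simp: a_assoc)
  also have "(\<Oplus>k\<in>{..n}. T (Suc n) (Suc k)) \<oplus> T (Suc n) 0 = (\<Oplus>k\<in>{..Suc n}. T (Suc n) k)"
    using T by (subst finsum_Suc2) auto
  also have "\<dots> = (\<Oplus>k\<in>{..n}. T (Suc n) k)"
    using T x y by (subst finsum_Suc) (auto simp: T_def binomial_eq_0 add.nat_pow_0)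
  also have "\<dots> = (\<Oplus>k\<in>{..n}. T n k) \<otimes> y"
    using x y T by (subst finsum_ldistr)
      (auto simp: T_def add_pow_ldistr m_assoc Suc_diff_le intro!: add.finprod_cong')
  also have "(\<Oplus>k\<in>{..n}. [(n choose k)] \<cdot> (x [^] Suc k \<otimes> y [^] (n - k))) = (\<Oplus>k\<in>{..n}. T n k) \<otimes> x"
    using x y T by (subst finsum_ldistr)
      (auto simp: T_def add_pow_ldistr add_pow_rdistr m_ac intro!: add.finprod_cong')
  finally have "(\<Oplus>k\<in>{..Suc n}. [(Suc n choose k)] \<cdot> (x [^] k \<otimes> y [^] (Suc n - k)))
     = (\<Oplus>k\<in>{..n}. T n k) \<otimes> (x \<oplus> y)"
    using x y T by (simp add: r_distr)
  also have "(\<Oplus>k\<in>{..n}. T n k) = (x \<oplus> y) [^] n" using Suc.IH by (simp add: T_def)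
  finally show ?case by simp
qed

section \<open>The rational algebra of a finite commutative monoid\<close>

definition single :: "'s \<Rightarrow> rat \<Rightarrow> 's \<Rightarrow> rat" where
  "single s c = (\<lambda>u. if u = s then c else 0)"

text \<open>The linear extension of \<open>h\<close> to the monoid algebra, as the push-forward of
  the coefficients.\<close>

definition push :: "('s, 'm) monoid_scheme \<Rightarrow> ('s \<Rightarrow> 's) \<Rightarrow> ('s \<Rightarrow> rat) \<Rightarrow> 's \<Rightarrow> rat" where
  "push S h f = (\<lambda>u. \<Sum>s\<in>carrier S. if h s = u then f s else 0)"

text \<open>The linear functional taking the value \<open>w s\<close> at the basis element s. The
  target field is left open: rational weights separate elements, complex weights give the
  characters.\<close>

definition integ :: "('s, 'm) monoid_scheme \<Rightarrow> ('s \<Rightarrow> 'c) \<Rightarrow> ('s \<Rightarrow> rat) \<Rightarrow> 'c::field_char_0" where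
  "integ S w f = (\<Sum>s\<in>carrier S. of_rat (f s) * w s)"

locale finite_comm_monoid = comm_monoid S for S (structure) +
  assumes fin: "finite (carrier S)"
begin

abbreviation A where "A \<equiv> monoid_algebra S"

lemma carrier_A: "f \<in> carrier A \<longleftrightarrow> (\<forall>s. s \<notin> carrier S \<longrightarrow> f s = 0)"
proof -
  have "finite {s. f s \<noteq> 0}" if "{s. f s \<noteq> 0} \<subseteq> carrier S"
    using that fin finite_subset by blast
  then show ?thesis by (auto simp: monoid_algebra_def)
qed

lemma A_simps:
  "\<zero>\<^bsub>A\<^esub> = (\<lambda>_. 0)" "f \<oplus>\<^bsub>A\<^esub> g = (\<lambda>u. f u + g u)" "c \<odot>\<^bsub>A\<^esub> f = (\<lambda>u. c * f u)"
  "\<one>\<^bsub>A\<^esub> = single \<one> 1"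
  by (simp_all add: monoid_algebra_def single_def)

lemma mult_A:
  assumes "f \<in> carrier A" "g \<in> carrier A"
  shows "(f \<otimes>\<^bsub>A\<^esub> g) u = (\<Sum>s\<in>carrier S. \<Sum>t\<in>carrier S. if s \<otimes> t = u then f s * g t else 0)"
proof -
  have "(f \<otimes>\<^bsub>A\<^esub> g) u = (\<Sum>(s, t)\<in>carrier S \<times> carrier S. if s \<otimes> t = u then f s * g t else 0)"
    unfolding monoid_algebra_def using assms fin
    by (auto simp: carrier_A split: if_splits intro!: sum.mono_neutral_cong_left)
  then show ?thesis by (simp add: sum.cartesian_product)
qed

lemma mult_A_closed:
  assumes "f \<in> carrier A" "g \<in> carrier A"
  shows "f \<otimes>\<^bsub>A\<^esub> g \<in> carrier A"
  unfolding carrier_A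
proof (intro allI impI)
  fix u assume "u \<notin> carrier S"
  then show "(f \<otimes>\<^bsub>A\<^esub> g) u = 0"
    unfolding mult_A[OF assms] by (intro sum.neutral ballI) auto
qed

lemma integ_mult_A:
  assumes "f \<in> carrier A" "g \<in> carrier A"
  shows "integ S w (f \<otimes>\<^bsub>A\<^esub> g)
    = (\<Sum>s\<in>carrier S. \<Sum>t\<in>carrier S. of_rat (f s) * of_rat (g t) * w (s \<otimes> t))"
proof -
  have "integ S w (f \<otimes>\<^bsub>A\<^esub> g) = (\<Sum>u\<in>carrier S. \<Sum>s\<in>carrier S. \<Sum>t\<in>carrier S.
      if s \<otimes> t = u then of_rat (f s) * of_rat (g t) * w u else 0)"
    unfolding integ_def mult_A[OF assms] of_rat_sum sum_distrib_right
    by (intro sum.cong refl) (auto simp: of_rat_mult)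
  also have "\<dots> = (\<Sum>s\<in>carrier S. \<Sum>t\<in>carrier S. \<Sum>u\<in>carrier S.
      if s \<otimes> t = u then of_rat (f s) * of_rat (g t) * w u else 0)"
    by (subst sum.swap) (intro sum.cong refl sum.swap)
  also have "\<dots> = (\<Sum>s\<in>carrier S. \<Sum>t\<in>carrier S. of_rat (f s) * of_rat (g t) * w (s \<otimes> t))"
    using fin by (intro sum.cong refl) (simp add: sum.delta')
  finally show ?thesis .
qed

lemma eval_eq_integ:
  "f \<in> carrier A \<Longrightarrow> f v = integ S (\<lambda>s. if s = v then 1 else 0) f"
  using fin by (simp add: integ_def carrier_A of_rat_eq_id if_distrib sum.delta cong: if_cong)

text \<open>Coefficients are themselves functionals, with indicator weights. Together with
  \<open>integ_mult_A\<close>, where the constraint s t = u has disappeared, this turns identities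
  in the algebra into rearrangements of finite sums.\<close>

lemma A_eqI:
  assumes "f \<in> carrier A" "g \<in> carrier A"
    "\<And>w :: 'a \<Rightarrow> rat. integ S w f = integ S w g"
  shows "f = g"
  using assms eval_eq_integ by (metis ext)

lemma integ_linear:
  "integ S w (f \<oplus>\<^bsub>A\<^esub> g) = integ S w f + integ S w g"
  "integ S w (c \<odot>\<^bsub>A\<^esub> f) = of_rat c * integ S w f"
  by (simp_all add: integ_def A_simps of_rat_add of_rat_mult algebra_simps sum.distrib sum_distrib_left)

lemma integ_single: "s \<in> carrier S \<Longrightarrow> integ S w (single s c) = of_rat c * w s"
proof -
  assume s: "s \<in> carrier S"
  have "integ S w (single s c) = (\<Sum>u\<in>carrier S. if u = s then of_rat c * w s else 0)"
    unfolding integ_def single_def by (intro sum.cong) auto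
  then show ?thesis using s fin by simp
qed

lemma integ_mult_hom:
  assumes "f \<in> carrier A" "g \<in> carrier A"
    and "\<And>s t. s \<in> carrier S \<Longrightarrow> t \<in> carrier S \<Longrightarrow> w (s \<otimes> t) = w s * w t"
  shows "integ S w (f \<otimes>\<^bsub>A\<^esub> g) = integ S w f * integ S w g"
  unfolding integ_mult_A[OF assms(1,2)] unfolding integ_def sum_product
  by (intro sum.cong refl) (simp add: assms(3))

lemma single_closed [simp]: "s \<in> carrier S \<Longrightarrow> single s c \<in> carrier A"
  by (auto simp: carrier_A single_def)

lemma add_A_closed: "f \<in> carrier A \<Longrightarrow> g \<in> carrier A \<Longrightarrow> f \<oplus>\<^bsub>A\<^esub> g \<in> carrier A"
  by (simp add: carrier_A A_simps)

lemma smult_A_closed [simp]: "f \<in> carrier A \<Longrightarrow> c \<odot>\<^bsub>A\<^esub> f \<in> carrier A"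
  by (simp add: carrier_A A_simps)

lemma cring_A: "cring A"
proof (rule cringI)
  show "abelian_group A"
  proof (rule abelian_groupI)
    fix x assume "x \<in> carrier A"
    then show "\<exists>y\<in>carrier A. y \<oplus>\<^bsub>A\<^esub> x = \<zero>\<^bsub>A\<^esub>"
      by (intro bexI[of _ "\<lambda>u. - x u"]) (auto simp: carrier_A A_simps)
  qed (auto simp: carrier_A A_simps)
  show "comm_monoid A"
  proof (rule comm_monoidI)
    fix f g assume fg: "f \<in> carrier A" "g \<in> carrier A"
    then show "f \<otimes>\<^bsub>A\<^esub> g \<in> carrier A" by (simp add: mult_A_closed)
    show "f \<otimes>\<^bsub>A\<^esub> g = g \<otimes>\<^bsub>A\<^esub> f"
    proof (rule A_eqI)
      fix w :: "'a \<Rightarrow> rat"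
      show "integ S w (f \<otimes>\<^bsub>A\<^esub> g) = integ S w (g \<otimes>\<^bsub>A\<^esub> f)"
        using fg by (simp add: integ_mult_A) (subst sum.swap, intro sum.cong refl, simp add: m_comm)
    qed (use fg in \<open>simp_all add: mult_A_closed\<close>)
  next
    show "\<one>\<^bsub>A\<^esub> \<in> carrier A" by (simp add: A_simps)
  next
    fix f g h assume fgh: "f \<in> carrier A" "g \<in> carrier A" "h \<in> carrier A"
    show "f \<otimes>\<^bsub>A\<^esub> g \<otimes>\<^bsub>A\<^esub> h = f \<otimes>\<^bsub>A\<^esub> (g \<otimes>\<^bsub>A\<^esub> h)"
    proof (rule A_eqI)
      fix w :: "'a \<Rightarrow> rat"
      have "integ S w (f \<otimes>\<^bsub>A\<^esub> g \<otimes>\<^bsub>A\<^esub> h)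
        = (\<Sum>t\<in>carrier S. integ S (\<lambda>s. w (s \<otimes> t)) (f \<otimes>\<^bsub>A\<^esub> g) * of_rat (h t))"
        unfolding integ_mult_A[OF mult_A_closed[OF fgh(1,2)] fgh(3)]
        by (subst sum.swap) (simp add: integ_def sum_distrib_left mult_ac)
      also have "\<dots> = (\<Sum>t\<in>carrier S. \<Sum>s\<in>carrier S. \<Sum>r\<in>carrier S.
          of_rat (f s) * of_rat (g r) * w (s \<otimes> r \<otimes> t) * of_rat (h t))"
        using fgh by (simp add: integ_mult_A sum_distrib_right)
      also have "\<dots> = (\<Sum>s\<in>carrier S. \<Sum>t\<in>carrier S. \<Sum>r\<in>carrier S.
          of_rat (f s) * of_rat (g r) * w (s \<otimes> r \<otimes> t) * of_rat (h t))"
        by (rule sum.swap)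
      also have "\<dots> = (\<Sum>s\<in>carrier S. \<Sum>r\<in>carrier S. \<Sum>t\<in>carrier S.
          of_rat (f s) * of_rat (g r) * w (s \<otimes> r \<otimes> t) * of_rat (h t))"
        by (intro sum.cong refl sum.swap)
      also have "\<dots> = (\<Sum>s\<in>carrier S. of_rat (f s) * (\<Sum>r\<in>carrier S. \<Sum>t\<in>carrier S.
          of_rat (g r) * of_rat (h t) * w (s \<otimes> (r \<otimes> t))))"
        unfolding sum_distrib_left by (intro sum.cong refl) (simp add: m_assoc)
      also have "\<dots> = (\<Sum>s\<in>carrier S. of_rat (f s) * integ S (\<lambda>t. w (s \<otimes> t)) (g \<otimes>\<^bsub>A\<^esub> h))"
        using fgh by (simp add: integ_mult_A)
      also have "\<dots> = integ S w (f \<otimes>\<^bsub>A\<^esub> (g \<otimes>\<^bsub>A\<^esub> h))"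
        unfolding integ_mult_A[OF fgh(1) mult_A_closed[OF fgh(2,3)]]
        by (simp add: integ_def sum_distrib_left mult_ac)
      finally show "integ S w (f \<otimes>\<^bsub>A\<^esub> g \<otimes>\<^bsub>A\<^esub> h) = integ S w (f \<otimes>\<^bsub>A\<^esub> (g \<otimes>\<^bsub>A\<^esub> h))" .
    qed (use fgh in \<open>simp_all add: mult_A_closed\<close>)
  next
    fix f assume fgh: "f \<in> carrier A"
    show "\<one>\<^bsub>A\<^esub> \<otimes>\<^bsub>A\<^esub> f = f"
    proof (rule A_eqI)
      fix w :: "'a \<Rightarrow> rat"
      have "integ S w (\<one>\<^bsub>A\<^esub> \<otimes>\<^bsub>A\<^esub> f)
         = (\<Sum>s\<in>carrier S. of_rat (single \<one> 1 s) * (\<Sum>t\<in>carrier S. of_rat (f t) * w (s \<otimes> t)))"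
        using fgh by (simp add: A_simps integ_mult_A sum_distrib_left mult_ac)
      also have "\<dots> = integ S (\<lambda>s. \<Sum>t\<in>carrier S. of_rat (f t) * w (s \<otimes> t)) (single \<one> 1)"
        by (simp add: integ_def)
      also have "\<dots> = integ S w f"
        by (simp add: integ_single) (simp add: integ_def)
      finally show "integ S w (\<one>\<^bsub>A\<^esub> \<otimes>\<^bsub>A\<^esub> f) = integ S w f" .
    qed (use fgh in \<open>simp_all add: mult_A_closed A_simps\<close>)
  qed
  fix f g h assume fgh: "f \<in> carrier A" "g \<in> carrier A" "h \<in> carrier A"
  show "(f \<oplus>\<^bsub>A\<^esub> g) \<otimes>\<^bsub>A\<^esub> h = f \<otimes>\<^bsub>A\<^esub> h \<oplus>\<^bsub>A\<^esub> g \<otimes>\<^bsub>A\<^esub> h"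
  proof (rule A_eqI)
    fix w :: "'a \<Rightarrow> rat"
    show "integ S w ((f \<oplus>\<^bsub>A\<^esub> g) \<otimes>\<^bsub>A\<^esub> h) = integ S w (f \<otimes>\<^bsub>A\<^esub> h \<oplus>\<^bsub>A\<^esub> g \<otimes>\<^bsub>A\<^esub> h)"
      using fgh by (simp add: integ_mult_A integ_linear add_A_closed)
        (simp add: A_simps of_rat_add algebra_simps sum.distrib)
  qed (use fgh in \<open>simp_all add: mult_A_closed add_A_closed\<close>)
qed

sublocale A: cring A by (rule cring_A)

lemma push_closed:
  assumes "h \<in> carrier S \<rightarrow> carrier S"
  shows "push S h f \<in> carrier A"
  unfolding carrier_A push_def
proof (intro allI impI sum.neutral ballI)
  fix u s assume "u \<notin> carrier S" "s \<in> carrier S"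
  then show "(if h s = u then f s else 0) = 0" using assms by auto
qed

lemma integ_push:
  assumes "h \<in> carrier S \<rightarrow> carrier S"
  shows "integ S w (push S h f) = integ S (\<lambda>s. w (h s)) f"
proof -
  have "integ S w (push S h f)
    = (\<Sum>u\<in>carrier S. \<Sum>s\<in>carrier S. if h s = u then of_rat (f s) * w u else 0)"
    unfolding integ_def push_def of_rat_sum sum_distrib_right by (intro sum.cong refl) auto
  also have "\<dots> = (\<Sum>s\<in>carrier S. \<Sum>u\<in>carrier S. if h s = u then of_rat (f s) * w u else 0)"
    by (rule sum.swap)
  also have "\<dots> = integ S (\<lambda>s. w (h s)) f"
    unfolding integ_def using assms fin by (intro sum.cong refl) (auto simp: sum.delta')
  finally show ?thesis .
qed

lemma push_mult:
  assumes h: "h \<in> carrier S \<rightarrow> carrier S"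
    and hom: "\<And>s t. s \<in> carrier S \<Longrightarrow> t \<in> carrier S \<Longrightarrow> h (s \<otimes> t) = h s \<otimes> h t"
    and fg: "f \<in> carrier A" "g \<in> carrier A"
  shows "push S h (f \<otimes>\<^bsub>A\<^esub> g) = push S h f \<otimes>\<^bsub>A\<^esub> push S h g"
proof (rule A_eqI)
  fix w :: "'a \<Rightarrow> rat"
  have "integ S w (push S h f \<otimes>\<^bsub>A\<^esub> push S h g)
    = (\<Sum>s\<in>carrier S. of_rat (push S h f s) * integ S (\<lambda>t. w (s \<otimes> t)) (push S h g))"
    using push_closed[OF h] by (simp add: integ_mult_A) (simp add: integ_def sum_distrib_left mult_ac)
  also have "\<dots> = integ S (\<lambda>s. integ S (\<lambda>t. w (s \<otimes> t)) (push S h g)) (push S h f)"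
    by (simp add: integ_def)
  also have "\<dots> = integ S (\<lambda>s. integ S (\<lambda>t. w (h s \<otimes> h t)) g) f"
    by (simp only: integ_push[OF h])
  also have "\<dots> = integ S (\<lambda>u. w (h u)) (f \<otimes>\<^bsub>A\<^esub> g)"
    using fg unfolding integ_mult_A[OF fg] unfolding integ_def sum_distrib_left
    by (intro sum.cong refl) (simp add: hom)
  finally show "integ S w (push S h (f \<otimes>\<^bsub>A\<^esub> g)) = integ S w (push S h f \<otimes>\<^bsub>A\<^esub> push S h g)"
    by (simp add: integ_push[OF h])
qed (use push_closed[OF h] fg in \<open>simp_all add: mult_A_closed\<close>)

lemma push_linear:
  "push S h (f \<oplus>\<^bsub>A\<^esub> g) = push S h f \<oplus>\<^bsub>A\<^esub> push S h g"
  by (auto simp: push_def A_simps simp flip: sum.distrib intro!: sum.cong)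

lemma push_single:
  assumes "s \<in> carrier S" shows "push S h (single s c) = single (h s) c"
proof
  fix u
  have "push S h (single s c) u = (\<Sum>t\<in>carrier S. if t = s then (if h s = u then c else 0) else 0)"
    unfolding push_def single_def by (intro sum.cong) auto
  then show "push S h (single s c) u = single (h s) c u"
    using fin assms by (simp add: single_def)
qed

lemma mult_single:
  assumes "s \<in> carrier S" "t \<in> carrier S"
  shows "single s c \<otimes>\<^bsub>A\<^esub> single t d = single (s \<otimes> t) (c * d)"
proof (rule A_eqI)
  fix w :: "'a \<Rightarrow> rat"
  have "integ S w (single s c \<otimes>\<^bsub>A\<^esub> single t d)
    = integ S (\<lambda>s. integ S (\<lambda>t. w (s \<otimes> t)) (single t d)) (single s c)"
    using assms by (simp add: integ_mult_A) (simp add: integ_def sum_distrib_left mult_ac)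
  also have "\<dots> = integ S w (single (s \<otimes> t) (c * d))"
    using assms by (simp add: integ_single of_rat_mult)
  finally show "integ S w (single s c \<otimes>\<^bsub>A\<^esub> single t d) = integ S w (single (s \<otimes> t) (c * d))" .
qed (use assms in \<open>simp_all add: mult_A_closed\<close>)

lemma single_pow:
  assumes "s \<in> carrier S"
  shows "single s c [^]\<^bsub>A\<^esub> (n::nat) = single (s [^] n) (c ^ n)"
  by (induction n) (use assms in \<open>simp_all add: mult_single A_simps mult.commute\<close>)

section \<open>Elements integral at p and the Frobenius congruence\<close>

definition W :: "nat \<Rightarrow> nat \<Rightarrow> ('a \<Rightarrow> rat) set" where
  "W p i = {f \<in> carrier A. \<forall>s. f s \<in> ploc p i}"

text \<open>\<open>W p i\<close> is p^i times the p-integral part of the algebra; multiplicativity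
  makes this a filtration, so congruences modulo p can be multiplied and powers of p
  accumulate.\<close>

lemma W_mult:
  assumes "prime p" "f \<in> W p i" "g \<in> W p j"
  shows "f \<otimes>\<^bsub>A\<^esub> g \<in> W p (i + j)"
proof -
  have c: "f \<in> carrier A" "g \<in> carrier A" using assms by (auto simp: W_def)
  have "(f \<otimes>\<^bsub>A\<^esub> g) u \<in> ploc p (i + j)" for u
    unfolding mult_A[OF c] using assms
    by (intro ploc_sum) (auto simp: W_def ploc_mult zero_in_ploc)
  then show ?thesis using c mult_A_closed by (auto simp: W_def)
qed

lemma W_add: "prime p \<Longrightarrow> f \<in> W p i \<Longrightarrow> g \<in> W p i \<Longrightarrow> f \<oplus>\<^bsub>A\<^esub> g \<in> W p i"
  by (auto simp: W_def) (simp add: A_simps ploc_add)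

lemma W_zero: "prime p \<Longrightarrow> \<zero>\<^bsub>A\<^esub> \<in> W p i"
  by (auto simp: W_def) (simp add: A_simps zero_in_ploc)

lemma a_inv_A: "f \<in> carrier A \<Longrightarrow> \<ominus>\<^bsub>A\<^esub> f = (\<lambda>u. - f u)"
  by (rule A.minus_equality) (auto simp: A_simps carrier_A)

lemma minus_A: "f \<in> carrier A \<Longrightarrow> g \<in> carrier A \<Longrightarrow> f \<ominus>\<^bsub>A\<^esub> g = (\<lambda>u. f u - g u)"
  by (simp add: A.minus_eq a_inv_A) (simp add: A_simps)

lemma W_minus: "prime p \<Longrightarrow> f \<in> W p i \<Longrightarrow> g \<in> W p i \<Longrightarrow> f \<ominus>\<^bsub>A\<^esub> g \<in> W p i"
  using A.minus_closed[of f g] by (auto simp: W_def) (simp add: minus_A ploc_diff)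

lemma W_one: "prime p \<Longrightarrow> \<one>\<^bsub>A\<^esub> \<in> W p 0"
  using of_int_ploc[of p 0 1] zero_in_ploc[of p 0] by (auto simp: W_def) (simp add: A_simps single_def)

lemma W_pow: "prime p \<Longrightarrow> f \<in> W p 0 \<Longrightarrow> f [^]\<^bsub>A\<^esub> (n::nat) \<in> W p 0"
  by (induction n) (use W_mult[of p _ 0 _ 0] W_one in auto)

lemma add_pow_A:
  assumes "f \<in> carrier A" shows "[(n::nat)] \<cdot>\<^bsub>A\<^esub> f = of_nat n \<odot>\<^bsub>A\<^esub> f"
  by (induction n) (use assms in \<open>simp_all add: A.add.nat_pow_Suc A_simps algebra_simps\<close>)

lemma W_finsum:
  assumes "prime p" "\<And>k. k \<in> I \<Longrightarrow> F k \<in> W p i"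
  shows "(\<Oplus>\<^bsub>A\<^esub>k\<in>I. F k) \<in> W p i"
proof (cases "finite I")
  case True
  then show ?thesis using assms(2)
  proof (induction I)
    case (insert k I)
    then have "F \<in> I \<rightarrow> carrier A" "F k \<in> carrier A" by (auto simp: W_def)
    with insert show ?case by (auto simp: W_add assms(1))
  qed (simp add: W_zero assms(1))
qed (simp add: W_zero assms(1) A.add.finprod_infinite)

text \<open>The p-th power is additive modulo p, because p divides all inner binomial
  coefficients.\<close>

lemma W_binomial:
  assumes p: "prime p" and x: "x \<in> W p 0" and y: "y \<in> W p 0"
  shows "(x \<oplus>\<^bsub>A\<^esub> y) [^]\<^bsub>A\<^esub> p \<ominus>\<^bsub>A\<^esub> (x [^]\<^bsub>A\<^esub> p \<oplus>\<^bsub>A\<^esub> y [^]\<^bsub>A\<^esub> p) \<in> W p 1"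
proof -
  have c: "x \<in> carrier A" "y \<in> carrier A" using x y by (auto simp: W_def)
  \<comment> \<open>With p = q + 2 the inner indices 1, ..., p - 1 are exactly \<open>Suc k\<close>
    for k <= q, and both end terms can be split off.\<close>
  obtain q where q: "p = Suc (Suc q)" using prime_ge_2_nat[OF p] by (metis add_2_eq_Suc le_Suc_ex)
  define F where "F k = [(p choose k)] \<cdot>\<^bsub>A\<^esub> (x [^]\<^bsub>A\<^esub> k \<otimes>\<^bsub>A\<^esub> y [^]\<^bsub>A\<^esub> (p - k))" for k
  have F: "F k \<in> carrier A" for k using c by (simp add: F_def)
  have "(x \<oplus>\<^bsub>A\<^esub> y) [^]\<^bsub>A\<^esub> p = (\<Oplus>\<^bsub>A\<^esub>k\<in>{..Suc (Suc q)}. F k)"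
    using A.binomial_expansion[OF c, of p] unfolding F_def q by simp
  also have "\<dots> = F p \<oplus>\<^bsub>A\<^esub> ((\<Oplus>\<^bsub>A\<^esub>k\<in>{..q}. F (Suc k)) \<oplus>\<^bsub>A\<^esub> F 0)"
    using F by (subst A.finsum_Suc, simp, subst A.finsum_Suc2) (auto simp: q)
  finally have "(x \<oplus>\<^bsub>A\<^esub> y) [^]\<^bsub>A\<^esub> p = x [^]\<^bsub>A\<^esub> p \<oplus>\<^bsub>A\<^esub> ((\<Oplus>\<^bsub>A\<^esub>k\<in>{..q}. F (Suc k)) \<oplus>\<^bsub>A\<^esub> y [^]\<^bsub>A\<^esub> p)"
    using c by (simp add: F_def)
  moreover define M where "M = (\<Oplus>\<^bsub>A\<^esub>k\<in>{..q}. F (Suc k))"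
  moreover have "M \<in> W p 1"
    unfolding M_def
  proof (rule W_finsum[OF p])
    fix k assume "k \<in> {..q}"
    then have "p dvd p choose Suc k" using p q by (intro dvd_choose_prime) auto
    then have "of_nat (p choose Suc k) \<in> ploc p 1"
      using of_int_ploc[OF p, of 1 "int (p choose Suc k)"] by simp
    moreover have "x [^]\<^bsub>A\<^esub> Suc k \<otimes>\<^bsub>A\<^esub> y [^]\<^bsub>A\<^esub> (p - Suc k) \<in> W p (0 + 0)"
      using W_mult W_pow p x y by blast
    ultimately show "F (Suc k) \<in> W p 1"
      using ploc_mult[OF p, of _ 1 _ 0] F[of "Suc k"] c
      unfolding F_def by (auto simp: W_def add_pow_A simp del: A.nat_pow_Suc nat_pow_Suc) (auto simp: A_simps)
  qed
  then have "M \<in> carrier A" "M \<in> W p 1" by (auto simp: W_def)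
  ultimately have "(x \<oplus>\<^bsub>A\<^esub> y) [^]\<^bsub>A\<^esub> p \<ominus>\<^bsub>A\<^esub> (x [^]\<^bsub>A\<^esub> p \<oplus>\<^bsub>A\<^esub> y [^]\<^bsub>A\<^esub> p) = M"
    using c by (simp add: minus_A) (simp add: A_simps)
  then show ?thesis using \<open>M \<in> W p 1\<close> by simp
qed

abbreviation frob :: "nat \<Rightarrow> ('a \<Rightarrow> rat) \<Rightarrow> 'a \<Rightarrow> rat" where
  "frob k \<equiv> push S (\<lambda>s. s [^] k)"

lemma pow_funcset: "(\<lambda>s. s [^] (k::nat)) \<in> carrier S \<rightarrow> carrier S" by simp

lemma W_frob: "prime p \<Longrightarrow> f \<in> W p i \<Longrightarrow> frob k f \<in> W p i"
  using push_closed[OF pow_funcset] by (auto simp: W_def) (auto simp: push_def zero_in_ploc intro!: ploc_sum)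

text \<open>Induction on the support: \<open>W_binomial\<close> splits off one basis element, and
  for a single term (c s)^p = c^p s^p, where c^p agrees with c modulo p by Fermat's little
  theorem.\<close>

lemma frob_cong:
  assumes p: "prime p" and f: "f \<in> W p 0"
  shows "f [^]\<^bsub>A\<^esub> p \<ominus>\<^bsub>A\<^esub> frob p f \<in> W p 1"
proof -
  have "finite F \<Longrightarrow> F \<subseteq> carrier S \<Longrightarrow> f \<in> W p 0 \<Longrightarrow> {s. f s \<noteq> 0} \<subseteq> F \<Longrightarrow> ?thesis" for F
  proof (induction F arbitrary: f rule: finite_induct)
    case empty
    then have f: "f = \<zero>\<^bsub>A\<^esub>" by (auto simp: A_simps)
    have "frob p f = \<zero>\<^bsub>A\<^esub>" unfolding f by (simp add: push_def A_simps)
    then show ?case using prime_gt_0_nat[OF p] W_zero[OF p] by (simp add: f A.nat_pow_zero A.minus_eq)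
  next
    case (insert s F)
    define g where "g = (\<lambda>u. if u = s then 0 else f u)"
    define h where "h = single s (f s)"
    have s: "s \<in> carrier S" using insert by simp
    have g: "g \<in> W p 0" and h: "h \<in> W p 0"
      using insert.prems zero_in_ploc[OF p] by (auto simp: W_def carrier_A g_def h_def single_def)
    have fgh: "f = g \<oplus>\<^bsub>A\<^esub> h" by (auto simp: A_simps g_def h_def single_def)
    have "g [^]\<^bsub>A\<^esub> p \<ominus>\<^bsub>A\<^esub> frob p g \<in> W p 1"
      using insert g by (intro insert.IH) (auto simp: g_def)
    moreover have "h [^]\<^bsub>A\<^esub> p \<ominus>\<^bsub>A\<^esub> frob p h \<in> W p 1"
    proof -
      have "f s \<in> ploc p 0" using insert.prems by (simp add: W_def)
      then have "f s ^ p - f s \<in> ploc p 1" using ploc_fermat p by blast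
      moreover have "h [^]\<^bsub>A\<^esub> p \<ominus>\<^bsub>A\<^esub> frob p h = single (s [^] p) (f s ^ p - f s)"
        using s by (simp add: h_def single_pow push_single minus_A) (auto simp: single_def)
      ultimately show ?thesis using s zero_in_ploc[OF p] by (auto simp: W_def single_def carrier_A)
    qed
    ultimately have "(f [^]\<^bsub>A\<^esub> p \<ominus>\<^bsub>A\<^esub> (g [^]\<^bsub>A\<^esub> p \<oplus>\<^bsub>A\<^esub> h [^]\<^bsub>A\<^esub> p))
       \<oplus>\<^bsub>A\<^esub> ((g [^]\<^bsub>A\<^esub> p \<ominus>\<^bsub>A\<^esub> frob p g) \<oplus>\<^bsub>A\<^esub> (h [^]\<^bsub>A\<^esub> p \<ominus>\<^bsub>A\<^esub> frob p h)) \<in> W p 1"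
      using W_binomial[OF p g h] by (auto simp: fgh W_add p)
    also have "(f [^]\<^bsub>A\<^esub> p \<ominus>\<^bsub>A\<^esub> (g [^]\<^bsub>A\<^esub> p \<oplus>\<^bsub>A\<^esub> h [^]\<^bsub>A\<^esub> p))
       \<oplus>\<^bsub>A\<^esub> ((g [^]\<^bsub>A\<^esub> p \<ominus>\<^bsub>A\<^esub> frob p g) \<oplus>\<^bsub>A\<^esub> (h [^]\<^bsub>A\<^esub> p \<ominus>\<^bsub>A\<^esub> frob p h)) = f [^]\<^bsub>A\<^esub> p \<ominus>\<^bsub>A\<^esub> frob p f"
    proof -
      have c: "g \<in> carrier A" "h \<in> carrier A" "f \<in> carrier A"
        using g h insert.prems by (auto simp: W_def)
      have "frob p f = frob p g \<oplus>\<^bsub>A\<^esub> frob p h" unfolding fgh push_linear ..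
      then show ?thesis
        using c push_closed[OF pow_funcset] by (simp add: minus_A) (simp add: A_simps algebra_simps)
    qed
    finally show ?case .
  qed
  from this[OF fin] f show ?thesis by (auto simp: W_def carrier_A)
qed

text \<open>From z = z z, membership in \<open>W p i\<close> improves to \<open>W p (i + 1)\<close>.
  Hence all coefficients lie in every power of p and vanish.\<close>

lemma idempotent_W_eq_zero:
  assumes p: "prime p" and z: "z \<in> W p 1" "z \<otimes>\<^bsub>A\<^esub> z = z"
  shows "z = \<zero>\<^bsub>A\<^esub>"
proof -
  have "z \<in> W p i" for i
  proof (induction i)
    case 0
    show ?case using z(1) ploc_antimono[OF p] by (auto simp: W_def)
  next
    case (Suc i)
    then show ?case using W_mult[OF p Suc z(1)] z(2) by simp
  qed
  then show ?thesis using ploc_Inter[OF p] by (auto simp: W_def A_simps)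
qed

text \<open>Modulo \<open>p\<close> the element \<open>x = x\<^sup>p\<close> agrees with its image under \<open>s \<mapsto> s\<^sup>p\<close>, and congruent
  idempotents are equal.\<close>

lemma frob_prime_idempotent:
  assumes p: "prime p" and x: "x \<in> W p 0" "x \<otimes>\<^bsub>A\<^esub> x = x"
  shows "frob p x = x"
proof -
  define y where "y = frob p x"
  have cx: "x \<in> carrier A" and cy: "y \<in> carrier A"
    using x push_closed[OF pow_funcset] by (auto simp: W_def y_def)
  have y: "y \<in> W p 0" "y \<otimes>\<^bsub>A\<^esub> y = y"
    using W_frob p x push_mult[OF pow_funcset nat_pow_distrib cx cx] by (simp_all add: y_def)
  have "x [^]\<^bsub>A\<^esub> Suc n = x" for n
    by (induction n) (use x cx in simp_all)
  then have "x [^]\<^bsub>A\<^esub> p = x" using prime_gt_0_nat[OF p] by (metis gr0_implies_Suc)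
  then have d: "x \<ominus>\<^bsub>A\<^esub> y \<in> W p 1" using frob_cong[OF p x(1)] by (simp add: y_def)
  \<comment> \<open>u (1 - v) is idempotent, and it equals u (u - v) because u u = u. So it is
    divisible by p and therefore zero. Applied in both directions this gives x = x y and y = y
    x.\<close>
  have *: "u = u \<otimes>\<^bsub>A\<^esub> v"
    if u: "u \<in> W p 0" "u \<otimes>\<^bsub>A\<^esub> u = u" and v: "v \<in> W p 0" "v \<otimes>\<^bsub>A\<^esub> v = v" and d: "u \<ominus>\<^bsub>A\<^esub> v \<in> W p 1" for u v
  proof -
    have c: "u \<in> carrier A" "v \<in> carrier A" using u v by (auto simp: W_def)
    define z where "z = u \<otimes>\<^bsub>A\<^esub> (\<one>\<^bsub>A\<^esub> \<ominus>\<^bsub>A\<^esub> v)"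
    have "z = u \<otimes>\<^bsub>A\<^esub> (u \<ominus>\<^bsub>A\<^esub> v)"
      using c u by (simp add: z_def A.minus_eq A.r_distr)
    then have "z \<in> W p 1" using W_mult[OF p u(1) d] by simp
    moreover have "z \<otimes>\<^bsub>A\<^esub> z = z"
    proof -
      have i: "(\<one>\<^bsub>A\<^esub> \<ominus>\<^bsub>A\<^esub> v) \<otimes>\<^bsub>A\<^esub> (\<one>\<^bsub>A\<^esub> \<ominus>\<^bsub>A\<^esub> v) = \<one>\<^bsub>A\<^esub> \<ominus>\<^bsub>A\<^esub> v"
        using c v by (simp add: A.minus_eq A.r_distr A.l_distr A.r_minus A.l_minus A.r_neg)
      have "z \<otimes>\<^bsub>A\<^esub> z = (u \<otimes>\<^bsub>A\<^esub> u) \<otimes>\<^bsub>A\<^esub> ((\<one>\<^bsub>A\<^esub> \<ominus>\<^bsub>A\<^esub> v) \<otimes>\<^bsub>A\<^esub> (\<one>\<^bsub>A\<^esub> \<ominus>\<^bsub>A\<^esub> v))"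
        unfolding z_def using c by (simp add: A.m_ac)
      then show ?thesis by (simp add: i u z_def)
    qed
    ultimately have "z = \<zero>\<^bsub>A\<^esub>" using idempotent_W_eq_zero p by blast
    then show ?thesis using c unfolding z_def
      by (simp add: A.minus_eq A.r_distr A.r_minus) (metis A.add.inv_equality A.add.m_comm A.a_inv_closed A.m_closed A.minus_minus A.minus_equality)
  qed
  have "y \<ominus>\<^bsub>A\<^esub> x \<in> W p 1"
  proof -
    have "y \<ominus>\<^bsub>A\<^esub> x = \<zero>\<^bsub>A\<^esub> \<ominus>\<^bsub>A\<^esub> (x \<ominus>\<^bsub>A\<^esub> y)"
      using minus_A[OF A.zero_closed A.minus_closed[OF cx cy]] minus_A[OF cx cy] minus_A[OF cy cx]
      by (simp add: A_simps)
    then show ?thesis using d W_minus W_zero p by simp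
  qed
  then have "y = y \<otimes>\<^bsub>A\<^esub> x" using * x y by blast
  moreover have "x = x \<otimes>\<^bsub>A\<^esub> y" using * x y d by blast
  ultimately show ?thesis using cx cy A.m_comm y_def by metis
qed

lemma exists_denominator:
  assumes "x \<in> carrier A"
  obtains D :: nat where "D > 0" "\<And>p. prime p \<Longrightarrow> coprime p D \<Longrightarrow> x \<in> W p 0"
proof
  define den where "den s = nat (snd (quotient_of (x s)))" for s
  have den: "den s > 0" "x s = of_int (fst (quotient_of (x s))) / of_int (int (den s))" for s
    using quotient_of_denom_pos'[of "x s"] quotient_of_div[of "x s"] by (auto simp: den_def)
  show "(\<Prod>s\<in>carrier S. den s) > 0" using den by (simp add: prod_pos)
  fix p :: nat assume p: "prime p" "coprime p (\<Prod>s\<in>carrier S. den s)"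
  have "x s \<in> ploc p 0" for s
  proof (cases "s \<in> carrier S")
    case True
    then have "den s dvd (\<Prod>s\<in>carrier S. den s)" using fin by (intro dvd_prodI)
    then have "\<not> p dvd den s"
      using p by (meson coprime_common_divisor dvd_refl dvd_trans not_prime_unit)
    then show ?thesis
      using plocI[of p "int (den s)" 0 "fst (quotient_of (x s))"] den(2)[of s] by simp
  next
    case False
    then show ?thesis using assms zero_in_ploc p by (simp add: carrier_A)
  qed
  then show "x \<in> W p 0" using assms by (simp add: W_def)
qed

text \<open>D is a common denominator of the coefficients. The maps \<open>frob\<close> compose
  multiplicatively in the exponent, so strong induction strips prime factors from k, each of them
  prime to D.\<close>

theorem frob_idempotent:
  assumes x: "x \<in> carrier A" "x \<otimes>\<^bsub>A\<^esub> x = x"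
  obtains D :: nat where "D > 0" "\<And>k. k > 0 \<Longrightarrow> coprime k D \<Longrightarrow> frob k x = x"
proof -
  obtain D where D: "D > 0" "\<And>p. prime p \<Longrightarrow> coprime p D \<Longrightarrow> x \<in> W p 0"
    using exists_denominator[OF x(1)] by blast
  have "frob k x = x" if "k > 0" "coprime k D" for k
    using that
  proof (induction k rule: less_induct)
    case (less k)
    show ?case
    proof (cases "k = 1")
      case True
      show ?thesis
        by (rule A_eqI, rule push_closed[OF pow_funcset], rule x(1), simp only: integ_push[OF pow_funcset])
          (simp add: integ_def True)
    next
      case False
      then obtain p where p: "prime p" "p dvd k" using prime_factor_nat by blast
      then obtain l where l: "k = l * p" by (metis dvd_def mult.commute)
      have "l < k" "l > 0" "coprime l D" "coprime p D"
        using l less.prems p prime_gt_1_nat[of p] by auto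
      then have "frob l x = x" "frob p x = x"
        using less.IH frob_prime_idempotent D p x by auto
      moreover have "frob k x = frob p (frob l x)"
        by (rule A_eqI, (rule push_closed[OF pow_funcset])+, simp only: integ_push[OF pow_funcset])
          (simp add: integ_def l nat_pow_pow)
      ultimately show ?thesis by simp
    qed
  qed
  then show ?thesis using that D by blast
qed

end

section \<open>The generalized character algebra\<close>

context cring
begin

lemma finprod_fix:
  assumes "finite I" "\<And>i. i \<in> I \<Longrightarrow> a i \<in> carrier R" "y \<in> carrier R"
    and "\<And>i. i \<in> I \<Longrightarrow> a i \<otimes> y = y"
  shows "(\<Otimes>i\<in>I. a i) \<otimes> y = y"
  using assms
proof (induction I rule: finite_induct)
  case (insert i I)
  then have c: "(\<Otimes>i\<in>I. a i) \<in> carrier R" "a \<in> I \<rightarrow> carrier R" "a i \<in> carrier R" by auto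
  then have "(\<Otimes>i\<in>insert i I. a i) \<otimes> y = a i \<otimes> ((\<Otimes>i\<in>I. a i) \<otimes> y)"
    using insert by (simp add: m_assoc)
  with insert show ?case by simp
qed simp

lemma finsum_swap:
  assumes "finite I" "\<And>i j. i \<in> I \<Longrightarrow> j \<in> J \<Longrightarrow> f i j \<in> carrier R"
  shows "(\<Oplus>i\<in>I. \<Oplus>j\<in>J. f i j) = (\<Oplus>j\<in>J. \<Oplus>i\<in>I. f i j)"
  using assms
proof (induction I rule: finite_induct)
  case (insert i I)
  have "(\<Oplus>i\<in>insert i I. \<Oplus>j\<in>J. f i j) = (\<Oplus>j\<in>J. f i j) \<oplus> (\<Oplus>i\<in>I. \<Oplus>j\<in>J. f i j)"
    using insert by (intro finsum_insert) (auto intro!: finsum_closed)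
  also have "\<dots> = (\<Oplus>j\<in>J. f i j) \<oplus> (\<Oplus>j\<in>J. \<Oplus>i\<in>I. f i j)"
    using insert by simp
  also have "\<dots> = (\<Oplus>j\<in>J. f i j \<oplus> (\<Oplus>i\<in>I. f i j))"
    using insert by (intro finsum_addf[symmetric]) (auto intro!: finsum_closed)
  also have "\<dots> = (\<Oplus>j\<in>J. \<Oplus>i\<in>insert i I. f i j)"
    using insert by (intro finsum_cong' finsum_insert[symmetric]) (auto intro!: finsum_closed)
  finally show ?case .
qed simp

lemma one_minus_fix_iff:
  assumes "a \<in> carrier R" "x \<in> carrier R"
  shows "(\<one> \<ominus> a) \<otimes> x = x \<longleftrightarrow> a \<otimes> x = \<zero>"
proof -
  have "(\<one> \<ominus> a) \<otimes> x = x \<ominus> a \<otimes> x"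
    using assms by (simp add: minus_eq l_distr l_minus)
  moreover have "x \<ominus> y = x \<longleftrightarrow> y = \<zero>" if "y \<in> carrier R" for y
  proof
    assume "x \<ominus> y = x"
    then have "x \<oplus> y = (x \<ominus> y) \<oplus> y" by simp
    also have "\<dots> = x \<oplus> \<zero>" using assms that by (simp add: minus_eq a_assoc l_neg)
    finally show "y = \<zero>" using assms that by simp
  qed (use assms in \<open>simp add: minus_eq\<close>)
  ultimately show ?thesis using assms by simp
qed

lemma one_minus_idempotent:
  assumes "a \<in> carrier R" "a \<otimes> a = a"
  shows "(\<one> \<ominus> a) \<otimes> (\<one> \<ominus> a) = \<one> \<ominus> a"
  using assms by (simp add: minus_eq l_distr r_distr l_minus r_minus r_neg)

lemma finprod_idempotent:
  assumes "\<And>i. i \<in> I \<Longrightarrow> a i \<in> carrier R" "\<And>i. i \<in> I \<Longrightarrow> a i \<otimes> a i = a i"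
  shows "(\<Otimes>i\<in>I. a i) \<otimes> (\<Otimes>i\<in>I. a i) = (\<Otimes>i\<in>I. a i)"
proof -
  have "(\<Otimes>i\<in>I. a i) \<otimes> (\<Otimes>i\<in>I. a i) = (\<Otimes>i\<in>I. a i \<otimes> a i)"
    using assms by (intro finprod_multf[symmetric]) auto
  also have "\<dots> = (\<Otimes>i\<in>I. a i)" using assms by (intro finprod_cong') auto
  finally show ?thesis .
qed

lemma finprod_absorb:
  assumes "finite I" "i \<in> I" "\<And>i. i \<in> I \<Longrightarrow> a i \<in> carrier R"
    and "\<And>i. i \<in> I \<Longrightarrow> a i \<otimes> a i = a i"
  shows "a i \<otimes> (\<Otimes>i\<in>I. a i) = (\<Otimes>i\<in>I. a i)"
proof -
  have I: "I = insert i (I - {i})" using assms by auto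
  have "(\<Otimes>i\<in>I. a i) = a i \<otimes> (\<Otimes>i\<in>I - {i}. a i)"
    using assms(1,3) by (subst I, subst finprod_insert) (use assms(2) in auto)
  moreover have "(\<Otimes>i\<in>I - {i}. a i) \<in> carrier R" using assms by (intro finprod_closed) auto
  ultimately show ?thesis using assms by (simp flip: m_assoc)
qed

end

context finite_comm_monoid
begin

lemma finsum_A_apply:
  assumes "\<And>i. i \<in> I \<Longrightarrow> F i \<in> carrier A" "finite I"
  shows "(\<Oplus>\<^bsub>A\<^esub>i\<in>I. F i) u = (\<Sum>i\<in>I. F i u)"
  using assms(2,1)
proof (induction I rule: finite_induct)
  case empty
  show ?case by (simp add: A_simps)
next
  case (insert i I)
  then have "(\<Oplus>\<^bsub>A\<^esub>i\<in>insert i I. F i) = F i \<oplus>\<^bsub>A\<^esub> (\<Oplus>\<^bsub>A\<^esub>i\<in>I. F i)"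
    by (intro A.finsum_insert) auto
  with insert show ?case by (simp add: A_simps)
qed

text \<open>In the form of a ring sum, the image can be sent through the projection to the quotient
  term by term.\<close>

lemma push_eq_finsum:
  assumes "h \<in> carrier S \<rightarrow> carrier S"
  shows "push S h f = (\<Oplus>\<^bsub>A\<^esub>s\<in>carrier S. single (h s) (f s))"
proof
  fix u
  have "(\<Oplus>\<^bsub>A\<^esub>s\<in>carrier S. single (h s) (f s)) u = (\<Sum>s\<in>carrier S. single (h s) (f s) u)"
    using assms fin by (intro finsum_A_apply single_closed) auto
  then show "push S h f u = (\<Oplus>\<^bsub>A\<^esub>s\<in>carrier S. single (h s) (f s)) u"
    by (auto simp: push_def single_def intro!: sum.cong)
qed

lemma single_one_mult:
  assumes "f \<in> carrier A" shows "single \<one> c \<otimes>\<^bsub>A\<^esub> f = c \<odot>\<^bsub>A\<^esub> f"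
proof -
  have "single \<one> c \<otimes>\<^bsub>A\<^esub> f = (c \<odot>\<^bsub>A\<^esub> \<one>\<^bsub>A\<^esub>) \<otimes>\<^bsub>A\<^esub> f"
    by (simp add: A_simps single_def if_distrib cong: if_cong)
  also have "\<dots> = c \<odot>\<^bsub>A\<^esub> (\<one>\<^bsub>A\<^esub> \<otimes>\<^bsub>A\<^esub> f)"
  proof (rule A_eqI)
    fix w :: "'a \<Rightarrow> rat"
    show "integ S w ((c \<odot>\<^bsub>A\<^esub> \<one>\<^bsub>A\<^esub>) \<otimes>\<^bsub>A\<^esub> f) = integ S w (c \<odot>\<^bsub>A\<^esub> (\<one>\<^bsub>A\<^esub> \<otimes>\<^bsub>A\<^esub> f))"
      unfolding integ_linear integ_mult_A[OF smult_A_closed[OF A.one_closed] assms]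
        integ_mult_A[OF A.one_closed assms]
      by (simp add: A_simps(3) of_rat_mult sum_distrib_left mult_ac)
  qed (use assms in \<open>auto intro!: mult_A_closed smult_A_closed\<close>)
  finally show ?thesis using assms by simp
qed

end

section \<open>The contracted algebra of a finite abelian group\<close>

locale finite_comm_group = comm_group G for G (structure) +
  assumes finite_G: "finite (carrier G)"
begin

abbreviation S where "S \<equiv> subset_monoid G"
abbreviation R where "R \<equiv> gen_char_algebra G"
abbreviation proj where "proj x \<equiv> contraction_ideal G +>\<^bsub>monoid_algebra S\<^esub> x"

lemma S_simps: "carrier S = Pow (carrier G) - {{}}" "B \<otimes>\<^bsub>S\<^esub> C = B <#> C" "\<one>\<^bsub>S\<^esub> = {\<one>}"
  by (simp_all add: subset_monoid_def)

sublocale S: finite_comm_monoid S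
proof (intro finite_comm_monoid.intro comm_monoidI finite_comm_monoid_axioms.intro)
  show "finite (carrier S)" by (simp add: S_simps finite_G)
next
  fix B C D assume "B \<in> carrier S" "C \<in> carrier S" "D \<in> carrier S"
  then show "B \<otimes>\<^bsub>S\<^esub> C \<otimes>\<^bsub>S\<^esub> D = B \<otimes>\<^bsub>S\<^esub> (C \<otimes>\<^bsub>S\<^esub> D)"
    by (auto simp: S_simps set_mult_assoc)
next
  fix B C assume BC: "B \<in> carrier S" "C \<in> carrier S"
  then show "B \<otimes>\<^bsub>S\<^esub> C = C \<otimes>\<^bsub>S\<^esub> B"
    unfolding S_simps set_mult_def by (auto, (metis m_comm subsetD)+)
  show "B \<otimes>\<^bsub>S\<^esub> C \<in> carrier S" using BC set_mult_closed by (auto simp: S_simps set_mult_def)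
next
  fix B assume "B \<in> carrier S"
  then show "\<one>\<^bsub>S\<^esub> \<otimes>\<^bsub>S\<^esub> B = B" by (force simp: S_simps set_mult_def)
qed (simp add: S_simps)

lemma G_in_S: "carrier G \<in> carrier S"
  by (auto simp: S_simps)

lemma set_mult_G:
  assumes "B \<in> carrier S" shows "carrier G <#> B = carrier G"
proof
  show "carrier G <#> B \<subseteq> carrier G" using assms set_mult_closed by (auto simp: S_simps)
  obtain b where b: "b \<in> B" "b \<in> carrier G" using assms by (auto simp: S_simps)
  show "carrier G \<subseteq> carrier G <#> B"
  proof
    fix x assume x: "x \<in> carrier G"
    then have "x = x \<otimes> inv b \<otimes> b" using b by (simp add: m_assoc)
    moreover have "x \<otimes> inv b \<in> carrier G" using x b by simp
    ultimately show "x \<in> carrier G <#> B" using b(1) unfolding set_mult_def by blast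
  qed
qed

lemma contraction_ideal_eq: "contraction_ideal G = range (single (carrier G))"
proof -
  have "c \<odot>\<^bsub>S.A\<^esub> basis_elem (carrier G) = single (carrier G) c" for c
    unfolding S.A_simps basis_elem_def single_def by (rule ext) simp
  then show ?thesis unfolding contraction_ideal_def by simp
qed

text \<open>Since G B = G for every nonempty B, only the sum of the coefficients of f survives. This
  is what makes the line spanned by G an ideal.\<close>

lemma mult_single_G:
  assumes "f \<in> carrier S.A"
  shows "single (carrier G) c \<otimes>\<^bsub>S.A\<^esub> f = single (carrier G) (c * integ S (\<lambda>_. 1) f)"
proof (rule S.A_eqI)
  fix w :: "'a set \<Rightarrow> rat"
  have "integ S w (single (carrier G) c \<otimes>\<^bsub>S.A\<^esub> f)
     = integ S (\<lambda>s. integ S (\<lambda>t. w (s \<otimes>\<^bsub>S\<^esub> t)) f) (single (carrier G) c)"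
    using assms G_in_S by (simp add: S.integ_mult_A) (simp add: integ_def sum_distrib_left mult_ac)
  also have "\<dots> = of_rat c * integ S (\<lambda>t. w (carrier G \<otimes>\<^bsub>S\<^esub> t)) f"
    by (simp add: S.integ_single G_in_S)
  also have "integ S (\<lambda>t. w (carrier G \<otimes>\<^bsub>S\<^esub> t)) f = integ S (\<lambda>_. 1) f * w (carrier G)"
    unfolding integ_def sum_distrib_right by (intro sum.cong) (auto simp: set_mult_G S_simps(2))
  finally show "integ S w (single (carrier G) c \<otimes>\<^bsub>S.A\<^esub> f)
      = integ S w (single (carrier G) (c * integ S (\<lambda>_. 1) f))"
    by (simp add: S.integ_single G_in_S of_rat_eq_id)
qed (use assms G_in_S in \<open>simp_all add: S.mult_A_closed\<close>)

lemma ideal_contraction: "ideal (contraction_ideal G) S.A"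
proof (rule idealI)
  show "ring S.A" by (rule S.A.ring_axioms)
  have cl: "contraction_ideal G \<subseteq> carrier S.A"
    using G_in_S by (auto simp: contraction_ideal_eq)
  show "subgroup (contraction_ideal G) (add_monoid S.A)"
  proof (rule group.subgroupI)
    show "group (add_monoid S.A)" by (rule S.A.a_group)
    show "contraction_ideal G \<subseteq> carrier (add_monoid S.A)" using cl by simp
    show "contraction_ideal G \<noteq> {}" by (simp add: contraction_ideal_eq)
  next
    fix a assume "a \<in> contraction_ideal G"
    then obtain c where c: "a = single (carrier G) c" by (auto simp: contraction_ideal_eq)
    have "inv\<^bsub>add_monoid S.A\<^esub> a = \<ominus>\<^bsub>S.A\<^esub> a" by (simp add: a_inv_def)
    also have "\<dots> = single (carrier G) (- c)"
      unfolding c S.a_inv_A[OF S.single_closed[OF G_in_S]] by (auto simp: single_def)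
    finally show "inv\<^bsub>add_monoid S.A\<^esub> a \<in> contraction_ideal G" by (simp add: contraction_ideal_eq)
  next
    fix a b assume "a \<in> contraction_ideal G" "b \<in> contraction_ideal G"
    then obtain c d where cd: "a = single (carrier G) c" "b = single (carrier G) d"
      by (auto simp: contraction_ideal_eq)
    have "a \<oplus>\<^bsub>S.A\<^esub> b = single (carrier G) (c + d)"
      unfolding S.A_simps cd by (auto simp: single_def)
    then show "a \<otimes>\<^bsub>add_monoid S.A\<^esub> b \<in> contraction_ideal G" by (simp add: contraction_ideal_eq)
  qed
  fix a x assume ax: "a \<in> contraction_ideal G" "x \<in> carrier S.A"
  obtain c where "a = single (carrier G) c"
    using ax(1) unfolding contraction_ideal_eq by blast
  then show *: "a \<otimes>\<^bsub>S.A\<^esub> x \<in> contraction_ideal G"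
    unfolding contraction_ideal_eq using mult_single_G[OF ax(2)] by blast
  have "a \<in> carrier S.A" using ax(1) cl by blast
  then show "x \<otimes>\<^bsub>S.A\<^esub> a \<in> contraction_ideal G"
    using * S.A.m_comm[OF _ ax(2)] by simp
qed

sublocale I: ideal "contraction_ideal G" "S.A"
  by (rule ideal_contraction)

lemma R_simps:
  "carrier R = carrier (S.A Quot contraction_ideal G)"
  "monoid.mult R = monoid.mult (S.A Quot contraction_ideal G)"
  "monoid.one R = monoid.one (S.A Quot contraction_ideal G)"
  "ring.zero R = ring.zero (S.A Quot contraction_ideal G)"
  "ring.add R = ring.add (S.A Quot contraction_ideal G)"
  by (simp_all add: gen_char_algebra_def ring.defs module.defs Let_def)

lemma cring_R: "cring R"
proof -
  interpret Q: cring "S.A Quot contraction_ideal G"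
    by (rule I.quotient_is_cring[OF S.cring_A])
  show ?thesis
  proof (rule cringI)
    show "abelian_group R"
    proof (rule abelian_groupI, unfold R_simps)
      fix x assume "x \<in> carrier (S.A Quot contraction_ideal G)"
      then show "\<exists>y\<in>carrier (S.A Quot contraction_ideal G).
          y \<oplus>\<^bsub>S.A Quot contraction_ideal G\<^esub> x = \<zero>\<^bsub>S.A Quot contraction_ideal G\<^esub>"
        using Q.l_neg Q.a_inv_closed by blast
    qed (rule Q.a_closed Q.zero_closed Q.a_assoc Q.a_comm Q.l_zero; assumption)+
    show "comm_monoid R"
      by (rule comm_monoidI, unfold R_simps)
        (rule Q.m_closed Q.one_closed Q.m_assoc Q.m_comm Q.l_one; assumption)+
  qed (unfold R_simps, rule Q.l_distr)
qed

sublocale R: cring R by (rule cring_R)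

lemma proj_hom: "ring_hom_cring S.A R proj"
proof (intro ring_hom_cring.intro ring_hom_cring_axioms.intro S.cring_A cring_R)
  show "proj \<in> ring_hom S.A R"
    using I.rcos_ring_hom by (simp add: ring_hom_def R_simps)
qed

sublocale proj: ring_hom_cring S.A R proj by (rule proj_hom)

lemma proj_surj: "y \<in> carrier R \<Longrightarrow> \<exists>x\<in>carrier S.A. y = proj x"
  unfolding R_simps FactRing_def A_RCOSETS_def' partial_object.simps by blast

lemma proj_eq_zero_iff: "x \<in> carrier S.A \<Longrightarrow> proj x = \<zero>\<^bsub>R\<^esub> \<longleftrightarrow> x \<in> contraction_ideal G"
  unfolding R_simps FactRing_def ring.simps using I.a_rcos_self I.a_rcos_const by metis

text \<open>The union defining the scalar multiplication runs over equal cosets: another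
  representative of the class changes the scaled element by a multiple of the basis element of
  G.\<close>

lemma smult_proj:
  assumes "x \<in> carrier S.A"
  shows "c \<odot>\<^bsub>R\<^esub> proj x = proj (c \<odot>\<^bsub>S.A\<^esub> x)"
proof -
  have *: "proj (c \<odot>\<^bsub>S.A\<^esub> x') = proj (c \<odot>\<^bsub>S.A\<^esub> x)" if x': "x' \<in> proj x" for x'
  proof -
    obtain i where i: "i \<in> contraction_ideal G" "x' = i \<oplus>\<^bsub>S.A\<^esub> x"
      using x' by (auto simp: a_r_coset_def')
    then obtain d where d: "i = single (carrier G) d" by (auto simp: contraction_ideal_eq)
    have "c \<odot>\<^bsub>S.A\<^esub> x' = single (carrier G) (c * d) \<oplus>\<^bsub>S.A\<^esub> c \<odot>\<^bsub>S.A\<^esub> x"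
      unfolding S.A_simps i d by (auto simp: single_def algebra_simps)
    moreover have "single (carrier G) (c * d) \<in> contraction_ideal G" by (simp add: contraction_ideal_eq)
    ultimately show ?thesis
      using assms G_in_S proj_eq_zero_iff[of "single (carrier G) (c * d)"] by simp
  qed
  have "x \<in> proj x" using assms I.a_rcos_self by blast
  have "c \<odot>\<^bsub>R\<^esub> proj x = (\<Union>x'\<in>proj x. proj (c \<odot>\<^bsub>S.A\<^esub> x'))"
    by (simp add: gen_char_algebra_def ring.defs module.defs Let_def)
  also have "\<dots> = (\<Union>x'\<in>proj x. proj (c \<odot>\<^bsub>S.A\<^esub> x))"
    by (simp only: * cong: SUP_cong)
  finally show ?thesis using \<open>x \<in> proj x\<close> by auto
qed

text \<open>The scalar c as a ring element, so that scalar multiplication becomes multiplication in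
  \<open>R\<close> and ring identities apply to it.\<close>

definition scal :: "rat \<Rightarrow> ('a set \<Rightarrow> rat) set" where
  "scal c = proj (single {\<one>} c)"

lemma one_in_S: "{\<one>} \<in> carrier S" by (simp add: S_simps)

lemma scal_closed [simp]: "scal c \<in> carrier R"
  by (simp add: scal_def one_in_S)

lemma scal_add: "scal (c + d) = scal c \<oplus>\<^bsub>R\<^esub> scal d"
proof -
  have "single {\<one>} (c + d) = single {\<one>} c \<oplus>\<^bsub>S.A\<^esub> single {\<one>} d"
    unfolding S.A_simps by (auto simp: single_def)
  then show ?thesis by (simp add: scal_def one_in_S)
qed

lemma scal_mult: "scal (c * d) = scal c \<otimes>\<^bsub>R\<^esub> scal d"
proof -
  have "single {\<one>} (c * d) = single {\<one>} c \<otimes>\<^bsub>S.A\<^esub> single {\<one>} d"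
    using S.mult_single[of "{\<one>}" "{\<one>}" c d] by (simp add: one_in_S S_simps set_mult_def)
  then show ?thesis by (simp add: scal_def one_in_S)
qed

lemma scal_one: "scal 1 = \<one>\<^bsub>R\<^esub>"
  using proj.hom_one by (simp add: scal_def S.A_simps S_simps)

lemma scal_zero: "scal 0 = \<zero>\<^bsub>R\<^esub>"
proof -
  have "single {\<one>} 0 = \<zero>\<^bsub>S.A\<^esub>" by (auto simp: S.A_simps single_def)
  then show ?thesis by (simp add: scal_def)
qed

lemma scal_inverse: "c \<noteq> 0 \<Longrightarrow> x \<in> carrier R \<Longrightarrow> scal (1 / c) \<otimes>\<^bsub>R\<^esub> (scal c \<otimes>\<^bsub>R\<^esub> x) = x"
  by (simp add: scal_one flip: R.m_assoc scal_mult)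

lemma scal_eq_zero: "c \<noteq> 0 \<Longrightarrow> x \<in> carrier R \<Longrightarrow> scal c \<otimes>\<^bsub>R\<^esub> x = \<zero>\<^bsub>R\<^esub> \<Longrightarrow> x = \<zero>\<^bsub>R\<^esub>"
  using scal_inverse[of c x] by simp

lemma smult_eq_scal: 
  assumes "y \<in> carrier R" shows "c \<odot>\<^bsub>R\<^esub> y = scal c \<otimes>\<^bsub>R\<^esub> y"
proof -
  obtain x where x: "x \<in> carrier S.A" "y = proj x" using proj_surj assms by blast
  have "scal c \<otimes>\<^bsub>R\<^esub> y = proj (single {\<one>} c \<otimes>\<^bsub>S.A\<^esub> x)"
    using x one_in_S by (simp add: scal_def)
  also have "single {\<one>} c \<otimes>\<^bsub>S.A\<^esub> x = c \<odot>\<^bsub>S.A\<^esub> x"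
    using S.single_one_mult[OF x(1), of c] by (simp add: S_simps)
  finally show ?thesis using x by (simp add: smult_proj)
qed

lemma finsum_const_scal:
  assumes "x \<in> carrier R" "finite I"
  shows "(\<Oplus>\<^bsub>R\<^esub>i\<in>I. x) = scal (of_nat (card I)) \<otimes>\<^bsub>R\<^esub> x"
  using assms(2) by (induction I rule: finite_induct)
    (use assms in \<open>simp_all add: scal_zero scal_add scal_one R.l_distr\<close>)

abbreviation X where "X g \<equiv> chi G {g}"

lemma chi_eq: "chi G B = proj (single B 1)"
  by (simp add: chi_def basis_elem_def single_def)

lemma proj_single: "B \<in> carrier S \<Longrightarrow> proj (single B c) = scal c \<otimes>\<^bsub>R\<^esub> chi G B"
  using S.mult_single[of "{\<one>}" B c 1] S.l_one[of B]
  by (simp add: scal_def chi_eq one_in_S S_simps(3) flip: proj.hom_mult)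

lemma chi_closed [simp]: "B \<in> carrier S \<Longrightarrow> chi G B \<in> carrier R"
  by (simp add: chi_eq)

lemma chi_mult: "B \<in> carrier S \<Longrightarrow> C \<in> carrier S \<Longrightarrow> chi G B \<otimes>\<^bsub>R\<^esub> chi G C = chi G (B <#> C)"
  by (simp add: chi_eq S.mult_single S_simps(2) flip: proj.hom_mult)

lemma chi_G: "chi G (carrier G) = \<zero>\<^bsub>R\<^esub>"
  using G_in_S by (simp add: chi_eq proj_eq_zero_iff) (simp add: contraction_ideal_eq)

lemma X_closed [simp]: "g \<in> carrier G \<Longrightarrow> X g \<in> carrier R"
  by (simp add: S_simps)

lemma X_one: "X \<one> = \<one>\<^bsub>R\<^esub>"
  using scal_one by (simp add: scal_def chi_eq)

lemma X_mult: "g \<in> carrier G \<Longrightarrow> h \<in> carrier G \<Longrightarrow> X (g \<otimes> h) = X g \<otimes>\<^bsub>R\<^esub> X h"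
  by (subst chi_mult) (auto simp: S_simps set_mult_def)

text \<open>The contraction kills \<open>\<chi>\<^sub>G\<close>, an idempotent, so multiplying a preimage by \<open>1 - \<chi>\<^sub>G\<close> lifts
  idempotents.\<close>

lemma lift_idempotent:
  assumes "e \<in> carrier R" "e \<otimes>\<^bsub>R\<^esub> e = e"
  obtains x where "x \<in> carrier S.A" "x \<otimes>\<^bsub>S.A\<^esub> x = x" "e = proj x"
proof -
  obtain y where y: "y \<in> carrier S.A" "e = proj y" using proj_surj assms by blast
  define s where "s = single (carrier G) (1::rat)"
  have s: "s \<in> carrier S.A" "s \<otimes>\<^bsub>S.A\<^esub> s = s" "proj s = \<zero>\<^bsub>R\<^esub>"
    using G_in_S set_mult_G[of "carrier G"] S.mult_single[of "carrier G" "carrier G" 1 1]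
    by (simp_all add: s_def S_simps(2) proj_eq_zero_iff) (simp add: contraction_ideal_eq)
  define t where "t = \<one>\<^bsub>S.A\<^esub> \<ominus>\<^bsub>S.A\<^esub> s"
  have t: "t \<in> carrier S.A" "t \<otimes>\<^bsub>S.A\<^esub> t = t" "s \<otimes>\<^bsub>S.A\<^esub> t = \<zero>\<^bsub>S.A\<^esub>" "proj t = \<one>\<^bsub>R\<^esub>"
    using s by (simp_all add: t_def S.A.minus_eq S.A.r_distr S.A.l_distr S.A.r_minus S.A.l_minus S.A.r_neg)
  have "proj (y \<otimes>\<^bsub>S.A\<^esub> y \<ominus>\<^bsub>S.A\<^esub> y) = \<zero>\<^bsub>R\<^esub>"
    using y assms(2) by (simp add: S.A.minus_eq R.r_neg)
  then have "y \<otimes>\<^bsub>S.A\<^esub> y \<ominus>\<^bsub>S.A\<^esub> y \<in> contraction_ideal G"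
    using proj_eq_zero_iff[of "y \<otimes>\<^bsub>S.A\<^esub> y \<ominus>\<^bsub>S.A\<^esub> y"] y(1) S.A.minus_closed S.A.m_closed by blast
  then obtain c where c: "y \<otimes>\<^bsub>S.A\<^esub> y \<ominus>\<^bsub>S.A\<^esub> y = single (carrier G) c"
    by (auto simp: contraction_ideal_eq)
  also have "\<dots> = single (carrier G) c \<otimes>\<^bsub>S.A\<^esub> s"
    using G_in_S by (simp add: mult_single_G s(1)) (simp add: s_def S.integ_single G_in_S)
  finally have "(y \<otimes>\<^bsub>S.A\<^esub> y \<ominus>\<^bsub>S.A\<^esub> y) \<otimes>\<^bsub>S.A\<^esub> t = single (carrier G) c \<otimes>\<^bsub>S.A\<^esub> s \<otimes>\<^bsub>S.A\<^esub> t"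
    by simp
  also have "\<dots> = \<zero>\<^bsub>S.A\<^esub>" using s t G_in_S by (simp add: S.A.m_assoc)
  finally have "y \<otimes>\<^bsub>S.A\<^esub> y \<otimes>\<^bsub>S.A\<^esub> t \<ominus>\<^bsub>S.A\<^esub> y \<otimes>\<^bsub>S.A\<^esub> t = \<zero>\<^bsub>S.A\<^esub>"
    using y t by (simp add: S.A.minus_eq S.A.l_distr S.A.l_minus)
  then have yyt: "y \<otimes>\<^bsub>S.A\<^esub> y \<otimes>\<^bsub>S.A\<^esub> t = y \<otimes>\<^bsub>S.A\<^esub> t" using y t by (simp add: S.A.r_right_minus_eq)
  show ?thesis
  proof
    show "y \<otimes>\<^bsub>S.A\<^esub> t \<in> carrier S.A" using y t by simp
    have "y \<otimes>\<^bsub>S.A\<^esub> t \<otimes>\<^bsub>S.A\<^esub> (y \<otimes>\<^bsub>S.A\<^esub> t) = y \<otimes>\<^bsub>S.A\<^esub> y \<otimes>\<^bsub>S.A\<^esub> (t \<otimes>\<^bsub>S.A\<^esub> t)"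
      using y t(1) by (simp add: S.A.m_ac)
    then show "y \<otimes>\<^bsub>S.A\<^esub> t \<otimes>\<^bsub>S.A\<^esub> (y \<otimes>\<^bsub>S.A\<^esub> t) = y \<otimes>\<^bsub>S.A\<^esub> t" using t yyt by simp
    show "e = proj (y \<otimes>\<^bsub>S.A\<^esub> t)" using y t by simp
  qed
qed

section \<open>Subgroups of a quotient group\<close>

lemma minimal_subgroup_Mod:
  assumes N: "subgroup N G" and K: "K \<in> minimal_subgroups (G Mod N)"
  shows "subgroup (\<Union>K) G" "N \<subseteq> \<Union>K" "\<Union>K \<noteq> N"
proof -
  interpret N: normal N G using N subgroup_imp_normal by blast
  interpret Q: group "G Mod N" by (rule N.factorgroup_is_group)
  interpret h: group_hom G "G Mod N" "\<lambda>x. N #> x"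
    by unfold_locales (rule N.r_coset_hom_Mod)
  have sK: "subgroup K (G Mod N)" and neK: "K \<noteq> {N}"
    using K by (auto simp: minimal_subgroups_def FactGroup_def)
  interpret K: subgroup K "G Mod N" by (rule sK)
  have KR: "K \<subseteq> rcosets N" using K.subset by (simp add: FactGroup_def)
  \<comment> \<open>The union of the cosets in K is the preimage of K under the projection to G/N;
    all subgroup properties are pulled back through this.\<close>
  have mem: "x \<in> \<Union>K \<longleftrightarrow> x \<in> carrier G \<and> N #> x \<in> K" for x
  proof
    assume "x \<in> \<Union>K"
    then obtain C where C: "C \<in> K" "x \<in> C" by blast
    then obtain y where y: "y \<in> carrier G" "C = N #> y" using KR by (auto simp: RCOSETS_def)
    then show "x \<in> carrier G \<and> N #> x \<in> K"
      using C N repr_independence[of x N y] by (metis N.subset r_coset_subset_G subsetD)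
  next
    assume "x \<in> carrier G \<and> N #> x \<in> K"
    then show "x \<in> \<Union>K" using rcos_self[OF _ N] by blast
  qed
  show "subgroup (\<Union>K) G"
  proof (rule subgroupI)
    show "\<Union>K \<subseteq> carrier G" using mem by blast
    show "\<Union>K \<noteq> {}" using mem[of \<one>] K.one_closed N.subset by (auto simp: FactGroup_def)
  next
    fix a assume "a \<in> \<Union>K"
    then show "inv a \<in> \<Union>K" unfolding mem using K.m_inv_closed h.hom_inv by auto
  next
    fix a b assume "a \<in> \<Union>K" "b \<in> \<Union>K"
    then show "a \<otimes> b \<in> \<Union>K" unfolding mem using K.m_closed h.hom_mult[of a b] by auto
  qed
  have "N \<in> K" using K.one_closed by (simp add: FactGroup_def)
  then show "N \<subseteq> \<Union>K" by blast
  show "\<Union>K \<noteq> N"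
  proof
    assume *: "\<Union>K = N"
    have "C = N" if C: "C \<in> K" for C
    proof -
      obtain y where y: "y \<in> carrier G" "C = N #> y" using C KR by (auto simp: RCOSETS_def)
      then have "y \<in> N" using mem C * by auto
      then show ?thesis using y N.rcos_const by simp
    qed
    then show False using neK \<open>N \<in> K\<close> by blast
  qed
qed

lemma finite_minimal_subgroups_Mod:
  assumes "subgroup N G" shows "finite (minimal_subgroups (G Mod N))"
proof -
  have "minimal_subgroups (G Mod N) \<subseteq> Pow (rcosets N)"
    using subgroup.subset by (force simp: minimal_subgroups_def FactGroup_def)
  moreover have "finite (rcosets N)" using finite_G by (simp add: RCOSETS_def)
  ultimately show ?thesis using finite_subset by blast
qed

text \<open>A subgroup of least cardinality among the nontrivial subgroups of G/N inside the image
  of M is minimal.\<close>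

lemma exists_minimal_subgroup_Mod:
  assumes N: "subgroup N G" and M: "subgroup M G" "N \<subseteq> M" "N \<noteq> M"
  obtains K where "K \<in> minimal_subgroups (G Mod N)" "\<Union>K \<subseteq> M"
proof -
  interpret N: normal N G using N subgroup_imp_normal by blast
  interpret Q: group "G Mod N" by (rule N.factorgroup_is_group)
  interpret h: group_hom G "G Mod N" "\<lambda>x. N #> x"
    by unfold_locales (rule N.r_coset_hom_Mod)
  define M' where "M' = (\<lambda>x. N #> x) ` M"
  have fin: "finite M'"
    unfolding M'_def by (rule finite_imageI[OF finite_subset[OF subgroup.subset[OF M(1)] finite_G]])
  define P where "P K \<longleftrightarrow> subgroup K (G Mod N) \<and> K \<noteq> {N} \<and> K \<subseteq> M'" for K
  obtain m where m: "m \<in> M" "m \<notin> N" using M by blast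
  have "N #> m \<noteq> N" using m rcos_self[OF subgroup.mem_carrier[OF M(1)] N] by blast
  then have "P M'" unfolding P_def M'_def using h.subgroup_img_is_subgroup[OF M(1)] m by auto
  then obtain K where K: "P K" "\<And>K'. P K' \<Longrightarrow> card K \<le> card K'"
    using ex_has_least_nat[of P M' card] by blast
  have "K' = K" if "subgroup K' (G Mod N)" "K' \<noteq> {N}" "K' \<subseteq> K" for K'
  proof -
    have "P K'" using that K by (auto simp: P_def)
    moreover have "finite K" using K fin finite_subset by (auto simp: P_def)
    ultimately show ?thesis using K that by (metis card_seteq)
  qed
  then have "K \<in> minimal_subgroups (G Mod N)"
    using K by (auto simp: minimal_subgroups_def P_def FactGroup_def)
  moreover have "\<Union>K \<subseteq> M"
  proof -
    have "N #> x \<subseteq> M" if "x \<in> M" for x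
      using that M subgroup.m_closed[OF M(1)] by (auto simp: r_coset_def)
    then show ?thesis using K by (force simp: P_def M'_def)
  qed
  ultimately show ?thesis using that by blast
qed

end

section \<open>The elements \<open>\<epsilon>(G, N)\<close>\<close>

context finite_comm_group
begin

lemma finite_subgroup: "subgroup L G \<Longrightarrow> finite L"
  using finite_G subgroup.subset finite_subset by blast

lemma check_elem_eq:
  assumes "L \<subseteq> carrier G"
  shows "check_elem G L = scal (1 / of_nat (card L)) \<otimes>\<^bsub>R\<^esub> (\<Oplus>\<^bsub>R\<^esub>g\<in>L. X g)"
  unfolding check_elem_def
  by (rule smult_eq_scal, rule R.finsum_closed) (use assms in auto)

lemma check_elem_closed: "L \<subseteq> carrier G \<Longrightarrow> check_elem G L \<in> carrier R"
  by (subst check_elem_eq) (auto intro!: R.finsum_closed R.m_closed)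

text \<open>Translation by g permutes L, so it only reorders the average.\<close>

lemma X_check_elem:
  assumes L: "subgroup L G" and g: "g \<in> L"
  shows "X g \<otimes>\<^bsub>R\<^esub> check_elem G L = check_elem G L"
proof -
  have LG: "L \<subseteq> carrier G" using L by (rule subgroup.subset)
  have cl: "X \<in> L \<rightarrow> carrier R" using LG by auto
  have gG: "g \<in> carrier G" using LG g by blast
  have inj: "inj_on (\<lambda>h. g \<otimes> h) L" using inj_on_subset[OF inj_on_cmult[OF gG] LG] .
  have img: "(\<lambda>h. g \<otimes> h) ` L = L"
    using L g by (intro endo_inj_surj finite_subgroup inj) (auto intro: subgroup.m_closed)
  have "X g \<otimes>\<^bsub>R\<^esub> (\<Oplus>\<^bsub>R\<^esub>h\<in>L. X h) = (\<Oplus>\<^bsub>R\<^esub>h\<in>L. X g \<otimes>\<^bsub>R\<^esub> X h)"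
    using gG cl finite_subgroup[OF L] by (intro R.finsum_rdistr) auto
  also have "\<dots> = (\<Oplus>\<^bsub>R\<^esub>h\<in>L. X (g \<otimes> h))"
    using gG LG by (intro R.finsum_cong') (auto simp: X_mult)
  also have "\<dots> = (\<Oplus>\<^bsub>R\<^esub>h\<in>(\<lambda>h. g \<otimes> h) ` L. X h)"
    using LG gG by (intro R.finsum_reindex[symmetric] inj) auto
  finally have *: "X g \<otimes>\<^bsub>R\<^esub> (\<Oplus>\<^bsub>R\<^esub>h\<in>L. X h) = (\<Oplus>\<^bsub>R\<^esub>h\<in>L. X h)" by (simp only: img)
  have "(\<Oplus>\<^bsub>R\<^esub>h\<in>L. X h) \<in> carrier R" using cl by (rule R.finsum_closed)
  then show ?thesis
    unfolding check_elem_eq[OF LG] using * gG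
    by (subst R.m_lcomm) auto
qed

lemma check_elem_fix:
  assumes L: "L \<subseteq> carrier G" "L \<noteq> {}" and v: "v \<in> carrier R"
    and inv: "\<And>g. g \<in> L \<Longrightarrow> X g \<otimes>\<^bsub>R\<^esub> v = v"
  shows "check_elem G L \<otimes>\<^bsub>R\<^esub> v = v"
proof -
  have finL: "finite L" using L finite_G finite_subset by blast
  have cl: "X \<in> L \<rightarrow> carrier R" using L by auto
  have "(\<Oplus>\<^bsub>R\<^esub>g\<in>L. X g) \<otimes>\<^bsub>R\<^esub> v = (\<Oplus>\<^bsub>R\<^esub>g\<in>L. X g \<otimes>\<^bsub>R\<^esub> v)"
    using v cl finL by (intro R.finsum_ldistr) auto
  also have "\<dots> = (\<Oplus>\<^bsub>R\<^esub>g\<in>L. v)"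
    using v inv by (intro R.finsum_cong') auto
  also have "\<dots> = scal (of_nat (card L)) \<otimes>\<^bsub>R\<^esub> v"
    using v finL by (rule finsum_const_scal)
  finally have *: "(\<Oplus>\<^bsub>R\<^esub>g\<in>L. X g) \<otimes>\<^bsub>R\<^esub> v = scal (of_nat (card L)) \<otimes>\<^bsub>R\<^esub> v" .
  have "(\<Oplus>\<^bsub>R\<^esub>h\<in>L. X h) \<in> carrier R" using cl by (rule R.finsum_closed)
  then have "check_elem G L \<otimes>\<^bsub>R\<^esub> v = scal (1 / of_nat (card L)) \<otimes>\<^bsub>R\<^esub> (scal (of_nat (card L)) \<otimes>\<^bsub>R\<^esub> v)"
    unfolding check_elem_eq[OF L(1)] using v by (simp only: R.m_assoc scal_closed *)
  also have "\<dots> = v" using v L finL by (intro scal_inverse) auto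
  finally show ?thesis .
qed

lemma check_elem_idempotent:
  assumes "subgroup L G" shows "check_elem G L \<otimes>\<^bsub>R\<^esub> check_elem G L = check_elem G L"
  using subgroup.subset[OF assms] subgroup.one_closed[OF assms]
  by (intro check_elem_fix check_elem_closed X_check_elem[OF assms]) auto

abbreviation eps where "eps \<equiv> check_epsilon G"

context
  fixes N assumes N: "subgroup N G"
begin

lemma minimal_subset: "K \<in> minimal_subgroups (G Mod N) \<Longrightarrow> \<Union>K \<subseteq> carrier G"
  using minimal_subgroup_Mod(1)[OF N] subgroup.subset by blast

lemma one_minus_check_elem_closed:
  "K \<in> minimal_subgroups (G Mod N) \<Longrightarrow> \<one>\<^bsub>R\<^esub> \<ominus>\<^bsub>R\<^esub> check_elem G (\<Union>K) \<in> carrier R"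
  using check_elem_closed[OF minimal_subset] by (intro R.minus_closed R.one_closed)

lemma prod_one_minus_closed:
  "(\<Otimes>\<^bsub>R\<^esub>K\<in>minimal_subgroups (G Mod N). \<one>\<^bsub>R\<^esub> \<ominus>\<^bsub>R\<^esub> check_elem G (\<Union>K)) \<in> carrier R"
  using one_minus_check_elem_closed by (intro R.finprod_closed) blast

lemma eps_closed: "eps N \<in> carrier R"
  unfolding check_epsilon_def
  by (intro R.m_closed check_elem_closed prod_one_minus_closed subgroup.subset[OF N])

lemma X_eps: "g \<in> N \<Longrightarrow> X g \<otimes>\<^bsub>R\<^esub> eps N = eps N"
  unfolding check_epsilon_def
  using X_check_elem[OF N, of g] check_elem_closed[OF subgroup.subset[OF N]]
    subgroup.mem_carrier[OF N, of g] prod_one_minus_closed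
  by (simp only: R.m_assoc[symmetric] X_closed)

lemma one_minus_check_elem_idempotent:
  assumes "K \<in> minimal_subgroups (G Mod N)"
  shows "(\<one>\<^bsub>R\<^esub> \<ominus>\<^bsub>R\<^esub> check_elem G (\<Union>K)) \<otimes>\<^bsub>R\<^esub> (\<one>\<^bsub>R\<^esub> \<ominus>\<^bsub>R\<^esub> check_elem G (\<Union>K))
    = \<one>\<^bsub>R\<^esub> \<ominus>\<^bsub>R\<^esub> check_elem G (\<Union>K)"
  using check_elem_idempotent[OF minimal_subgroup_Mod(1)[OF N assms]]
    check_elem_closed[OF minimal_subset[OF assms]] by (rule R.one_minus_idempotent[rotated])

lemma eps_idempotent: "eps N \<otimes>\<^bsub>R\<^esub> eps N = eps N"
proof -
  define P where "P = (\<Otimes>\<^bsub>R\<^esub>K\<in>minimal_subgroups (G Mod N). \<one>\<^bsub>R\<^esub> \<ominus>\<^bsub>R\<^esub> check_elem G (\<Union>K))"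
  have P: "P \<in> carrier R" "P \<otimes>\<^bsub>R\<^esub> P = P"
    unfolding P_def
    by (rule prod_one_minus_closed, rule R.finprod_idempotent)
      (simp_all only: one_minus_check_elem_closed one_minus_check_elem_idempotent)
  have C: "check_elem G N \<in> carrier R" "check_elem G N \<otimes>\<^bsub>R\<^esub> check_elem G N = check_elem G N"
    using check_elem_closed[OF subgroup.subset[OF N]] check_elem_idempotent[OF N] by blast+
  have "(check_elem G N \<otimes>\<^bsub>R\<^esub> P) \<otimes>\<^bsub>R\<^esub> (check_elem G N \<otimes>\<^bsub>R\<^esub> P)
     = (check_elem G N \<otimes>\<^bsub>R\<^esub> check_elem G N) \<otimes>\<^bsub>R\<^esub> (P \<otimes>\<^bsub>R\<^esub> P)"
    using P(1) C(1) by (simp add: R.m_ac)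
  then show ?thesis unfolding check_epsilon_def P_def[symmetric] by (simp only: P C)
qed

text \<open>\<open>eps N\<close> contains the idempotent factor 1 - c, where c is the average over
  the subgroup in question, and c (1 - c) = 0.\<close>

lemma check_elem_eps:
  assumes "K \<in> minimal_subgroups (G Mod N)"
  shows "check_elem G (\<Union>K) \<otimes>\<^bsub>R\<^esub> eps N = \<zero>\<^bsub>R\<^esub>"
proof -
  define P where "P = (\<Otimes>\<^bsub>R\<^esub>K\<in>minimal_subgroups (G Mod N). \<one>\<^bsub>R\<^esub> \<ominus>\<^bsub>R\<^esub> check_elem G (\<Union>K))"
  have P: "P \<in> carrier R" unfolding P_def by (rule prod_one_minus_closed)
  have C: "check_elem G N \<in> carrier R" "check_elem G (\<Union>K) \<in> carrier R"
    by (intro check_elem_closed subgroup.subset[OF N] minimal_subset[OF assms])+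
  have "(\<one>\<^bsub>R\<^esub> \<ominus>\<^bsub>R\<^esub> check_elem G (\<Union>K)) \<otimes>\<^bsub>R\<^esub> P = P"
    unfolding P_def
    by (rule R.finprod_absorb[OF finite_minimal_subgroups_Mod[OF N] assms])
      (simp_all only: one_minus_check_elem_closed one_minus_check_elem_idempotent)
  then have "check_elem G (\<Union>K) \<otimes>\<^bsub>R\<^esub> P = \<zero>\<^bsub>R\<^esub>"
    using R.one_minus_fix_iff[OF C(2) P] by blast
  moreover have "check_elem G (\<Union>K) \<otimes>\<^bsub>R\<^esub> (check_elem G N \<otimes>\<^bsub>R\<^esub> P)
      = check_elem G N \<otimes>\<^bsub>R\<^esub> (check_elem G (\<Union>K) \<otimes>\<^bsub>R\<^esub> P)"
    by (rule R.m_lcomm[OF C(2) C(1) P])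
  ultimately show ?thesis
    unfolding check_epsilon_def P_def[symmetric] using C by simp
qed

end

lemma stabilizer_subgroup:
  assumes v: "v \<in> carrier R"
  shows "subgroup {g \<in> carrier G. X g \<otimes>\<^bsub>R\<^esub> v = v} G"
proof (rule subgroupI)
  show "{g \<in> carrier G. X g \<otimes>\<^bsub>R\<^esub> v = v} \<noteq> {}" using v X_one by fastforce
next
  fix a assume a: "a \<in> {g \<in> carrier G. X g \<otimes>\<^bsub>R\<^esub> v = v}"
  have "X (inv a) \<otimes>\<^bsub>R\<^esub> v = X (inv a) \<otimes>\<^bsub>R\<^esub> (X a \<otimes>\<^bsub>R\<^esub> v)" using a by simp
  also have "\<dots> = X (inv a \<otimes> a) \<otimes>\<^bsub>R\<^esub> v" using a v by (subst X_mult) (auto simp: R.m_assoc)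
  also have "\<dots> = v" using a v by (simp add: X_one)
  finally show "inv a \<in> {g \<in> carrier G. X g \<otimes>\<^bsub>R\<^esub> v = v}" using a by simp
next
  fix a b assume "a \<in> {g \<in> carrier G. X g \<otimes>\<^bsub>R\<^esub> v = v}" "b \<in> {g \<in> carrier G. X g \<otimes>\<^bsub>R\<^esub> v = v}"
  then show "a \<otimes> b \<in> {g \<in> carrier G. X g \<otimes>\<^bsub>R\<^esub> v = v}"
    using v by (simp add: X_mult R.m_assoc)
qed auto

text \<open>The stabilizer of v = z \<open>eps N\<close> contains N and also a, hence some L with
  L/N minimal. The average over L then fixes v, but it kills \<open>eps N\<close>. Every later
  vanishing statement about \<open>eps N\<close> rests on this.\<close>

lemma mult_eps_eq_zero:
  assumes N: "subgroup N G" and a: "a \<in> carrier G" "a \<notin> N" and z: "z \<in> carrier R"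
    and inv: "X a \<otimes>\<^bsub>R\<^esub> (z \<otimes>\<^bsub>R\<^esub> eps N) = z \<otimes>\<^bsub>R\<^esub> eps N"
  shows "z \<otimes>\<^bsub>R\<^esub> eps N = \<zero>\<^bsub>R\<^esub>"
proof -
  define v where "v = z \<otimes>\<^bsub>R\<^esub> eps N"
  have v: "v \<in> carrier R" unfolding v_def using z eps_closed[OF N] by (rule R.m_closed)
  define M where "M = {g \<in> carrier G. X g \<otimes>\<^bsub>R\<^esub> v = v}"
  have M: "subgroup M G" unfolding M_def by (rule stabilizer_subgroup[OF v])
  have "X g \<otimes>\<^bsub>R\<^esub> v = v" if g: "g \<in> N" for g
    unfolding v_def using z eps_closed[OF N] X_eps[OF N g] subgroup.mem_carrier[OF N g]
    by (subst R.m_lcomm) auto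
  then have "N \<subseteq> M" unfolding M_def using subgroup.mem_carrier[OF N] by blast
  moreover have "a \<in> M" unfolding M_def using a inv v_def by blast
  ultimately obtain K where K: "K \<in> minimal_subgroups (G Mod N)" "\<Union>K \<subseteq> M"
    using exists_minimal_subgroup_Mod[OF N M] a by blast
  have C: "check_elem G (\<Union>K) \<in> carrier R"
    by (rule check_elem_closed[OF minimal_subset[OF N K(1)]])
  have "v = check_elem G (\<Union>K) \<otimes>\<^bsub>R\<^esub> v"
    using K(2) minimal_subset[OF N K(1)] subgroup.one_closed[OF minimal_subgroup_Mod(1)[OF N K(1)]] M_def
    by (intro check_elem_fix[symmetric] v) blast+
  also have "\<dots> = z \<otimes>\<^bsub>R\<^esub> (check_elem G (\<Union>K) \<otimes>\<^bsub>R\<^esub> eps N)"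
    unfolding v_def by (rule R.m_lcomm[OF C z eps_closed[OF N]])
  also have "\<dots> = \<zero>\<^bsub>R\<^esub>" using check_elem_eps[OF N K(1)] z by simp
  finally show ?thesis unfolding v_def .
qed

section \<open>Rational multiples and power sums acting on \<open>eps N\<close>\<close>

definition multiples :: "('a set \<Rightarrow> rat) set \<Rightarrow> ('a set \<Rightarrow> rat) set set" where
  "multiples w = {scal c \<otimes>\<^bsub>R\<^esub> w | c. True}"

lemma multiplesI: "scal c \<otimes>\<^bsub>R\<^esub> w \<in> multiples w"
  unfolding multiples_def by blast

lemma multiplesE:
  assumes "y \<in> multiples w" obtains c where "y = scal c \<otimes>\<^bsub>R\<^esub> w"
  using assms unfolding multiples_def by blast

lemma multiples_closed: "w \<in> carrier R \<Longrightarrow> multiples w \<subseteq> carrier R"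
  by (auto simp: multiples_def)

lemma multiples_add:
  assumes "w \<in> carrier R" "y \<in> multiples w" "z \<in> multiples w" shows "y \<oplus>\<^bsub>R\<^esub> z \<in> multiples w"
proof -
  obtain c d where "y = scal c \<otimes>\<^bsub>R\<^esub> w" "z = scal d \<otimes>\<^bsub>R\<^esub> w" using assms by (blast elim: multiplesE)
  then have "y \<oplus>\<^bsub>R\<^esub> z = scal (c + d) \<otimes>\<^bsub>R\<^esub> w" using assms(1) by (simp add: scal_add R.l_distr)
  then show ?thesis using multiplesI by simp
qed

lemma multiples_scal:
  assumes "w \<in> carrier R" "y \<in> multiples w" shows "scal c \<otimes>\<^bsub>R\<^esub> y \<in> multiples w"
proof -
  obtain d where "y = scal d \<otimes>\<^bsub>R\<^esub> w" using assms by (blast elim: multiplesE)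
  then have "scal c \<otimes>\<^bsub>R\<^esub> y = scal (c * d) \<otimes>\<^bsub>R\<^esub> w" using assms(1) by (simp add: scal_mult R.m_assoc)
  then show ?thesis using multiplesI by simp
qed

lemma multiples_zero: "w \<in> carrier R \<Longrightarrow> \<zero>\<^bsub>R\<^esub> \<in> multiples w"
  using multiplesI[of 0 w] by (simp add: scal_zero)

lemma multiples_mult:
  assumes "w \<in> carrier R" "z \<in> carrier R" "y \<in> multiples w" shows "z \<otimes>\<^bsub>R\<^esub> y \<in> multiples (z \<otimes>\<^bsub>R\<^esub> w)"
proof -
  obtain d where "y = scal d \<otimes>\<^bsub>R\<^esub> w" using assms by (blast elim: multiplesE)
  then have "z \<otimes>\<^bsub>R\<^esub> y = scal d \<otimes>\<^bsub>R\<^esub> (z \<otimes>\<^bsub>R\<^esub> w)" using assms(1,2) by (simp add: R.m_lcomm)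
  then show ?thesis using multiplesI by simp
qed

lemma multiples_finsum:
  assumes "w \<in> carrier R" "finite I" "\<And>i. i \<in> I \<Longrightarrow> f i \<in> multiples w"
  shows "(\<Oplus>\<^bsub>R\<^esub>i\<in>I. f i) \<in> multiples w"
  using assms(2,3)
proof (induction I rule: finite_induct)
  case empty
  show ?case using multiples_zero[OF assms(1)] by simp
next
  case (insert i I)
  then have "f \<in> I \<rightarrow> carrier R" "f i \<in> carrier R" using multiples_closed[OF assms(1)] by blast+
  then show ?case using insert multiples_add[OF assms(1)] by simp
qed

lemma multiples_add_cancel:
  assumes w: "w \<in> carrier R" and y: "y \<in> carrier R" and z: "z \<in> multiples w" "y \<oplus>\<^bsub>R\<^esub> z \<in> multiples w"
  shows "y \<in> multiples w"
proof -
  have zR: "z \<in> carrier R" using z w multiples_closed by blast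
  have "scal (-1) \<otimes>\<^bsub>R\<^esub> z \<oplus>\<^bsub>R\<^esub> z = (scal (-1) \<oplus>\<^bsub>R\<^esub> scal 1) \<otimes>\<^bsub>R\<^esub> z"
    using zR by (simp add: R.l_distr scal_one)
  also have "\<dots> = \<zero>\<^bsub>R\<^esub>" using zR by (simp add: scal_zero flip: scal_add)
  finally have "y = (y \<oplus>\<^bsub>R\<^esub> z) \<oplus>\<^bsub>R\<^esub> scal (-1) \<otimes>\<^bsub>R\<^esub> z"
    using y zR by (simp add: R.a_ac)
  then show ?thesis using multiples_add[OF w z(2) multiples_scal[OF w z(1)]] by metis
qed

text \<open>The power sum z satisfies a z + 1 = a^m + z by telescoping, and a^m acts as 1 on
  \<open>eps N\<close>. So a fixes z \<open>eps N\<close>, while a is outside N.\<close>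

lemma power_sum_eps:
  assumes N: "subgroup N G" and a: "a \<in> carrier G" "a \<notin> N" "a [^] m \<in> N" and m: "m > (0::nat)"
  shows "(\<Oplus>\<^bsub>R\<^esub>r\<in>{..<m}. X (a [^] r)) \<otimes>\<^bsub>R\<^esub> eps N = \<zero>\<^bsub>R\<^esub>"
proof -
  obtain n where n: "m = Suc n" using m gr0_implies_Suc by blast
  define z where "z = (\<Oplus>\<^bsub>R\<^esub>r\<in>{..n}. X (a [^] r))"
  have cl: "X (a [^] r) \<in> carrier R" for r :: nat using a by simp
  have z: "z \<in> carrier R" unfolding z_def using cl by (intro R.finsum_closed) blast
  have e: "eps N \<in> carrier R" by (rule eps_closed[OF N])
  have "X a \<otimes>\<^bsub>R\<^esub> z = (\<Oplus>\<^bsub>R\<^esub>r\<in>{..n}. X a \<otimes>\<^bsub>R\<^esub> X (a [^] r))"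
    unfolding z_def using cl a by (intro R.finsum_rdistr) auto
  also have "\<dots> = (\<Oplus>\<^bsub>R\<^esub>r\<in>{..n}. X (a [^] Suc r))"
    using a cl by (intro R.finsum_cong') (auto simp: X_mult R.m_comm)
  finally have "X a \<otimes>\<^bsub>R\<^esub> z \<oplus>\<^bsub>R\<^esub> \<one>\<^bsub>R\<^esub> = (\<Oplus>\<^bsub>R\<^esub>r\<in>{..n}. X (a [^] Suc r)) \<oplus>\<^bsub>R\<^esub> X (a [^] (0::nat))"
    by (simp add: X_one)
  also have "\<dots> = (\<Oplus>\<^bsub>R\<^esub>r\<in>{..Suc n}. X (a [^] r))"
    using cl by (intro R.finsum_Suc2[symmetric]) blast
  also have "\<dots> = X (a [^] m) \<oplus>\<^bsub>R\<^esub> z"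
    unfolding z_def n using cl by (intro R.finsum_Suc) blast
  finally have "(X a \<otimes>\<^bsub>R\<^esub> z \<oplus>\<^bsub>R\<^esub> \<one>\<^bsub>R\<^esub>) \<otimes>\<^bsub>R\<^esub> eps N = (X (a [^] m) \<oplus>\<^bsub>R\<^esub> z) \<otimes>\<^bsub>R\<^esub> eps N"
    by simp
  then have "X a \<otimes>\<^bsub>R\<^esub> (z \<otimes>\<^bsub>R\<^esub> eps N) \<oplus>\<^bsub>R\<^esub> eps N = z \<otimes>\<^bsub>R\<^esub> eps N \<oplus>\<^bsub>R\<^esub> eps N"
    using z e a cl X_eps[OF N a(3)] by (simp add: R.l_distr R.m_assoc R.a_comm)
  then have "X a \<otimes>\<^bsub>R\<^esub> (z \<otimes>\<^bsub>R\<^esub> eps N) = z \<otimes>\<^bsub>R\<^esub> eps N"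
    using z e a by simp
  then have "z \<otimes>\<^bsub>R\<^esub> eps N = \<zero>\<^bsub>R\<^esub>" using mult_eps_eq_zero[OF N a(1,2) z] by blast
  then show ?thesis by (simp add: z_def n lessThan_Suc_atMost)
qed

lemma full_power_sum_multiples:
  assumes N: "subgroup N G" and a: "a \<in> carrier G" "a [^] m \<in> N" and m: "m > (0::nat)"
  shows "(\<Oplus>\<^bsub>R\<^esub>r\<in>{..<m}. X (a [^] r)) \<otimes>\<^bsub>R\<^esub> eps N \<in> multiples (eps N)"
proof (cases "a \<in> N")
  case True
  have e: "eps N \<in> carrier R" by (rule eps_closed[OF N])
  have "a [^] r \<in> N" for r :: nat
    by (induction r) (use True subgroup.one_closed[OF N] subgroup.m_closed[OF N] in simp_all)
  then have "X (a [^] r) \<otimes>\<^bsub>R\<^esub> eps N \<in> multiples (eps N)" for r :: nat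
    using X_eps[OF N] multiplesI[of 1 "eps N"] e by (simp add: scal_one)
  then have "(\<Oplus>\<^bsub>R\<^esub>r\<in>{..<m}. X (a [^] r) \<otimes>\<^bsub>R\<^esub> eps N) \<in> multiples (eps N)"
    by (intro multiples_finsum e) auto
  also have "(\<Oplus>\<^bsub>R\<^esub>r\<in>{..<m}. X (a [^] r) \<otimes>\<^bsub>R\<^esub> eps N) = (\<Oplus>\<^bsub>R\<^esub>r\<in>{..<m}. X (a [^] r)) \<otimes>\<^bsub>R\<^esub> eps N"
    using a e by (intro R.finsum_ldistr[symmetric]) auto
  finally show ?thesis .
next
  case False
  then show ?thesis
    using power_sum_eps[OF N a(1) False a(2) m] multiples_zero[OF eps_closed[OF N]] by simp
qed

text \<open>Representatives of the units modulo m. For m = 1 the set is {0}, as 0 is coprime to 1,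
  so it is nonempty for every positive m.\<close>

definition units_below :: "nat \<Rightarrow> nat set" where
  "units_below m = {r. r < m \<and> coprime r m}"

lemma finite_units_below: "finite (units_below m)"
  by (simp add: units_below_def)

lemma units_below_reindex:
  assumes d: "d dvd m" and m: "m > 0"
  shows "{r. r < m \<and> gcd r m = d} = (\<lambda>r. d * r) ` units_below (m div d)"
proof -
  obtain q where q: "m = d * q" using d by blast
  have dq: "d > 0" "q > 0" using m q by auto
  show ?thesis
  proof (intro equalityI subsetI)
    fix r assume r: "r \<in> {r. r < m \<and> gcd r m = d}"
    then have "d dvd r" by auto
    then obtain s where s: "r = d * s" by blast
    have "d * gcd s q = d" using r s q by (simp add: gcd_mult_distrib_nat)
    then have "coprime s q" using dq by (simp add: coprime_iff_gcd_eq_1)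
    then show "r \<in> (\<lambda>r. d * r) ` units_below (m div d)"
      using r s q dq by (auto simp: units_below_def)
  next
    fix r assume "r \<in> (\<lambda>r. d * r) ` units_below (m div d)"
    then show "r \<in> {r. r < m \<and> gcd r m = d}"
      using q dq by (auto simp: units_below_def coprime_iff_gcd_eq_1 gcd_mult_distrib_nat[symmetric])
  qed
qed

text \<open>Splitting the full power sum according to \<open>gcd(r, m)\<close> expresses the sum over units through
  full power sums and shorter sums over units.\<close>

lemma unit_power_sum_multiples:
  assumes N: "subgroup N G"
  shows "\<lbrakk>a \<in> carrier G; a [^] m \<in> N; m > 0\<rbrakk> \<Longrightarrow>
    (\<Oplus>\<^bsub>R\<^esub>r\<in>units_below m. X (a [^] r)) \<otimes>\<^bsub>R\<^esub> eps N \<in> multiples (eps N)"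
proof (induction m arbitrary: a rule: less_induct)
  case (less m)
  have e: "eps N \<in> carrier R" by (rule eps_closed[OF N])
  have cl: "X (a [^] r) \<in> carrier R" for r :: nat using less.prems by simp
  define D where "D = {d. d dvd m}"
  have finD: "finite D" unfolding D_def using less.prems by (simp add: finite_divisors_nat)
  define T where "T d = (\<Oplus>\<^bsub>R\<^esub>r\<in>{r. r < m \<and> gcd r m = d}. X (a [^] r))" for d
  have T: "T d \<in> carrier R" for d unfolding T_def using cl by (intro R.finsum_closed) blast
  have "{..<m} = (\<Union>d\<in>D. {r. r < m \<and> gcd r m = d})" by (auto simp: D_def)
  then have "(\<Oplus>\<^bsub>R\<^esub>r\<in>{..<m}. X (a [^] r)) = (\<Oplus>\<^bsub>R\<^esub>d\<in>D. T d)"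
    unfolding T_def using finD cl
    by (simp only:) (intro R.add.finprod_UN_disjoint; auto simp: pairwise_def disjnt_def)
  also have "\<dots> = T 1 \<oplus>\<^bsub>R\<^esub> (\<Oplus>\<^bsub>R\<^esub>d\<in>D - {1}. T d)"
  proof -
    have "D = insert 1 (D - {1})" by (auto simp: D_def)
    moreover have "(\<Oplus>\<^bsub>R\<^esub>d\<in>insert 1 (D - {1}). T d) = T 1 \<oplus>\<^bsub>R\<^esub> (\<Oplus>\<^bsub>R\<^esub>d\<in>D - {1}. T d)"
      using finD T by (intro R.finsum_insert) auto
    ultimately show ?thesis by metis
  qed
  finally have "(\<Oplus>\<^bsub>R\<^esub>r\<in>{..<m}. X (a [^] r)) \<otimes>\<^bsub>R\<^esub> eps N
      = T 1 \<otimes>\<^bsub>R\<^esub> eps N \<oplus>\<^bsub>R\<^esub> (\<Oplus>\<^bsub>R\<^esub>d\<in>D - {1}. T d) \<otimes>\<^bsub>R\<^esub> eps N"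
    using T e R.finsum_closed[of T] by (simp add: R.l_distr)
  then have sum: "T 1 \<otimes>\<^bsub>R\<^esub> eps N \<oplus>\<^bsub>R\<^esub> (\<Oplus>\<^bsub>R\<^esub>d\<in>D - {1}. T d) \<otimes>\<^bsub>R\<^esub> eps N \<in> multiples (eps N)"
    using full_power_sum_multiples[OF N less.prems] by simp
  have "T d \<otimes>\<^bsub>R\<^esub> eps N \<in> multiples (eps N)" if d: "d \<in> D - {1}" for d
  proof -
    have dm: "d dvd m" "d \<noteq> 1" "d > 0" using d less.prems by (auto simp: D_def intro: Nat.gr0I)
    \<comment> \<open>The residues r with gcd(r, m) = d are d times the units modulo m/d. So this
      class contributes the unit power sum of a^d with modulus m/d < m, to which the induction
      hypothesis applies.\<close>
    have "T d = (\<Oplus>\<^bsub>R\<^esub>r\<in>units_below (m div d). X (a [^] (d * r)))"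
      unfolding T_def units_below_reindex[OF dm(1) less.prems(3)]
      using cl dm by (intro R.finsum_reindex) (auto intro!: inj_onI)
    also have "\<dots> = (\<Oplus>\<^bsub>R\<^esub>r\<in>units_below (m div d). X ((a [^] d) [^] r))"
      using less.prems by (simp add: nat_pow_pow)
    moreover have "m div d < m" "m div d > 0" "(a [^] d) [^] (m div d) = a [^] m"
      using less.prems dm by (simp_all add: nat_pow_pow dvd_imp_le div_greater_zero_iff)
    ultimately show ?thesis
      using less.IH[of "m div d" "a [^] d"] less.prems by simp
  qed
  then have "(\<Oplus>\<^bsub>R\<^esub>d\<in>D - {1}. T d \<otimes>\<^bsub>R\<^esub> eps N) \<in> multiples (eps N)"
    using finD by (intro multiples_finsum e) auto
  moreover have "(\<Oplus>\<^bsub>R\<^esub>d\<in>D - {1}. T d \<otimes>\<^bsub>R\<^esub> eps N) = (\<Oplus>\<^bsub>R\<^esub>d\<in>D - {1}. T d) \<otimes>\<^bsub>R\<^esub> eps N"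
    using T e finD by (intro R.finsum_ldistr[symmetric]) auto
  ultimately have "T 1 \<otimes>\<^bsub>R\<^esub> eps N \<in> multiples (eps N)"
    using sum T e by (intro multiples_add_cancel[OF e _ _ sum]) auto
  moreover have "{r. r < m \<and> gcd r m = 1} = units_below m"
    by (auto simp: units_below_def coprime_iff_gcd_eq_1)
  ultimately show ?case unfolding T_def by simp
qed

end

section \<open>The products \<open>\<psi>(G, H) \<epsilon>(G, N)\<close>\<close>

lemma (in cring) diff_idempotent:
  assumes "a \<in> carrier R" "b \<in> carrier R" "a \<otimes> a = a" "a \<otimes> b = b" "b \<otimes> b = b"
  shows "(a \<ominus> b) \<otimes> (a \<ominus> b) = a \<ominus> b"
proof -
  have "(a \<ominus> b) \<otimes> (a \<ominus> b) = a \<otimes> a \<ominus> a \<otimes> b \<oplus> (b \<otimes> b \<ominus> a \<otimes> b)"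
    using assms(1,2) by (simp add: minus_eq l_distr r_distr l_minus r_minus m_comm a_ac)
  then show ?thesis using assms by (simp add: minus_eq r_neg)
qed

context finite_comm_group
begin

lemma subgroup_in_S: "subgroup L G \<Longrightarrow> L \<in> carrier S"
  using subgroup.subset subgroup.one_closed by (fastforce simp: S_simps)

lemma set_mult_subgroup_absorb:
  assumes M: "subgroup M G" and B: "B \<subseteq> M" "B \<noteq> {}"
  shows "B <#> M = M"
proof
  show "B <#> M \<subseteq> M" using B subgroup.m_closed[OF M] by (auto simp: set_mult_def)
  obtain b where b: "b \<in> B" "b \<in> M" using B by blast
  show "M \<subseteq> B <#> M"
  proof
    fix x assume x: "x \<in> M"
    have "inv b \<otimes> x \<in> M" using b x subgroup.m_closed[OF M] subgroup.m_inv_closed[OF M] by blast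
    moreover have "x = b \<otimes> (inv b \<otimes> x)"
      using subgroup.mem_carrier[OF M] x b by (simp flip: m_assoc)
    ultimately show "x \<in> B <#> M" using b(1) unfolding set_mult_def by blast
  qed
qed

lemma chi_absorb:
  assumes "subgroup M G" "B \<subseteq> M" "B \<in> carrier S"
  shows "chi G B \<otimes>\<^bsub>R\<^esub> chi G M = chi G M"
  using assms set_mult_subgroup_absorb[of M B] by (simp add: chi_mult subgroup_in_S) (simp add: S_simps)

context
  fixes H assumes H: "subgroup H G" "H \<noteq> carrier G"
begin

lemma psi_factor:
  assumes "K \<in> minimal_subgroups (G Mod H)"
  shows "chi G H \<ominus>\<^bsub>R\<^esub> chi G (\<Union>K) \<in> carrier R"
    and "(chi G H \<ominus>\<^bsub>R\<^esub> chi G (\<Union>K)) \<otimes>\<^bsub>R\<^esub> (chi G H \<ominus>\<^bsub>R\<^esub> chi G (\<Union>K)) = chi G H \<ominus>\<^bsub>R\<^esub> chi G (\<Union>K)"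
    and "chi G H \<otimes>\<^bsub>R\<^esub> (chi G H \<ominus>\<^bsub>R\<^esub> chi G (\<Union>K)) = chi G H \<ominus>\<^bsub>R\<^esub> chi G (\<Union>K)"
proof -
  note K = minimal_subgroup_Mod[OF H(1) assms]
  have c: "chi G H \<in> carrier R" "chi G (\<Union>K) \<in> carrier R"
    using subgroup_in_S H K by simp_all
  have m: "chi G H \<otimes>\<^bsub>R\<^esub> chi G H = chi G H" "chi G H \<otimes>\<^bsub>R\<^esub> chi G (\<Union>K) = chi G (\<Union>K)"
    "chi G (\<Union>K) \<otimes>\<^bsub>R\<^esub> chi G (\<Union>K) = chi G (\<Union>K)"
    by (rule chi_absorb[OF _ _ subgroup_in_S], (rule H K subset_refl)+)+
  show "chi G H \<ominus>\<^bsub>R\<^esub> chi G (\<Union>K) \<in> carrier R" using c by (rule R.minus_closed)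
  show "(chi G H \<ominus>\<^bsub>R\<^esub> chi G (\<Union>K)) \<otimes>\<^bsub>R\<^esub> (chi G H \<ominus>\<^bsub>R\<^esub> chi G (\<Union>K)) = chi G H \<ominus>\<^bsub>R\<^esub> chi G (\<Union>K)"
    using c m by (rule R.diff_idempotent)
  show "chi G H \<otimes>\<^bsub>R\<^esub> (chi G H \<ominus>\<^bsub>R\<^esub> chi G (\<Union>K)) = chi G H \<ominus>\<^bsub>R\<^esub> chi G (\<Union>K)"
    using c by (simp add: R.minus_eq R.r_distr R.r_minus m)
qed

lemma psi_closed: "psi G H \<in> carrier R"
  unfolding psi_def using psi_factor(1) by (intro R.finprod_closed) blast

lemma psi_idempotent: "psi G H \<otimes>\<^bsub>R\<^esub> psi G H = psi G H"
  unfolding psi_def by (rule R.finprod_idempotent) (simp_all only: psi_factor)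

lemma psi_factor_absorb:
  assumes "K \<in> minimal_subgroups (G Mod H)"
  shows "(chi G H \<ominus>\<^bsub>R\<^esub> chi G (\<Union>K)) \<otimes>\<^bsub>R\<^esub> psi G H = psi G H"
  unfolding psi_def
  by (rule R.finprod_absorb[OF finite_minimal_subgroups_Mod[OF H(1)] assms])
    (simp_all only: psi_factor)

text \<open>H is proper, so G/H has a minimal subgroup and the product is not empty; any one of its
  factors is already fixed by chi_H.\<close>

lemma chi_psi: "chi G H \<otimes>\<^bsub>R\<^esub> psi G H = psi G H"
proof -
  obtain K where K: "K \<in> minimal_subgroups (G Mod H)" "\<Union>K \<subseteq> carrier G"
    by (rule exists_minimal_subgroup_Mod[OF H(1) subgroup_self subgroup.subset[OF H(1)] H(2)])
  have "chi G H \<otimes>\<^bsub>R\<^esub> psi G H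
      = chi G H \<otimes>\<^bsub>R\<^esub> ((chi G H \<ominus>\<^bsub>R\<^esub> chi G (\<Union>K)) \<otimes>\<^bsub>R\<^esub> psi G H)"
    by (simp only: psi_factor_absorb[OF K(1)])
  also have "\<dots> = (chi G H \<otimes>\<^bsub>R\<^esub> (chi G H \<ominus>\<^bsub>R\<^esub> chi G (\<Union>K))) \<otimes>\<^bsub>R\<^esub> psi G H"
    using chi_closed[OF subgroup_in_S[OF H(1)]] psi_factor(1)[OF K(1)] psi_closed by (rule R.m_assoc[symmetric])
  also have "\<dots> = psi G H" by (simp only: psi_factor(3)[OF K(1)] psi_factor_absorb[OF K(1)])
  finally show ?thesis .
qed

text \<open>Some H' with H'/H minimal lies in M, and chi_M absorbs both chi_H and chi_H'. Thus chi_M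
  annihilates their difference, a factor of \<open>psi G H\<close>.\<close>

lemma chi_psi_eq_zero:
  assumes M: "subgroup M G" "H \<subseteq> M" "H \<noteq> M"
  shows "chi G M \<otimes>\<^bsub>R\<^esub> psi G H = \<zero>\<^bsub>R\<^esub>"
proof -
  obtain K where K: "K \<in> minimal_subgroups (G Mod H)" "\<Union>K \<subseteq> M"
    using exists_minimal_subgroup_Mod[OF H(1) M] by blast
  have sK: "subgroup (\<Union>K) G" using minimal_subgroup_Mod[OF H(1) K(1)] by blast
  have c: "chi G H \<in> carrier R" "chi G (\<Union>K) \<in> carrier R" "chi G M \<in> carrier R"
    using subgroup_in_S[OF H(1)] subgroup_in_S[OF sK] subgroup_in_S[OF M(1)] by simp_all
  have "chi G M \<otimes>\<^bsub>R\<^esub> psi G H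
      = chi G M \<otimes>\<^bsub>R\<^esub> ((chi G H \<ominus>\<^bsub>R\<^esub> chi G (\<Union>K)) \<otimes>\<^bsub>R\<^esub> psi G H)"
    by (simp only: psi_factor_absorb[OF K(1)])
  also have "\<dots> = (chi G M \<otimes>\<^bsub>R\<^esub> (chi G H \<ominus>\<^bsub>R\<^esub> chi G (\<Union>K))) \<otimes>\<^bsub>R\<^esub> psi G H"
    using c(3) psi_factor(1)[OF K(1)] psi_closed by (rule R.m_assoc[symmetric])
  also have "chi G M \<otimes>\<^bsub>R\<^esub> (chi G H \<ominus>\<^bsub>R\<^esub> chi G (\<Union>K))
      = chi G H \<otimes>\<^bsub>R\<^esub> chi G M \<ominus>\<^bsub>R\<^esub> chi G (\<Union>K) \<otimes>\<^bsub>R\<^esub> chi G M"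
    using c by (simp add: R.minus_eq R.r_distr R.r_minus R.m_comm)
  also have "\<dots> = \<zero>\<^bsub>R\<^esub>"
    using chi_absorb[OF M(1,2) subgroup_in_S[OF H(1)]] chi_absorb[OF M(1) K(2) subgroup_in_S[OF sK]] c
    by (simp add: R.minus_eq R.r_neg)
  finally show ?thesis using psi_closed by simp
qed

end

section \<open>Large powers of subsets\<close>

lemma singleton_pow: "a \<in> carrier G \<Longrightarrow> {a} [^]\<^bsub>S\<^esub> (k::nat) = {a [^] k}"
  by (induction k) (auto simp: S_simps set_mult_def)

text \<open>Since 1 is in C, the powers form an increasing chain in a finite group, constant from a
  power M of largest cardinality on. Comparing C^(2j) with C^j gives M M = M, and inverses are
  positive powers.\<close>

lemma set_pow_stabilizes:
  assumes C: "C \<in> carrier S" "\<one> \<in> C"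
  obtains M j where "subgroup M G" "\<And>k::nat. k \<ge> j \<Longrightarrow> C [^]\<^bsub>S\<^esub> k = M"
proof -
  have inS: "C [^]\<^bsub>S\<^esub> k \<in> carrier S" for k :: nat using C by simp
  have sub: "C [^]\<^bsub>S\<^esub> k \<subseteq> carrier G" for k :: nat using inS[of k] by (simp add: S_simps)
  have step: "C [^]\<^bsub>S\<^esub> k \<subseteq> C [^]\<^bsub>S\<^esub> Suc k" for k :: nat
  proof
    fix x assume x: "x \<in> C [^]\<^bsub>S\<^esub> k"
    then have "x \<otimes> \<one> \<in> C [^]\<^bsub>S\<^esub> k <#> C" using C(2) unfolding set_mult_def by blast
    then show "x \<in> C [^]\<^bsub>S\<^esub> Suc k" using x sub[of k] by (auto simp: S_simps(2))
  qed
  have mono: "C [^]\<^bsub>S\<^esub> k \<subseteq> C [^]\<^bsub>S\<^esub> l" if "k \<le> l" for k l :: nat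
    using lift_Suc_mono_le[of "\<lambda>k::nat. C [^]\<^bsub>S\<^esub> k", OF step that] .
  have finC: "finite (C [^]\<^bsub>S\<^esub> k)" for k :: nat using sub finite_G finite_subset by blast
  obtain j :: nat where j: "\<And>k::nat. card (C [^]\<^bsub>S\<^esub> k) \<le> card (C [^]\<^bsub>S\<^esub> j)"
    using ex_has_greatest_nat[of "\<lambda>_. True" 0 "\<lambda>k::nat. card (C [^]\<^bsub>S\<^esub> k)" "Suc (card (carrier G))"]
      card_mono[OF finite_G sub] by (auto simp: less_Suc_eq_le)
  define M where "M = C [^]\<^bsub>S\<^esub> j"
  have stable: "C [^]\<^bsub>S\<^esub> k = M" if "k \<ge> j" for k
    unfolding M_def using card_seteq[OF finC mono[OF that] j] by simp
  have one: "\<one> \<in> M"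
    using mono[of 0 j] unfolding M_def by (simp add: S_simps(3))
  have closed: "x \<otimes> y \<in> M" if "x \<in> M" "y \<in> M" for x y
  proof -
    have "C [^]\<^bsub>S\<^esub> j <#> C [^]\<^bsub>S\<^esub> j = C [^]\<^bsub>S\<^esub> (j + j)"
      using S.nat_pow_mult[OF C(1), of j j] by (simp add: S_simps(2))
    then have "M <#> M = M" using stable[of "j + j"] by (simp add: M_def)
    then show ?thesis using that unfolding set_mult_def by blast
  qed
  have MG: "M \<subseteq> carrier G" unfolding M_def by (rule sub)
  have pow: "x [^] n \<in> M" if "x \<in> M" for x and n :: nat
    by (induction n) (use one closed that in simp_all)
  have "subgroup M G"
  proof (rule subgroupI)
    fix x assume x: "x \<in> M"
    then have xG: "x \<in> carrier G" using MG by blast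
    have "order G > 0" using finite_G order_gt_0_iff_finite by blast
    then have "x \<otimes> x [^] (order G - 1) = x [^] order G"
      using xG by (metis Suc_pred' nat_pow_Suc2)
    then have "inv x = x [^] (order G - 1)"
      using xG pow_order_eq_1[OF xG] by (metis inv_equality m_comm nat_pow_closed)
    then show "inv x \<in> M" using pow x by simp
  qed (use MG one closed in auto)
  then show ?thesis using that stable by blast
qed

text \<open>Write B = a C with 1 in C, so that B^k = a^k M for large k. If M is inside H, chi_M
  fixes \<open>psi G H\<close>; otherwise M H is strictly larger than H and chi_M
  \<open>psi G H\<close> = chi_(MH) \<open>psi G H\<close> = 0. So c is 1 or 0, and neither a nor c
  depends on k.\<close>

lemma chi_pow_psi:
  assumes H: "subgroup H G" "H \<noteq> carrier G" and B: "B \<in> carrier S"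
  shows "\<exists>a\<in>carrier G. \<exists>c j. \<forall>k\<ge>j. chi G (B [^]\<^bsub>S\<^esub> (k::nat)) \<otimes>\<^bsub>R\<^esub> psi G H
    = scal c \<otimes>\<^bsub>R\<^esub> (X (a [^] k) \<otimes>\<^bsub>R\<^esub> psi G H)"
proof -
  have psiR: "psi G H \<in> carrier R" by (rule psi_closed[OF H])
  obtain a where a: "a \<in> B" "a \<in> carrier G" using B by (auto simp: S_simps)
  define C where "C = {inv a} <#> B"
  have aS: "{a} \<in> carrier S" "{inv a} \<in> carrier S" using a by (simp_all add: S_simps)
  have C: "C \<in> carrier S" using S.m_closed[OF aS(2) B] by (simp add: C_def S_simps(2))
  have "inv a \<otimes> a \<in> C" unfolding C_def set_mult_def using a(1) by blast
  then have one: "\<one> \<in> C" using a by simp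
  have "{a} \<otimes>\<^bsub>S\<^esub> C = ({a} \<otimes>\<^bsub>S\<^esub> {inv a}) \<otimes>\<^bsub>S\<^esub> B"
    using S.m_assoc[OF aS B] by (simp add: C_def S_simps(2))
  also have "{a} \<otimes>\<^bsub>S\<^esub> {inv a} = \<one>\<^bsub>S\<^esub>" using a by (simp add: S_simps(2,3) set_mult_def)
  finally have BC: "B = {a} \<otimes>\<^bsub>S\<^esub> C" using B by simp
  obtain M j where M: "subgroup M G" "\<And>k::nat. k \<ge> j \<Longrightarrow> C [^]\<^bsub>S\<^esub> k = M"
    using set_pow_stabilizes[OF C one] by blast
  have MS: "M \<in> carrier S" by (rule subgroup_in_S[OF M(1)])
  have HS: "H \<in> carrier S" by (rule subgroup_in_S[OF H(1)])
  have "\<exists>c. chi G M \<otimes>\<^bsub>R\<^esub> psi G H = scal c \<otimes>\<^bsub>R\<^esub> psi G H"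
  proof (cases "M \<subseteq> H")
    case True
    have "chi G M \<otimes>\<^bsub>R\<^esub> psi G H = chi G M \<otimes>\<^bsub>R\<^esub> (chi G H \<otimes>\<^bsub>R\<^esub> psi G H)"
      by (simp only: chi_psi[OF H])
    also have "\<dots> = chi G H \<otimes>\<^bsub>R\<^esub> psi G H"
      using chi_absorb[OF H(1) True MS] MS HS psiR by (simp flip: R.m_assoc)
    also have "\<dots> = scal 1 \<otimes>\<^bsub>R\<^esub> psi G H"
      using psiR by (simp add: chi_psi[OF H] scal_one)
    finally show ?thesis by blast
  next
    case False
    have HM: "subgroup (M <#> H) G" by (rule mult_subgroups[OF M(1) H(1)])
    have MHM: "M \<subseteq> M <#> H"
    proof
      fix x assume "x \<in> M"
      then have "x \<otimes> \<one> \<in> M <#> H" "x \<in> carrier G"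
        using subgroup.one_closed[OF H(1)] subgroup.mem_carrier[OF M(1)] unfolding set_mult_def by blast+
      then show "x \<in> M <#> H" by simp
    qed
    have HHM: "H \<subseteq> M <#> H"
    proof
      fix x assume "x \<in> H"
      then have "\<one> \<otimes> x \<in> M <#> H" "x \<in> carrier G"
        using subgroup.one_closed[OF M(1)] subgroup.mem_carrier[OF H(1)] unfolding set_mult_def by blast+
      then show "x \<in> M <#> H" by simp
    qed
    have "chi G M \<otimes>\<^bsub>R\<^esub> psi G H = chi G M \<otimes>\<^bsub>R\<^esub> (chi G H \<otimes>\<^bsub>R\<^esub> psi G H)"
      by (simp only: chi_psi[OF H])
    also have "\<dots> = chi G (M <#> H) \<otimes>\<^bsub>R\<^esub> psi G H"
      using MS HS psiR by (simp add: chi_mult flip: R.m_assoc)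
    also have "\<dots> = \<zero>\<^bsub>R\<^esub>"
      using HM HHM MHM False by (intro chi_psi_eq_zero[OF H]) auto
    also have "\<dots> = scal 0 \<otimes>\<^bsub>R\<^esub> psi G H" using psiR by (simp add: scal_zero)
    finally show ?thesis by blast
  qed
  then obtain c where c: "chi G M \<otimes>\<^bsub>R\<^esub> psi G H = scal c \<otimes>\<^bsub>R\<^esub> psi G H" by blast
  have "chi G (B [^]\<^bsub>S\<^esub> k) \<otimes>\<^bsub>R\<^esub> psi G H = scal c \<otimes>\<^bsub>R\<^esub> (X (a [^] k) \<otimes>\<^bsub>R\<^esub> psi G H)"
    if k: "k \<ge> j" for k
  proof -
    have ak: "X (a [^] k) \<in> carrier R" using a by simp
    have "B [^]\<^bsub>S\<^esub> k = {a [^] k} <#> M"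
      by (simp only: BC S.nat_pow_distrib[OF aS(1) C] singleton_pow[OF a(2)] M(2)[OF k] S_simps(2)[symmetric])
    then have "chi G (B [^]\<^bsub>S\<^esub> k) = X (a [^] k) \<otimes>\<^bsub>R\<^esub> chi G M"
      using a MS by (simp add: chi_mult S_simps)
    then have "chi G (B [^]\<^bsub>S\<^esub> k) \<otimes>\<^bsub>R\<^esub> psi G H = X (a [^] k) \<otimes>\<^bsub>R\<^esub> (scal c \<otimes>\<^bsub>R\<^esub> psi G H)"
      using ak MS psiR by (simp add: R.m_assoc c)
    then show ?thesis using ak psiR by (simp add: R.m_lcomm)
  qed
  then show ?thesis using a(2) by blast
qed

text \<open>An idempotent is unchanged by \<open>B \<mapsto> B\<^sup>k\<close> for suitable large \<open>k\<close> in every residue class of units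
  modulo \<open>|G|\<close>; averaging over these classes gives the scalar.\<close>

theorem idempotent_mult_multiples:
  assumes H: "subgroup H G" "H \<noteq> carrier G" and N: "subgroup N G"
    and e: "e \<in> carrier R" "e \<otimes>\<^bsub>R\<^esub> e = e"
  shows "e \<otimes>\<^bsub>R\<^esub> (psi G H \<otimes>\<^bsub>R\<^esub> eps N) \<in> multiples (psi G H \<otimes>\<^bsub>R\<^esub> eps N)"
proof -
  define w where "w = psi G H \<otimes>\<^bsub>R\<^esub> eps N"
  have psiR: "psi G H \<in> carrier R" by (rule psi_closed[OF H])
  have epsR: "eps N \<in> carrier R" by (rule eps_closed[OF N])
  have wR: "w \<in> carrier R" unfolding w_def using psiR epsR by (rule R.m_closed)
  obtain x where x: "x \<in> carrier S.A" "x \<otimes>\<^bsub>S.A\<^esub> x = x" "e = proj x"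
    using lift_idempotent[OF e] by blast
  obtain D :: nat where D: "D > 0" "\<And>k. k > 0 \<Longrightarrow> coprime k D \<Longrightarrow> S.frob k x = x"
    using S.frob_idempotent[OF x(1,2)] by blast
  have "\<forall>B\<in>carrier S. \<exists>a c j. a \<in> carrier G \<and> (\<forall>k\<ge>j. chi G (B [^]\<^bsub>S\<^esub> (k::nat)) \<otimes>\<^bsub>R\<^esub> psi G H
    = scal c \<otimes>\<^bsub>R\<^esub> (X (a [^] k) \<otimes>\<^bsub>R\<^esub> psi G H))"
    using chi_pow_psi[OF H] by blast
  then obtain a c j where acj: "\<And>B. B \<in> carrier S \<Longrightarrow> a B \<in> carrier G"
    "\<And>B k. \<lbrakk>B \<in> carrier S; k \<ge> j B\<rbrakk> \<Longrightarrow> chi G (B [^]\<^bsub>S\<^esub> (k::nat)) \<otimes>\<^bsub>R\<^esub> psi G H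
    = scal (c B) \<otimes>\<^bsub>R\<^esub> (X (a B [^] k) \<otimes>\<^bsub>R\<^esub> psi G H)"
    unfolding bchoice_iff by blast
  define J where "J = (\<Sum>B\<in>carrier S. j B)"
  have J: "j B \<le> J" if "B \<in> carrier S" for B
    unfolding J_def using that S.fin by (intro member_le_sum) auto
  define n where "n = order G"
  have n: "n > 0" unfolding n_def using finite_G order_gt_0_iff_finite by blast
  define U where "U = units_below n"
  define s where "s B = x B * c B" for B
  define g where "g B r = scal (s B) \<otimes>\<^bsub>R\<^esub> (psi G H \<otimes>\<^bsub>R\<^esub> (X (a B [^] r) \<otimes>\<^bsub>R\<^esub> eps N))" for B and r :: nat
  have XR: "X (a B [^] r) \<in> carrier R" if "B \<in> carrier S" for B and r :: nat
    using acj(1)[OF that] by simp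
  have gR: "g B r \<in> carrier R" if "B \<in> carrier S" for B r
    unfolding g_def using XR[OF that] psiR epsR by (intro R.m_closed scal_closed)
  have main: "e \<otimes>\<^bsub>R\<^esub> w = (\<Oplus>\<^bsub>R\<^esub>B\<in>carrier S. g B r)" if r: "r \<in> U" for r
  proof -
    have r': "r < n" "coprime r n" using r by (simp_all add: U_def units_below_def)
    \<comment> \<open>Size at least J passes every threshold \<open>j B\<close>; the extra 1 makes k
      positive, as the invariance under \<open>frob\<close> demands. The class modulo n = |G| gives
      a^k = a^r.\<close>
    obtain k where k: "k \<ge> Suc J" "coprime k D" "k mod n = r mod n"
      using coprime_shift_ge[OF r'(2) D(1) n] by blast
    have "e = proj (S.frob k x)" using D(2)[OF _ k(2)] k(1) x(3) by simp
    also have "\<dots> = (\<Oplus>\<^bsub>R\<^esub>B\<in>carrier S. proj (single (B [^]\<^bsub>S\<^esub> k) (x B)))"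
      unfolding S.push_eq_finsum[OF S.pow_funcset]
      by (subst proj.hom_finsum) (auto simp: comp_def)
    also have "\<dots> = (\<Oplus>\<^bsub>R\<^esub>B\<in>carrier S. scal (x B) \<otimes>\<^bsub>R\<^esub> chi G (B [^]\<^bsub>S\<^esub> k))"
      by (intro R.finsum_cong') (simp_all add: proj_single)
    finally have "e \<otimes>\<^bsub>R\<^esub> w = (\<Oplus>\<^bsub>R\<^esub>B\<in>carrier S. scal (x B) \<otimes>\<^bsub>R\<^esub> chi G (B [^]\<^bsub>S\<^esub> k) \<otimes>\<^bsub>R\<^esub> w)"
      using wR S.fin by (simp add: R.finsum_ldistr Pi_def)
    also have "\<dots> = (\<Oplus>\<^bsub>R\<^esub>B\<in>carrier S. g B r)"
    proof (intro R.finsum_cong' refl)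
      show "(\<lambda>B. g B r) \<in> carrier S \<rightarrow> carrier R" using gR by blast
      fix B assume B: "B \<in> carrier S"
      have aG: "a B \<in> carrier G" by (rule acj(1)[OF B])
      have chiR: "chi G (B [^]\<^bsub>S\<^esub> k) \<in> carrier R" using B by simp
      have "a B [^] k = a B [^] (n * (k div n) + r)"
        using k(3) r'(1) by (metis div_mult_mod_eq mod_less mult.commute)
      also have "\<dots> = a B [^] r"
        using aG pow_order_eq_1[OF aG] by (simp add: n_def flip: nat_pow_mult nat_pow_pow)
      finally have ak: "a B [^] k = a B [^] r" .
      have "scal (x B) \<otimes>\<^bsub>R\<^esub> chi G (B [^]\<^bsub>S\<^esub> k) \<otimes>\<^bsub>R\<^esub> w
         = scal (x B) \<otimes>\<^bsub>R\<^esub> (chi G (B [^]\<^bsub>S\<^esub> k) \<otimes>\<^bsub>R\<^esub> psi G H) \<otimes>\<^bsub>R\<^esub> eps N"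
        unfolding w_def using chiR psiR epsR by (simp add: R.m_assoc)
      also have "chi G (B [^]\<^bsub>S\<^esub> k) \<otimes>\<^bsub>R\<^esub> psi G H = scal (c B) \<otimes>\<^bsub>R\<^esub> (X (a B [^] r) \<otimes>\<^bsub>R\<^esub> psi G H)"
        using acj(2)[OF B, of k] J[OF B] k(1) by (simp add: ak)
      also have "scal (x B) \<otimes>\<^bsub>R\<^esub> (scal (c B) \<otimes>\<^bsub>R\<^esub> (X (a B [^] r) \<otimes>\<^bsub>R\<^esub> psi G H)) \<otimes>\<^bsub>R\<^esub> eps N = g B r"
        unfolding g_def s_def scal_mult using XR[OF B, of r] psiR epsR by (simp add: R.m_ac)
      finally show "scal (x B) \<otimes>\<^bsub>R\<^esub> chi G (B [^]\<^bsub>S\<^esub> k) \<otimes>\<^bsub>R\<^esub> w = g B r" .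
    qed
    finally show ?thesis .
  qed
  have finU: "finite U" by (simp add: U_def finite_units_below)
  have "U \<noteq> {}"
  proof (cases "n = 1")
    case True then show ?thesis by (auto simp: U_def units_below_def)
  next
    case False
    then have "1 \<in> U" using n by (simp add: U_def units_below_def)
    then show ?thesis by blast
  qed
  have ewR: "e \<otimes>\<^bsub>R\<^esub> w \<in> carrier R" using e wR by simp
  \<comment> \<open>By \<open>main\<close> the sum over B has the same value for every unit r.
    Adding these equations over U replaces each a^r by a unit power sum, which acts on
    \<open>eps N\<close> by a rational scalar.\<close>
  have "scal (of_nat (card U)) \<otimes>\<^bsub>R\<^esub> (e \<otimes>\<^bsub>R\<^esub> w) = (\<Oplus>\<^bsub>R\<^esub>r\<in>U. e \<otimes>\<^bsub>R\<^esub> w)"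
    using ewR finU by (rule finsum_const_scal[symmetric])
  also have "\<dots> = (\<Oplus>\<^bsub>R\<^esub>r\<in>U. \<Oplus>\<^bsub>R\<^esub>B\<in>carrier S. g B r)"
    using gR by (intro R.finsum_cong' main refl) (auto intro!: R.finsum_closed)
  also have "\<dots> = (\<Oplus>\<^bsub>R\<^esub>B\<in>carrier S. \<Oplus>\<^bsub>R\<^esub>r\<in>U. g B r)"
    using finU gR by (rule R.finsum_swap)
  also have "\<dots> \<in> multiples w"
  proof (rule multiples_finsum[OF wR S.fin])
    fix B assume B: "B \<in> carrier S"
    have aG: "a B \<in> carrier G" by (rule acj(1)[OF B])
    have "(\<Oplus>\<^bsub>R\<^esub>r\<in>U. X (a B [^] r)) \<otimes>\<^bsub>R\<^esub> eps N \<in> multiples (eps N)"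
      unfolding U_def using aG n pow_order_eq_1[OF aG] subgroup.one_closed[OF N]
      by (intro unit_power_sum_multiples[OF N]) (simp_all add: n_def)
    then have "scal (s B) \<otimes>\<^bsub>R\<^esub> (psi G H \<otimes>\<^bsub>R\<^esub> ((\<Oplus>\<^bsub>R\<^esub>r\<in>U. X (a B [^] r)) \<otimes>\<^bsub>R\<^esub> eps N)) \<in> multiples w"
      using multiples_scal[OF wR] multiples_mult[OF epsR psiR] unfolding w_def by blast
    also have "(\<Oplus>\<^bsub>R\<^esub>r\<in>U. X (a B [^] r)) \<otimes>\<^bsub>R\<^esub> eps N = (\<Oplus>\<^bsub>R\<^esub>r\<in>U. X (a B [^] r) \<otimes>\<^bsub>R\<^esub> eps N)"
      using finU epsR XR[OF B] by (intro R.finsum_ldistr) auto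
    also have "psi G H \<otimes>\<^bsub>R\<^esub> \<dots> = (\<Oplus>\<^bsub>R\<^esub>r\<in>U. psi G H \<otimes>\<^bsub>R\<^esub> (X (a B [^] r) \<otimes>\<^bsub>R\<^esub> eps N))"
      using finU epsR psiR XR[OF B] by (intro R.finsum_rdistr) auto
    also have "scal (s B) \<otimes>\<^bsub>R\<^esub> \<dots> = (\<Oplus>\<^bsub>R\<^esub>r\<in>U. g B r)"
      unfolding g_def using finU epsR psiR XR[OF B] by (intro R.finsum_rdistr) auto
    finally show "(\<Oplus>\<^bsub>R\<^esub>r\<in>U. g B r) \<in> multiples w" .
  qed
  finally have "scal (1 / of_nat (card U)) \<otimes>\<^bsub>R\<^esub> (scal (of_nat (card U)) \<otimes>\<^bsub>R\<^esub> (e \<otimes>\<^bsub>R\<^esub> w)) \<in> multiples w"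
    by (rule multiples_scal[OF wR])
  moreover have "(of_nat (card U) :: rat) \<noteq> 0" using finU \<open>U \<noteq> {}\<close> by simp
  ultimately have "e \<otimes>\<^bsub>R\<^esub> w \<in> multiples w" using scal_inverse[OF _ ewR] by simp
  then show ?thesis by (simp only: w_def)
qed

text \<open>If e w = c w, idempotency of e gives (c^2 - c) w = 0, so c is 0 or 1 unless w itself
  vanishes.\<close>

lemma idempotent_multiple:
  assumes e: "e \<in> carrier R" "e \<otimes>\<^bsub>R\<^esub> e = e" and w: "w \<in> carrier R" "w \<otimes>\<^bsub>R\<^esub> w = w"
    and ew: "e \<otimes>\<^bsub>R\<^esub> w \<in> multiples w"
  shows "e \<otimes>\<^bsub>R\<^esub> w = \<zero>\<^bsub>R\<^esub> \<or> e \<otimes>\<^bsub>R\<^esub> w = w"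
proof -
  obtain c where c: "e \<otimes>\<^bsub>R\<^esub> w = scal c \<otimes>\<^bsub>R\<^esub> w" using ew by (rule multiplesE)
  have "scal c \<otimes>\<^bsub>R\<^esub> w = (e \<otimes>\<^bsub>R\<^esub> e) \<otimes>\<^bsub>R\<^esub> w" using c e(2) by simp
  also have "\<dots> = e \<otimes>\<^bsub>R\<^esub> (scal c \<otimes>\<^bsub>R\<^esub> w)" using e(1) w(1) by (simp add: R.m_assoc c)
  also have "\<dots> = scal c \<otimes>\<^bsub>R\<^esub> (scal c \<otimes>\<^bsub>R\<^esub> w)" using R.m_lcomm[OF e(1) scal_closed w(1), of c] c by simp
  also have "\<dots> = scal (c * c) \<otimes>\<^bsub>R\<^esub> w" using w(1) by (simp add: scal_mult R.m_assoc)
  finally have *: "scal c \<otimes>\<^bsub>R\<^esub> w = scal (c * c) \<otimes>\<^bsub>R\<^esub> w" .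
  have "scal (c * c - c) \<otimes>\<^bsub>R\<^esub> w \<oplus>\<^bsub>R\<^esub> scal c \<otimes>\<^bsub>R\<^esub> w = scal (c * c - c + c) \<otimes>\<^bsub>R\<^esub> w"
    unfolding scal_add using w(1) by (intro R.l_distr[symmetric] scal_closed)
  also have "\<dots> = scal c \<otimes>\<^bsub>R\<^esub> w" using * by simp
  finally have zero: "scal (c * c - c) \<otimes>\<^bsub>R\<^esub> w = \<zero>\<^bsub>R\<^esub>"
    using R.add.r_cancel_one[of "scal c \<otimes>\<^bsub>R\<^esub> w" "scal (c * c - c) \<otimes>\<^bsub>R\<^esub> w"]
      R.m_closed[OF scal_closed w(1)] by blast
  show ?thesis
  proof (cases "c * c - c = 0")
    case True
    then have "c * (c - 1) = 0" by (simp add: algebra_simps)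
    then consider "c = 0" | "c = 1" by auto
    then show ?thesis
    proof cases
      case 1
      then have "e \<otimes>\<^bsub>R\<^esub> w = \<zero>\<^bsub>R\<^esub>" unfolding c by (simp add: scal_zero w(1))
      then show ?thesis ..
    next
      case 2
      then have "e \<otimes>\<^bsub>R\<^esub> w = w" unfolding c by (simp add: scal_one w(1))
      then show ?thesis ..
    qed
  next
    case False
    then have "w = \<zero>\<^bsub>R\<^esub>" using zero w(1) scal_eq_zero by blast
    then show ?thesis using e by simp
  qed
qed

text \<open>Take N of largest order whose average does not kill z, starting from {1}. The average
  over any larger subgroup kills z, so every factor of the product in \<open>eps N\<close> fixes the
  averaged element, and z \<open>eps N\<close> equals that element.\<close>

lemma exists_eps_mult_nonzero:
  assumes z: "z \<in> carrier R" "z \<noteq> \<zero>\<^bsub>R\<^esub>"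
  obtains N where "subgroup N G" "z \<otimes>\<^bsub>R\<^esub> eps N \<noteq> \<zero>\<^bsub>R\<^esub>"
proof -
  define P where "P N \<longleftrightarrow> subgroup N G \<and> check_elem G N \<otimes>\<^bsub>R\<^esub> z \<noteq> \<zero>\<^bsub>R\<^esub>" for N
  have "check_elem G {\<one>} \<otimes>\<^bsub>R\<^esub> z = z"
    using z by (intro check_elem_fix) (auto simp: X_one)
  then have P1: "P {\<one>}" using z triv_subgroup by (simp add: P_def)
  have "\<forall>N. P N \<longrightarrow> card N < Suc (card (carrier G))"
    unfolding P_def less_Suc_eq_le by (auto intro!: card_mono[OF finite_G] dest: subgroup.subset)
  then have "\<exists>N. P N \<and> (\<forall>L. P L \<longrightarrow> card L \<le> card N)"
    by (rule ex_has_greatest_nat[where P = P, OF P1])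
  then obtain N where N: "P N" "\<And>L. P L \<Longrightarrow> card L \<le> card N" by blast
  have sN: "subgroup N G" using N(1) by (simp add: P_def)
  define y where "y = check_elem G N \<otimes>\<^bsub>R\<^esub> z"
  have cN: "check_elem G N \<in> carrier R" by (rule check_elem_closed[OF subgroup.subset[OF sN]])
  have y: "y \<in> carrier R" "y \<noteq> \<zero>\<^bsub>R\<^esub>" using N(1) cN z by (simp_all add: y_def P_def)
  have K: "(\<one>\<^bsub>R\<^esub> \<ominus>\<^bsub>R\<^esub> check_elem G (\<Union>K)) \<otimes>\<^bsub>R\<^esub> y = y" if K: "K \<in> minimal_subgroups (G Mod N)" for K
  proof -
    note L = minimal_subgroup_Mod[OF sN K]
    have cL: "check_elem G (\<Union>K) \<in> carrier R" by (rule check_elem_closed[OF subgroup.subset[OF L(1)]])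
    have "N \<subset> \<Union>K" using L by blast
    then have "card N < card (\<Union>K)" using finite_subgroup[OF L(1)] psubset_card_mono by blast
    then have "\<not> P (\<Union>K)" using N(2) by fastforce
    then have "check_elem G (\<Union>K) \<otimes>\<^bsub>R\<^esub> z = \<zero>\<^bsub>R\<^esub>" using L(1) by (simp add: P_def)
    then have "check_elem G (\<Union>K) \<otimes>\<^bsub>R\<^esub> y = \<zero>\<^bsub>R\<^esub>"
      unfolding y_def using cL cN z by (simp add: R.m_lcomm)
    then show ?thesis using R.one_minus_fix_iff[OF cL y(1)] by blast
  qed
  define Q where "Q = (\<Otimes>\<^bsub>R\<^esub>K\<in>minimal_subgroups (G Mod N). \<one>\<^bsub>R\<^esub> \<ominus>\<^bsub>R\<^esub> check_elem G (\<Union>K))"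
  have Q: "Q \<in> carrier R" unfolding Q_def by (rule prod_one_minus_closed[OF sN])
  have "Q \<otimes>\<^bsub>R\<^esub> y = y"
    unfolding Q_def
    by (rule R.finprod_fix[OF finite_minimal_subgroups_Mod[OF sN] one_minus_check_elem_closed[OF sN] y(1) K])
  then have "z \<otimes>\<^bsub>R\<^esub> eps N = y"
    unfolding check_epsilon_def Q_def[symmetric] y_def using Q cN z by (simp add: R.m_ac)
  then show ?thesis using that[OF sN] y by simp
qed

text \<open>The same choice of a largest subgroup, with chi_H in place of the average. The chosen H
  is proper because chi_G = 0 in the contracted algebra.\<close>

lemma exists_psi_mult_nonzero:
  assumes z: "z \<in> carrier R" "z \<noteq> \<zero>\<^bsub>R\<^esub>"
  obtains H where "subgroup H G" "H \<noteq> carrier G" "z \<otimes>\<^bsub>R\<^esub> psi G H \<noteq> \<zero>\<^bsub>R\<^esub>"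
proof -
  define P where "P N \<longleftrightarrow> subgroup N G \<and> chi G N \<otimes>\<^bsub>R\<^esub> z \<noteq> \<zero>\<^bsub>R\<^esub>" for N
  have P1: "P {\<one>}" using z triv_subgroup by (simp add: P_def X_one)
  have "\<forall>N. P N \<longrightarrow> card N < Suc (card (carrier G))"
    unfolding P_def less_Suc_eq_le by (auto intro!: card_mono[OF finite_G] dest: subgroup.subset)
  then have "\<exists>N. P N \<and> (\<forall>L. P L \<longrightarrow> card L \<le> card N)"
    by (rule ex_has_greatest_nat[where P = P, OF P1])
  then obtain H where H: "P H" "\<And>L. P L \<Longrightarrow> card L \<le> card H" by blast
  have sH: "subgroup H G" using H(1) by (simp add: P_def)
  have HG: "H \<noteq> carrier G" using H(1) z by (auto simp: P_def chi_G)
  have cH: "chi G H \<in> carrier R" by (rule chi_closed[OF subgroup_in_S[OF sH]])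
  define y where "y = chi G H \<otimes>\<^bsub>R\<^esub> z"
  have y: "y \<in> carrier R" "y \<noteq> \<zero>\<^bsub>R\<^esub>" using H(1) cH z by (simp_all add: y_def P_def)
  have hy: "chi G H \<otimes>\<^bsub>R\<^esub> y = y"
    unfolding y_def using cH z chi_absorb[OF sH subset_refl subgroup_in_S[OF sH]]
    by (simp flip: R.m_assoc)
  have K: "(chi G H \<ominus>\<^bsub>R\<^esub> chi G (\<Union>K)) \<otimes>\<^bsub>R\<^esub> y = y" if K: "K \<in> minimal_subgroups (G Mod H)" for K
  proof -
    note L = minimal_subgroup_Mod[OF sH K]
    have cL: "chi G (\<Union>K) \<in> carrier R" by (rule chi_closed[OF subgroup_in_S[OF L(1)]])
    have "H \<subset> \<Union>K" using L by blast
    then have "card H < card (\<Union>K)" using finite_subgroup[OF L(1)] psubset_card_mono by blast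
    then have "\<not> P (\<Union>K)" using H(2) by fastforce
    then have "chi G (\<Union>K) \<otimes>\<^bsub>R\<^esub> z = \<zero>\<^bsub>R\<^esub>" using L(1) by (simp add: P_def)
    then have "chi G (\<Union>K) \<otimes>\<^bsub>R\<^esub> y = \<zero>\<^bsub>R\<^esub>"
      unfolding y_def using cL cH z by (simp add: R.m_lcomm)
    then show ?thesis using cH cL y(1) by (simp add: R.minus_eq R.l_distr R.l_minus hy)
  qed
  have "psi G H \<otimes>\<^bsub>R\<^esub> y = y"
    unfolding psi_def
    by (rule R.finprod_fix[OF finite_minimal_subgroups_Mod[OF sH] psi_factor(1)[OF sH HG] y(1) K])
  moreover have "psi G H \<otimes>\<^bsub>R\<^esub> y = z \<otimes>\<^bsub>R\<^esub> (chi G H \<otimes>\<^bsub>R\<^esub> psi G H)"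
    unfolding y_def using cH z psi_closed[OF sH HG] by (simp add: R.m_ac)
  ultimately have "z \<otimes>\<^bsub>R\<^esub> psi G H = y" by (simp only: chi_psi[OF sH HG])
  then show ?thesis using that[OF sH HG] y by simp
qed

text \<open>An h in H but not in N fixes chi_H, hence \<open>psi G H\<close>, hence the product,
  which \<open>mult_eps_eq_zero\<close> then forces to vanish.\<close>

lemma psi_eps_eq_zero_if_not_subset:
  assumes H: "subgroup H G" "H \<noteq> carrier G" and N: "subgroup N G" and HN: "\<not> H \<subseteq> N"
  shows "psi G H \<otimes>\<^bsub>R\<^esub> eps N = \<zero>\<^bsub>R\<^esub>"
proof -
  obtain h where h: "h \<in> H" "h \<notin> N" using HN by blast
  have hG: "h \<in> carrier G" by (rule subgroup.mem_carrier[OF H(1) h(1)])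
  have c: "X h \<in> carrier R" "chi G H \<in> carrier R" "psi G H \<in> carrier R" "eps N \<in> carrier R"
    using hG subgroup_in_S[OF H(1)] psi_closed[OF H] eps_closed[OF N] by simp_all
  have "X h \<otimes>\<^bsub>R\<^esub> psi G H = X h \<otimes>\<^bsub>R\<^esub> (chi G H \<otimes>\<^bsub>R\<^esub> psi G H)" by (simp only: chi_psi[OF H])
  also have "\<dots> = chi G H \<otimes>\<^bsub>R\<^esub> psi G H"
    using c chi_absorb[OF H(1), of "{h}"] h(1) hG by (simp add: S_simps flip: R.m_assoc)
  finally have "X h \<otimes>\<^bsub>R\<^esub> psi G H = psi G H" by (simp only: chi_psi[OF H])
  then have "X h \<otimes>\<^bsub>R\<^esub> (psi G H \<otimes>\<^bsub>R\<^esub> eps N) = psi G H \<otimes>\<^bsub>R\<^esub> eps N"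
    using c by (simp flip: R.m_assoc)
  then show ?thesis using mult_eps_eq_zero[OF N hG h(2) c(3)] by blast
qed

text \<open>With \<open>x\<^sup>p, y\<^sup>p \<in> N\<close> independent modulo \<open>N\<close>, summing the power sums of \<open>x y\<^sup>i\<close> over \<open>i < p\<close>
  gives \<open>p\<close> plus multiples of power sums of the \<open>y\<^sup>j\<close>; all power sums annihilate \<open>\<epsilon>(G, N)\<close>.\<close>

lemma eps_eq_zero_if_independent:
  assumes N: "subgroup N G" and p: "prime p" and xy: "x \<in> carrier G" "y \<in> carrier G"
    and pow: "x [^] p \<in> N" "y [^] (p::nat) \<in> N" and y: "y \<notin> N"
    and indep: "\<And>i::nat. x \<otimes> y [^] i \<notin> N"
  shows "eps N = \<zero>\<^bsub>R\<^esub>"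
proof -
  have p0: "p > 0" using p prime_gt_0_nat by blast
  have e: "eps N \<in> carrier R" by (rule eps_closed[OF N])
  have npow: "b [^] i \<in> N" if "b \<in> N" for b and i :: nat
    by (induction i) (use that subgroup.one_closed[OF N] subgroup.m_closed[OF N] in simp_all)
  have sum_zero: "(\<Oplus>\<^bsub>R\<^esub>i\<in>{..<p}. X (a [^] i) \<otimes>\<^bsub>R\<^esub> eps N) = \<zero>\<^bsub>R\<^esub>"
    if "a \<in> carrier G" "a \<notin> N" "a [^] p \<in> N" for a
    using power_sum_eps[OF N that p0] that(1) e by (simp add: R.finsum_ldistr Pi_def)
  \<comment> \<open>The entry is x^j y^(ij) \<open>eps N\<close>, which can be read in two ways: row
    i is the power sum of x y^i, column j is x^j times the power sum of y^j.\<close>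
  define g where "g i j = X (x [^] j) \<otimes>\<^bsub>R\<^esub> (X ((y [^] j) [^] i) \<otimes>\<^bsub>R\<^esub> eps N)" for i j :: nat
  have gR: "g i j \<in> carrier R" for i j
    unfolding g_def using xy e by (intro R.m_closed X_closed nat_pow_closed) 
  have row: "(\<Oplus>\<^bsub>R\<^esub>j\<in>{..<p}. g i j) = \<zero>\<^bsub>R\<^esub>" for i
  proof -
    have "(x \<otimes> y [^] i) [^] p = x [^] p \<otimes> (y [^] p) [^] i"
      using xy by (simp add: nat_pow_distrib nat_pow_pow mult.commute)
    then have "(x \<otimes> y [^] i) [^] p \<in> N" using pow npow subgroup.m_closed[OF N] by simp
    then have "(\<Oplus>\<^bsub>R\<^esub>j\<in>{..<p}. X ((x \<otimes> y [^] i) [^] j) \<otimes>\<^bsub>R\<^esub> eps N) = \<zero>\<^bsub>R\<^esub>"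
      using xy indep by (intro sum_zero) simp_all
    moreover have "X ((x \<otimes> y [^] i) [^] j) \<otimes>\<^bsub>R\<^esub> eps N = g i j" for j :: nat
      unfolding g_def using xy e
      by (simp add: nat_pow_distrib nat_pow_pow X_mult R.m_assoc mult.commute)
    ultimately show ?thesis by simp
  qed
  have col: "(\<Oplus>\<^bsub>R\<^esub>i\<in>{..<p}. g i j) = \<zero>\<^bsub>R\<^esub>" if j: "j < p" "j > 0" for j
  proof -
    \<comment> \<open>j is invertible modulo p, so by Bezout y is a product of powers of y^j and of
      the inverse of y^p; both in N would put y into N.\<close>
    have "y [^] j \<notin> N"
    proof
      assume yj: "y [^] j \<in> N"
      have "coprime j p" using p j by (metis coprime_commute nat_dvd_not_less prime_imp_coprime)
      then obtain u v where uv: "j * u = p * v + 1" using bezout_nat[of j p] j by auto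
      have "y = inv ((y [^] p) [^] v) \<otimes> (y [^] j) [^] u"
        using xy uv by (simp add: nat_pow_pow flip: m_assoc)
      moreover have "inv ((y [^] p) [^] v) \<otimes> (y [^] j) [^] u \<in> N"
        using npow yj pow subgroup.m_closed[OF N] subgroup.m_inv_closed[OF N] by simp
      ultimately show False using y by simp
    qed
    moreover have "(y [^] j) [^] p \<in> N"
    proof -
      have "(y [^] j) [^] p = (y [^] p) [^] j" using xy by (simp add: nat_pow_pow mult.commute)
      then show ?thesis using npow pow by simp
    qed
    ultimately have "(\<Oplus>\<^bsub>R\<^esub>i\<in>{..<p}. X ((y [^] j) [^] i) \<otimes>\<^bsub>R\<^esub> eps N) = \<zero>\<^bsub>R\<^esub>"
      using xy by (intro sum_zero) simp_all
    moreover have "(\<Oplus>\<^bsub>R\<^esub>i\<in>{..<p}. g i j)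
        = X (x [^] j) \<otimes>\<^bsub>R\<^esub> (\<Oplus>\<^bsub>R\<^esub>i\<in>{..<p}. X ((y [^] j) [^] i) \<otimes>\<^bsub>R\<^esub> eps N)"
      unfolding g_def using xy e by (intro R.finsum_rdistr[symmetric]) auto
    ultimately show ?thesis using xy by simp
  qed
  have "\<zero>\<^bsub>R\<^esub> = (\<Oplus>\<^bsub>R\<^esub>i\<in>{..<p}. \<Oplus>\<^bsub>R\<^esub>j\<in>{..<p}. g i j)" by (simp add: row)
  also have "\<dots> = (\<Oplus>\<^bsub>R\<^esub>j\<in>{..<p}. \<Oplus>\<^bsub>R\<^esub>i\<in>{..<p}. g i j)"
    using gR by (intro R.finsum_swap) auto
  \<comment> \<open>Column 0 is split off: all its p entries are \<open>eps N\<close>, while the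
    other columns and all rows sum to zero. What remains is p \<open>eps N\<close> = 0.\<close>
  also have "\<dots> = (\<Oplus>\<^bsub>R\<^esub>j\<in>insert 0 ({..<p} - {0}). \<Oplus>\<^bsub>R\<^esub>i\<in>{..<p}. g i j)"
    using p0 by (simp add: insert_absorb)
  also have "\<dots> = (\<Oplus>\<^bsub>R\<^esub>i\<in>{..<p}. g i 0) \<oplus>\<^bsub>R\<^esub> (\<Oplus>\<^bsub>R\<^esub>j\<in>{..<p} - {0}. \<Oplus>\<^bsub>R\<^esub>i\<in>{..<p}. g i j)"
    using gR by (intro R.finsum_insert) (auto intro!: R.finsum_closed)
  also have "(\<Oplus>\<^bsub>R\<^esub>j\<in>{..<p} - {0}. \<Oplus>\<^bsub>R\<^esub>i\<in>{..<p}. g i j) = \<zero>\<^bsub>R\<^esub>"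
    by (rule R.add.finprod_one_eqI, rule col) auto
  also have "(\<Oplus>\<^bsub>R\<^esub>i\<in>{..<p}. g i 0) = scal (of_nat p) \<otimes>\<^bsub>R\<^esub> eps N"
    using e finsum_const_scal[OF e, of "{..<p}"] by (simp add: g_def X_one)
  finally have "scal (of_nat p) \<otimes>\<^bsub>R\<^esub> eps N = \<zero>\<^bsub>R\<^esub>" using e by simp
  then show ?thesis using scal_eq_zero[OF _ e, of "of_nat p"] p0 by simp
qed

text \<open>The cyclicity criterion, read contrapositively in G/N, provides cosets of x and y with
  trivial p-th powers such that the first is not a power of the second. Their representatives
  satisfy the independence condition modulo N.\<close>

lemma eps_eq_zero_if_not_cyclic:
  assumes N: "subgroup N G" and nc: "\<not> cyclic_group (G Mod N)"
  shows "eps N = \<zero>\<^bsub>R\<^esub>"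
proof -
  interpret N: normal N G using N subgroup_imp_normal by blast
  interpret Q: comm_group "G Mod N" by (rule abelian_FactGroup[OF N])
  have one: "\<one>\<^bsub>G Mod N\<^esub> = N" and car: "carrier (G Mod N) = rcosets N" by (simp_all add: FactGroup_def)
  have fin: "finite (carrier (G Mod N))" using finite_G by (simp add: car RCOSETS_def)
  have coset_one: "N #> x = N \<longleftrightarrow> x \<in> N" if "x \<in> carrier G" for x
    using coset_join1[OF _ that N] coset_join2[OF that N] subgroup.subset[OF N] by blast
  have pow: "(N #> x) [^]\<^bsub>G Mod N\<^esub> (k::nat) = N #> (x [^] k)" if "x \<in> carrier G" for x k
    using N.FactGroup_pow[OF that] by simp
  obtain p x' y' where p: "prime p" and x': "x' \<in> carrier (G Mod N)" "x' [^]\<^bsub>G Mod N\<^esub> (p::nat) = \<one>\<^bsub>G Mod N\<^esub>"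
    and y': "y' \<in> carrier (G Mod N)" "y' [^]\<^bsub>G Mod N\<^esub> p = \<one>\<^bsub>G Mod N\<^esub>" "y' \<noteq> \<one>\<^bsub>G Mod N\<^esub>"
    and indep: "x' \<notin> range (\<lambda>n::nat. y' [^]\<^bsub>G Mod N\<^esub> n)"
    using Q.cyclic_group_if_unique_prime_order[OF fin] nc by blast
  obtain x where x: "x \<in> carrier G" "x' = N #> x" using x'(1) by (auto simp: car RCOSETS_def)
  obtain y where y: "y \<in> carrier G" "y' = N #> y" using y'(1) by (auto simp: car RCOSETS_def)
  show ?thesis
  proof (rule eps_eq_zero_if_independent[OF N p x(1) y(1)])
    show "x [^] p \<in> N" using x'(2) x coset_one[of "x [^] p"] by (simp add: pow one)
    show "y [^] p \<in> N" using y'(2) y coset_one[of "y [^] p"] by (simp add: pow one)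
    show "y \<notin> N" using y'(3) y coset_one[of y] by (simp add: one)
    fix i :: nat
    show "x \<otimes> y [^] i \<notin> N"
    proof
      assume "x \<otimes> y [^] i \<in> N"
      then have *: "x' \<otimes>\<^bsub>G Mod N\<^esub> y' [^]\<^bsub>G Mod N\<^esub> i = \<one>\<^bsub>G Mod N\<^esub>"
        using x y coset_one[of "x \<otimes> y [^] i"] by (simp add: pow one N.rcos_sum)
      have "p > 0" using p prime_gt_0_nat by blast
      \<comment> \<open>The inverse of y'^i is expressed as y'^((p-1) i), because
        \<open>indep\<close> speaks of natural powers only.\<close>
      then have "i + (p - 1) * i = p * i" by (simp add: algebra_simps)
      then have "y' [^]\<^bsub>G Mod N\<^esub> i \<otimes>\<^bsub>G Mod N\<^esub> y' [^]\<^bsub>G Mod N\<^esub> ((p - 1) * i) = (y' [^]\<^bsub>G Mod N\<^esub> p) [^]\<^bsub>G Mod N\<^esub> i"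
        using y'(1) by (simp only: Q.nat_pow_mult Q.nat_pow_pow)
      then have "y' [^]\<^bsub>G Mod N\<^esub> i \<otimes>\<^bsub>G Mod N\<^esub> y' [^]\<^bsub>G Mod N\<^esub> ((p - 1) * i) = \<one>\<^bsub>G Mod N\<^esub>"
        by (simp only: y'(2) Q.nat_pow_one)
      then have "x' = (x' \<otimes>\<^bsub>G Mod N\<^esub> y' [^]\<^bsub>G Mod N\<^esub> i) \<otimes>\<^bsub>G Mod N\<^esub> y' [^]\<^bsub>G Mod N\<^esub> ((p - 1) * i)"
        using x'(1) y'(1) by (simp only: Q.m_assoc Q.nat_pow_closed Q.r_one)
      then have "x' = y' [^]\<^bsub>G Mod N\<^esub> ((p - 1) * i)"
        using y'(1) by (simp only: * Q.l_one Q.nat_pow_closed)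
      then show False using indep by blast
    qed
  qed
qed

end

section \<open>Nonvanishing\<close>

text \<open>A coset N x is a power z^k of a generator of order n and is sent to exp(2 pi i k / n).
  This value depends on k only modulo n, so the arbitrary choice of k is harmless, and it is 1
  exactly for the trivial coset.\<close>

lemma (in comm_group) exists_character_with_kernel:
  assumes fin: "finite (carrier G)" and N: "subgroup N G" and cyc: "cyclic_group (G Mod N)"
  obtains lam :: "'a \<Rightarrow> complex" where
    "\<And>x y. \<lbrakk>x \<in> carrier G; y \<in> carrier G\<rbrakk> \<Longrightarrow> lam (x \<otimes> y) = lam x * lam y"
    "\<And>x. x \<in> carrier G \<Longrightarrow> lam x = 1 \<longleftrightarrow> x \<in> N"
proof -
  interpret N: normal N G using N subgroup_imp_normal by blast
  interpret Q: group "G Mod N" by (rule N.factorgroup_is_group)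
  have car: "carrier (G Mod N) = rcosets N" and one: "\<one>\<^bsub>G Mod N\<^esub> = N" by (simp_all add: FactGroup_def)
  have finQ: "finite (carrier (G Mod N))" using fin by (simp add: car RCOSETS_def)
  obtain z where z: "z \<in> carrier (G Mod N)" "carrier (G Mod N) = range (\<lambda>k::int. z [^]\<^bsub>G Mod N\<^esub> k)"
    using cyc Q.cyclic_group by blast
  define n where "n = Q.ord z"
  have n: "n > 0" using Q.ord_ge_1[OF finQ z(1)] by (simp add: n_def)
  define k where "k x = (SOME k::int. N #> x = z [^]\<^bsub>G Mod N\<^esub> k)" for x
  have k: "N #> x = z [^]\<^bsub>G Mod N\<^esub> k x" if "x \<in> carrier G" for x
  proof -
    have "N #> x \<in> carrier (G Mod N)" using that by (auto simp: car RCOSETS_def)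
    then have "\<exists>k::int. N #> x = z [^]\<^bsub>G Mod N\<^esub> k" using z(2) by blast
    then show ?thesis unfolding k_def by (rule someI_ex)
  qed
  define zeta where "zeta j = cis (2 * pi * of_int j / of_nat n)" for j :: int
  have zeta_add: "zeta (i + j) = zeta i * zeta j" for i j
    by (simp add: zeta_def cis_mult add_divide_distrib distrib_left)
  have zeta_one: "zeta j = 1 \<longleftrightarrow> int n dvd j" for j
  proof
    assume "zeta j = 1"
    then have "cos (2 * pi * of_int j / of_nat n) = 1" by (simp add: zeta_def complex_eq_iff)
    then obtain m :: int where "2 * pi * of_int j / of_nat n = of_int m * 2 * pi"
      using cos_one_2pi_int by blast
    then have "(of_int j :: real) = of_int (m * int n)" using n by (simp add: field_simps)
    then have "j = m * int n" by (simp only: of_int_eq_iff)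
    then show "int n dvd j" by simp
  next
    assume "int n dvd j"
    then obtain m where "j = int n * m" by blast
    then have "2 * pi * of_int j / of_nat n = of_int m * (2 * pi)" using n by simp
    moreover have "cis (of_int m * (2 * pi)) = 1"
      using cis_multiple_2pi[of "of_int m"] by (simp add: mult_ac)
    ultimately show "zeta j = 1" by (simp add: zeta_def)
  qed
  have pow_eq: "z [^]\<^bsub>G Mod N\<^esub> i = z [^]\<^bsub>G Mod N\<^esub> j \<longleftrightarrow> int n dvd j - i" for i j :: int
    using Q.int_pow_eq[OF z(1)] by (simp add: n_def)
  show ?thesis
  proof
    fix x y assume xy: "x \<in> carrier G" "y \<in> carrier G"
    have "z [^]\<^bsub>G Mod N\<^esub> (k x + k y) = (N #> x) \<otimes>\<^bsub>G Mod N\<^esub> (N #> y)"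
      using xy z(1) by (simp only: k Q.int_pow_mult)
    also have "\<dots> = N #> (x \<otimes> y)" using xy by (simp add: N.rcos_sum)
    also have "\<dots> = z [^]\<^bsub>G Mod N\<^esub> k (x \<otimes> y)" using xy by (simp only: k m_closed)
    finally have "zeta (k (x \<otimes> y) - (k x + k y)) = 1" by (simp add: pow_eq zeta_one)
    then have "zeta (k (x \<otimes> y) - (k x + k y)) * zeta (k x + k y) = zeta (k x + k y)" by simp
    then show "zeta (k (x \<otimes> y)) = zeta (k x) * zeta (k y)" by (simp flip: zeta_add)
  next
    fix x assume x: "x \<in> carrier G"
    have "zeta (k x) = 1 \<longleftrightarrow> z [^]\<^bsub>G Mod N\<^esub> (0::int) = z [^]\<^bsub>G Mod N\<^esub> k x"
      unfolding pow_eq zeta_one by simp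
    also have "\<dots> \<longleftrightarrow> N #> x = N" using k[OF x] by (auto simp: one)
    also have "\<dots> \<longleftrightarrow> x \<in> N"
      using coset_join1[OF _ x N] coset_join2[OF x N] subgroup.subset[OF N] by blast
    finally show "zeta (k x) = 1 \<longleftrightarrow> x \<in> N" .
  qed
qed

section \<open>The character of the contracted algebra attached to H, N and
  \<open>lam\<close>\<close>

context finite_comm_group
begin

context
  fixes H N :: "'a set" and lam :: "'a \<Rightarrow> complex"
  assumes H: "subgroup H G" "H \<noteq> carrier G" and N: "subgroup N G" and HN: "H \<subseteq> N"
    and lam_mult: "\<And>x y. \<lbrakk>x \<in> carrier G; y \<in> carrier G\<rbrakk> \<Longrightarrow> lam (x \<otimes> y) = lam x * lam y"
    and lam_one: "\<And>x. x \<in> carrier G \<Longrightarrow> lam x = 1 \<longleftrightarrow> x \<in> N"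
begin

text \<open>\<open>lam\<close> extends to subsets as a monoid homomorphism: zero on all subsets that are not inside
  one coset of \<open>H\<close>, in particular on \<open>G\<close>, so that it survives the contraction.\<close>

definition in_coset :: "'a set \<Rightarrow> bool" where
  "in_coset B \<longleftrightarrow> (\<forall>b\<in>B. \<forall>b'\<in>B. b \<otimes> inv b' \<in> H)"

definition weight :: "'a set \<Rightarrow> complex" where
  "weight B = (if in_coset B then lam (SOME b. b \<in> B) else 0)"

text \<open>H lies in N, the kernel of \<open>lam\<close>. This makes \<open>weight\<close>
  independent of the representative picked by \<open>SOME\<close>.\<close>

lemma lam_coset:
  assumes "b \<in> carrier G" "b' \<in> carrier G" "b \<otimes> inv b' \<in> H"
  shows "lam b = lam b'"
proof -
  have "lam (b \<otimes> inv b') = 1" using assms HN by (subst lam_one) auto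
  moreover have "b = (b \<otimes> inv b') \<otimes> b'" using assms by (simp add: m_assoc)
  then have "lam b = lam (b \<otimes> inv b') * lam b'" using assms lam_mult by (metis inv_closed m_closed)
  ultimately show ?thesis by simp
qed

lemma weight_eq:
  assumes "B \<in> carrier S" "in_coset B" "b \<in> B"
  shows "weight B = lam b"
proof -
  have s: "(SOME b. b \<in> B) \<in> B" using assms(3) by (rule someI)
  have "(SOME b. b \<in> B) \<otimes> inv b \<in> H" using assms(2,3) s unfolding in_coset_def by blast
  then have "lam (SOME b. b \<in> B) = lam b"
    using assms s by (intro lam_coset) (auto simp: S_simps)
  then show ?thesis using assms(2) by (simp add: weight_def)
qed

text \<open>The forward direction is what makes \<open>weight\<close> multiplicative where it
  vanishes: with a fixed c0 in C, the quotient of b c0 and b' c0 is already b b'^(-1), and likewise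
  for C.\<close>

lemma in_coset_mult:
  assumes B: "B \<in> carrier S" and C: "C \<in> carrier S"
  shows "in_coset (B <#> C) \<longleftrightarrow> in_coset B \<and> in_coset C"
proof -
  have sub: "B \<subseteq> carrier G" "C \<subseteq> carrier G" "B \<noteq> {}" "C \<noteq> {}" using B C by (auto simp: S_simps)
  have eq: "(b \<otimes> c) \<otimes> inv (b' \<otimes> c') = (b \<otimes> inv b') \<otimes> (c \<otimes> inv c')"
    if "b \<in> B" "b' \<in> B" "c \<in> C" "c' \<in> C" for b b' c c'
  proof -
    have "b \<in> carrier G" "b' \<in> carrier G" "c \<in> carrier G" "c' \<in> carrier G" using that sub by blast+
    then show ?thesis by (simp add: inv_mult m_ac)
  qed
  have mem: "b \<otimes> c \<in> B <#> C" if "b \<in> B" "c \<in> C" for b c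
    using that unfolding set_mult_def by blast
  show ?thesis
  proof (intro iffI conjI)
    assume bc: "in_coset (B <#> C)"
    have *: "(b \<otimes> inv b') \<otimes> (c \<otimes> inv c') \<in> H" if "b \<in> B" "b' \<in> B" "c \<in> C" "c' \<in> C" for b b' c c'
      using bc mem[OF that(1,3)] mem[OF that(2,4)] eq[OF that] unfolding in_coset_def by force
    obtain b0 c0 where bc0: "b0 \<in> B" "c0 \<in> C" using sub by blast
    then have inv0: "b0 \<otimes> inv b0 = \<one>" "c0 \<otimes> inv c0 = \<one>" using sub by auto
    show "in_coset B" unfolding in_coset_def
    proof (intro ballI)
      fix b b' assume b: "b \<in> B" "b' \<in> B"
      then have "b \<otimes> inv b' \<in> carrier G" using sub by blast
      then show "b \<otimes> inv b' \<in> H" using *[OF b bc0(2) bc0(2)] inv0 by simp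
    qed
    show "in_coset C" unfolding in_coset_def
    proof (intro ballI)
      fix c c' assume c: "c \<in> C" "c' \<in> C"
      then have "c \<otimes> inv c' \<in> carrier G" using sub by blast
      then show "c \<otimes> inv c' \<in> H" using *[OF bc0(1) bc0(1) c] inv0 by simp
    qed
  next
    assume bc: "in_coset B \<and> in_coset C"
    show "in_coset (B <#> C)" unfolding in_coset_def
    proof (intro ballI)
      fix u v assume "u \<in> B <#> C" "v \<in> B <#> C"
      then obtain b c b' c' where uv: "u = b \<otimes> c" "v = b' \<otimes> c'"
        and m: "b \<in> B" "c \<in> C" "b' \<in> B" "c' \<in> C"
        unfolding set_mult_def by blast
      have "b \<otimes> inv b' \<in> H" "c \<otimes> inv c' \<in> H" using bc m unfolding in_coset_def by blast+
      then show "u \<otimes> inv v \<in> H"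
        unfolding uv eq[OF m(1,3,2,4)] by (rule subgroup.m_closed[OF H(1)])
    qed
  qed
qed

lemma weight_mult:
  assumes B: "B \<in> carrier S" and C: "C \<in> carrier S"
  shows "weight (B \<otimes>\<^bsub>S\<^esub> C) = weight B * weight C"
proof (cases "in_coset B \<and> in_coset C")
  case True
  obtain b c where bc: "b \<in> B" "c \<in> C" "b \<in> carrier G" "c \<in> carrier G" using B C by (auto simp: S_simps)
  have "b \<otimes> c \<in> B <#> C" using bc unfolding set_mult_def by blast
  moreover have "B <#> C \<in> carrier S" using S.m_closed[OF B C] by (simp add: S_simps(2))
  ultimately have "weight (B <#> C) = lam (b \<otimes> c)"
    using True in_coset_mult[OF B C] by (intro weight_eq) simp_all
  also have "\<dots> = weight B * weight C"
    using True B C bc by (simp add: lam_mult weight_eq)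
  finally show ?thesis by (simp add: S_simps(2))
next
  case False
  then show ?thesis using in_coset_mult[OF B C] by (auto simp: weight_def S_simps(2))
qed

lemma weight_subgroup:
  assumes M: "subgroup M G" "H \<subseteq> M" "H \<noteq> M" shows "weight M = 0"
proof -
  obtain x where x: "x \<in> M" "x \<notin> H" using M by blast
  then have "x \<otimes> inv \<one> \<notin> H" using subgroup.mem_carrier[OF M(1)] by simp
  then have "\<not> in_coset M" using x subgroup.one_closed[OF M(1)] unfolding in_coset_def by blast
  then show ?thesis by (simp add: weight_def)
qed

lemma weight_H: "weight H = 1"
proof -
  have "in_coset H"
    unfolding in_coset_def using subgroup.m_closed[OF H(1)] subgroup.m_inv_closed[OF H(1)] by blast
  then have "weight H = lam \<one>"
    using weight_eq[OF subgroup_in_S[OF H(1)]] subgroup.one_closed[OF H(1)] by blast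
  then show ?thesis using lam_one[of \<one>] subgroup.one_closed[OF N] by simp
qed

lemma weight_singleton:
  assumes "g \<in> carrier G" shows "weight {g} = lam g"
  using assms subgroup.one_closed[OF H(1)]
  by (intro weight_eq) (auto simp: S_simps in_coset_def)

text \<open>Evaluates \<open>weight\<close> on an arbitrary lift. The choice is immaterial since
  \<open>weight\<close> is 0 at G, which is not contained in a coset of the proper subgroup H; see
  \<open>character_proj\<close>.\<close>

definition character :: "('a set \<Rightarrow> rat) set \<Rightarrow> complex" where
  "character y = integ S weight (SOME x. x \<in> carrier S.A \<and> y = proj x)"

lemma integ_weight_ideal: "x \<in> contraction_ideal G \<Longrightarrow> integ S weight x = 0"
  using weight_subgroup[OF subgroup_self subgroup.subset[OF H(1)] H(2)]
  by (auto simp: contraction_ideal_eq S.integ_single[OF G_in_S])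

lemma integ_A_minus:
  assumes "x \<in> carrier S.A" "y \<in> carrier S.A"
  shows "integ S weight (x \<ominus>\<^bsub>S.A\<^esub> y) = integ S weight x - integ S weight y"
  by (simp add: S.minus_A[OF assms] integ_def of_rat_diff algebra_simps sum_subtractf)

lemma character_proj:
  assumes x: "x \<in> carrier S.A" shows "character (proj x) = integ S weight x"
proof -
  define x' where "x' = (SOME x'. x' \<in> carrier S.A \<and> proj x = proj x')"
  have "x' \<in> carrier S.A \<and> proj x = proj x'"
    unfolding x'_def by (rule someI[of _ x]) (simp add: x)
  then have x': "x' \<in> carrier S.A" "proj x = proj x'" by blast+
  have "proj (x' \<ominus>\<^bsub>S.A\<^esub> x) = \<zero>\<^bsub>R\<^esub>"
    using x x' by (simp add: S.A.minus_eq R.r_neg)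
  then have "x' \<ominus>\<^bsub>S.A\<^esub> x \<in> contraction_ideal G"
    using proj_eq_zero_iff[OF S.A.minus_closed[OF x'(1) x]] by blast
  then have "integ S weight x' - integ S weight x = 0"
    using integ_weight_ideal integ_A_minus[OF x'(1) x] by simp
  then show ?thesis unfolding character_def x'_def[symmetric] by simp
qed

lemma character_mult:
  assumes "y \<in> carrier R" "z \<in> carrier R"
  shows "character (y \<otimes>\<^bsub>R\<^esub> z) = character y * character z"
proof -
  obtain u v where u: "u \<in> carrier S.A" "y = proj u" and v: "v \<in> carrier S.A" "z = proj v"
    using proj_surj assms by metis
  have "character (y \<otimes>\<^bsub>R\<^esub> z) = character (proj (u \<otimes>\<^bsub>S.A\<^esub> v))" using u v by simp
  also have "\<dots> = integ S weight (u \<otimes>\<^bsub>S.A\<^esub> v)"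
    using S.mult_A_closed[OF u(1) v(1)] by (rule character_proj)
  also have "\<dots> = integ S weight u * integ S weight v"
    using u(1) v(1) weight_mult by (rule S.integ_mult_hom)
  finally show ?thesis by (simp only: u(2) v(2) character_proj[OF u(1)] character_proj[OF v(1)])
qed

lemma character_minus:
  assumes "y \<in> carrier R" "z \<in> carrier R"
  shows "character (y \<ominus>\<^bsub>R\<^esub> z) = character y - character z"
proof -
  obtain u v where u: "u \<in> carrier S.A" "y = proj u" and v: "v \<in> carrier S.A" "z = proj v"
    using proj_surj assms by metis
  have "character (y \<ominus>\<^bsub>R\<^esub> z) = character (proj (u \<ominus>\<^bsub>S.A\<^esub> v))"
    using u v by (simp add: S.A.minus_eq R.minus_eq)
  also have "\<dots> = integ S weight (u \<ominus>\<^bsub>S.A\<^esub> v)"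
    using S.A.minus_closed[OF u(1) v(1)] by (rule character_proj)
  finally show ?thesis
    by (simp only: u(2) v(2) character_proj[OF u(1)] character_proj[OF v(1)] integ_A_minus[OF u(1) v(1)])
qed

lemma character_chi: "B \<in> carrier S \<Longrightarrow> character (chi G B) = weight B"
  by (simp add: chi_eq character_proj S.integ_single)

lemma character_X: "g \<in> carrier G \<Longrightarrow> character (X g) = lam g"
  using character_chi[of "{g}"] weight_singleton by (simp add: S_simps)

lemma character_one: "character \<one>\<^bsub>R\<^esub> = 1"
  using character_X[of \<one>] lam_one[of \<one>] subgroup.one_closed[OF N] by (simp add: X_one)

lemma character_zero: "character \<zero>\<^bsub>R\<^esub> = 0"
  using character_minus[OF R.one_closed R.one_closed] by (simp add: R.minus_eq R.r_neg)

lemma character_finprod_one: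
  assumes "finite I" "\<And>i. i \<in> I \<Longrightarrow> f i \<in> carrier R" "\<And>i. i \<in> I \<Longrightarrow> character (f i) = 1"
  shows "character (\<Otimes>\<^bsub>R\<^esub>i\<in>I. f i) = 1"
  using assms
proof (induction I rule: finite_induct)
  case empty
  show ?case by (simp add: character_one)
next
  case (insert i I)
  have "f \<in> I \<rightarrow> carrier R" using insert.prems(1) by blast
  then have "(\<Otimes>\<^bsub>R\<^esub>i\<in>insert i I. f i) = f i \<otimes>\<^bsub>R\<^esub> (\<Otimes>\<^bsub>R\<^esub>i\<in>I. f i)" "(\<Otimes>\<^bsub>R\<^esub>i\<in>I. f i) \<in> carrier R"
    using insert.hyps insert.prems(1)[of i] by (auto intro: R.finprod_insert R.finprod_closed)
  then show ?case using insert by (simp add: character_mult)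
qed

text \<open>\<open>weight\<close> is 1 at H and 0 at every strictly larger subgroup, so each factor
  takes the value 1.\<close>

lemma character_psi: "character (psi G H) = 1"
  unfolding psi_def
proof (rule character_finprod_one[OF finite_minimal_subgroups_Mod[OF H(1)]])
  fix K assume K: "K \<in> minimal_subgroups (G Mod H)"
  show "chi G H \<ominus>\<^bsub>R\<^esub> chi G (\<Union>K) \<in> carrier R" by (rule psi_factor(1)[OF H K])
  note M = minimal_subgroup_Mod[OF H(1) K]
  have "weight (\<Union>K) = 0" using M by (intro weight_subgroup) auto
  then show "character (chi G H \<ominus>\<^bsub>R\<^esub> chi G (\<Union>K)) = 1"
    using subgroup_in_S[OF H(1)] subgroup_in_S[OF M(1)]
    by (simp add: character_minus character_chi weight_H)
qed

lemma character_check_elem_N: "character (check_elem G N) = 1"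
proof -
  have sub: "N \<subseteq> carrier G" by (rule subgroup.subset[OF N])
  have add: "character (u \<oplus>\<^bsub>R\<^esub> v) = character u + character v"
    if "u \<in> carrier R" "v \<in> carrier R" for u v
  proof -
    \<comment> \<open>Additivity is obtained from \<open>character_minus\<close> by writing u + v as
      u - (0 - v).\<close>
    have "u \<oplus>\<^bsub>R\<^esub> v = u \<ominus>\<^bsub>R\<^esub> (\<zero>\<^bsub>R\<^esub> \<ominus>\<^bsub>R\<^esub> v)" using that by (simp add: R.minus_eq)
    then show ?thesis using that by (simp add: character_minus character_zero)
  qed
  have sum: "character (\<Oplus>\<^bsub>R\<^esub>g\<in>I. X g) = of_nat (card I)" if "finite I" "I \<subseteq> N" for I
    using that
  proof (induction I rule: finite_induct)
    case empty
    show ?case by (simp add: character_zero)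
  next
    case (insert g I)
    have g: "g \<in> carrier G" "lam g = 1" using insert.prems sub lam_one by auto
    have I: "X \<in> I \<rightarrow> carrier R" using insert.prems sub by auto
    then have "(\<Oplus>\<^bsub>R\<^esub>g\<in>I. X g) \<in> carrier R" by (rule R.finsum_closed)
    then show ?case using insert g I by (simp add: add character_X)
  qed
  have scal: "character (scal c) = of_rat c" for c
    using weight_singleton[of \<one>] lam_one[of \<one>] subgroup.one_closed[OF N]
    by (simp add: scal_def character_proj one_in_S S.integ_single)
  have "(\<Oplus>\<^bsub>R\<^esub>g\<in>N. X g) \<in> carrier R" using sub by (intro R.finsum_closed) auto
  then have "character (check_elem G N) = of_rat (1 / of_nat (card N)) * of_nat (card N)"
    unfolding check_elem_eq[OF sub] by (simp add: character_mult scal sum finite_subgroup[OF N])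
  moreover have "card N \<noteq> 0" using finite_subgroup[OF N] subgroup.one_closed[OF N] by auto
  ultimately show ?thesis by (simp add: of_rat_divide)
qed

text \<open>Each L strictly above N contains an a with \<open>lam a\<close> different from 1. As a
  fixes the average over L, the character must vanish on that average, so the factor 1 minus the
  average has value 1.\<close>

lemma character_eps: "character (eps N) = 1"
proof -
  have "character (\<Otimes>\<^bsub>R\<^esub>K\<in>minimal_subgroups (G Mod N). \<one>\<^bsub>R\<^esub> \<ominus>\<^bsub>R\<^esub> check_elem G (\<Union>K)) = 1"
  proof (rule character_finprod_one[OF finite_minimal_subgroups_Mod[OF N] one_minus_check_elem_closed[OF N]])
    fix K assume K: "K \<in> minimal_subgroups (G Mod N)"
    note L = minimal_subgroup_Mod[OF N K]
    have c: "check_elem G (\<Union>K) \<in> carrier R" by (rule check_elem_closed[OF subgroup.subset[OF L(1)]])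
    obtain a where a: "a \<in> \<Union>K" "a \<notin> N" using L by blast
    have aG: "a \<in> carrier G" by (rule subgroup.mem_carrier[OF L(1) a(1)])
    have "lam a \<noteq> 1" using a aG lam_one by blast
    moreover have "lam a * character (check_elem G (\<Union>K)) = character (check_elem G (\<Union>K))"
      using character_mult[OF X_closed[OF aG] c] X_check_elem[OF L(1) a(1)] character_X[OF aG] by simp
    ultimately have "character (check_elem G (\<Union>K)) = 0" by simp
    then show "character (\<one>\<^bsub>R\<^esub> \<ominus>\<^bsub>R\<^esub> check_elem G (\<Union>K)) = 1"
      using c by (simp add: character_minus character_one)
  qed
  then show ?thesis
    unfolding check_epsilon_def
    using character_mult[OF check_elem_closed[OF subgroup.subset[OF N]] prod_one_minus_closed[OF N]]
    by (simp only: character_check_elem_N mult_1)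
qed

lemma psi_eps_nonzero_aux: "psi G H \<otimes>\<^bsub>R\<^esub> eps N \<noteq> \<zero>\<^bsub>R\<^esub>"
  using character_mult[OF psi_closed[OF H] eps_closed[OF N]] character_psi character_eps character_zero
  by auto

end

lemma psi_eps_nonzero:
  assumes "subgroup H G" "H \<noteq> carrier G" "subgroup N G" "H \<subseteq> N" "cyclic_group (G Mod N)"
  shows "psi G H \<otimes>\<^bsub>R\<^esub> eps N \<noteq> \<zero>\<^bsub>R\<^esub>"
  by (rule exists_character_with_kernel[OF finite_G assms(3,5)], rule psi_eps_nonzero_aux[OF assms(1-4)])

lemma psi_eps_idempotent:
  assumes H: "subgroup H G" "H \<noteq> carrier G" and N: "subgroup N G"
  shows "(psi G H \<otimes>\<^bsub>R\<^esub> eps N) \<otimes>\<^bsub>R\<^esub> (psi G H \<otimes>\<^bsub>R\<^esub> eps N) = psi G H \<otimes>\<^bsub>R\<^esub> eps N"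
proof -
  have c: "psi G H \<in> carrier R" "eps N \<in> carrier R" using psi_closed[OF H] eps_closed[OF N] .
  have "(psi G H \<otimes>\<^bsub>R\<^esub> eps N) \<otimes>\<^bsub>R\<^esub> (psi G H \<otimes>\<^bsub>R\<^esub> eps N)
     = (psi G H \<otimes>\<^bsub>R\<^esub> psi G H) \<otimes>\<^bsub>R\<^esub> (eps N \<otimes>\<^bsub>R\<^esub> eps N)"
    using c by (simp add: R.m_ac)
  then show ?thesis by (simp only: psi_idempotent[OF H] eps_idempotent[OF N])
qed

section \<open>Primitivity of the products and completeness of the list\<close>

lemma central_idempotent_iff: "central_idempotent R e \<longleftrightarrow> e \<in> carrier R \<and> e \<otimes>\<^bsub>R\<^esub> e = e"
  unfolding central_idempotent_def using R.m_comm by blast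

text \<open>For an orthogonal splitting w = e1 + e2, the nonzero e1 = e1 w is a rational multiple of
  w, hence equal to w, and this leaves e2 = 0.\<close>

lemma primitive_psi_eps:
  assumes H: "subgroup H G" "H \<noteq> carrier G" and N: "subgroup N G"
    and HN: "H \<subseteq> N" and cyc: "cyclic_group (G Mod N)"
  shows "primitive_central_idempotent R (psi G H \<otimes>\<^bsub>R\<^esub> eps N)"
proof -
  define w where "w = psi G H \<otimes>\<^bsub>R\<^esub> eps N"
  have w: "w \<in> carrier R" "w \<otimes>\<^bsub>R\<^esub> w = w" "w \<noteq> \<zero>\<^bsub>R\<^esub>"
    using psi_closed[OF H] eps_closed[OF N] psi_eps_idempotent[OF H N] psi_eps_nonzero[OF H N HN cyc]
    by (simp_all add: w_def)
  have False if e1: "e1 \<in> carrier R" "e1 \<otimes>\<^bsub>R\<^esub> e1 = e1" "e1 \<noteq> \<zero>\<^bsub>R\<^esub>"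
    and e2: "e2 \<in> carrier R" "e2 \<noteq> \<zero>\<^bsub>R\<^esub>" and e12: "e1 \<otimes>\<^bsub>R\<^esub> e2 = \<zero>\<^bsub>R\<^esub>" "w = e1 \<oplus>\<^bsub>R\<^esub> e2" for e1 e2
  proof -
    have "e1 \<otimes>\<^bsub>R\<^esub> w = e1" using e1 e2 by (simp add: e12 R.r_distr)
    moreover have "e1 \<otimes>\<^bsub>R\<^esub> w \<in> multiples w"
      unfolding w_def by (rule idempotent_mult_multiples[OF H N e1(1,2)])
    ultimately have "e1 = w" using idempotent_multiple[OF e1(1,2) w(1,2)] e1(3) by simp
    then have "e1 \<oplus>\<^bsub>R\<^esub> e2 = e1 \<oplus>\<^bsub>R\<^esub> \<zero>\<^bsub>R\<^esub>" using e12(2) e1(1) by simp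
    then show False using e1(1) e2 by simp
  qed
  then show ?thesis
    unfolding primitive_central_idempotent_def w_def[symmetric] central_idempotent_iff
    using w by blast
qed

text \<open>A nonzero e w must equal w, so e = w + (e - w) is a sum of orthogonal idempotents and
  primitivity forces e = w. The conditions on H and N are then read off from w being
  nonzero.\<close>

lemma primitive_eq_psi_eps:
  assumes "primitive_central_idempotent R e"
  obtains H N where "subgroup H G" "subgroup N G" "H \<subseteq> N" "H \<noteq> carrier G"
    "cyclic_group (G Mod N)" "e = psi G H \<otimes>\<^bsub>R\<^esub> eps N"
proof -
  have e: "e \<in> carrier R" "e \<otimes>\<^bsub>R\<^esub> e = e" "e \<noteq> \<zero>\<^bsub>R\<^esub>"
    and prim: "\<And>e1 e2. \<lbrakk>e1 \<in> carrier R; e1 \<otimes>\<^bsub>R\<^esub> e1 = e1; e2 \<in> carrier R; e2 \<otimes>\<^bsub>R\<^esub> e2 = e2;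
      e1 \<noteq> \<zero>\<^bsub>R\<^esub>; e2 \<noteq> \<zero>\<^bsub>R\<^esub>; e1 \<otimes>\<^bsub>R\<^esub> e2 = \<zero>\<^bsub>R\<^esub>; e = e1 \<oplus>\<^bsub>R\<^esub> e2\<rbrakk> \<Longrightarrow> False"
    using assms unfolding primitive_central_idempotent_def central_idempotent_iff by blast+
  obtain H where H: "subgroup H G" "H \<noteq> carrier G" "e \<otimes>\<^bsub>R\<^esub> psi G H \<noteq> \<zero>\<^bsub>R\<^esub>"
    by (rule exists_psi_mult_nonzero[OF e(1,3)])
  have pR: "psi G H \<in> carrier R" by (rule psi_closed[OF H(1,2)])
  obtain N where N: "subgroup N G" "e \<otimes>\<^bsub>R\<^esub> psi G H \<otimes>\<^bsub>R\<^esub> eps N \<noteq> \<zero>\<^bsub>R\<^esub>"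
    by (rule exists_eps_mult_nonzero[OF R.m_closed[OF e(1) pR] H(3)])
  have eR: "eps N \<in> carrier R" by (rule eps_closed[OF N(1)])
  define w where "w = psi G H \<otimes>\<^bsub>R\<^esub> eps N"
  have w: "w \<in> carrier R" "w \<otimes>\<^bsub>R\<^esub> w = w"
    using pR eR psi_eps_idempotent[OF H(1,2) N(1)] by (simp_all add: w_def)
  have ew0: "e \<otimes>\<^bsub>R\<^esub> w \<noteq> \<zero>\<^bsub>R\<^esub>" using N(2) e(1) pR eR by (simp add: w_def R.m_assoc)
  then have w0: "w \<noteq> \<zero>\<^bsub>R\<^esub>" using e(1) by auto
  have ew: "e \<otimes>\<^bsub>R\<^esub> w = w"
    using idempotent_multiple[OF e(1,2) w idempotent_mult_multiples[OF H(1,2) N(1) e(1,2), folded w_def]] ew0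
    by blast
  have "e = w"
  proof (rule ccontr)
    assume ne: "e \<noteq> w"
    define d where "d = e \<ominus>\<^bsub>R\<^esub> w"
    have dR: "d \<in> carrier R" unfolding d_def using e(1) w(1) by (rule R.minus_closed)
    have dd: "d \<otimes>\<^bsub>R\<^esub> d = d" unfolding d_def by (rule R.diff_idempotent[OF e(1) w(1) e(2) ew w(2)])
    have d0: "d \<noteq> \<zero>\<^bsub>R\<^esub>" using ne e(1) w(1) unfolding d_def by (simp add: R.r_right_minus_eq)
    have "w \<otimes>\<^bsub>R\<^esub> d = e \<otimes>\<^bsub>R\<^esub> w \<ominus>\<^bsub>R\<^esub> w \<otimes>\<^bsub>R\<^esub> w"
      unfolding d_def using e(1) w(1) by (simp add: R.minus_eq R.r_distr R.r_minus R.m_comm)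
    then have wd: "w \<otimes>\<^bsub>R\<^esub> d = \<zero>\<^bsub>R\<^esub>" using w(1) by (simp add: ew w(2) R.minus_eq R.r_neg)
    have "w \<oplus>\<^bsub>R\<^esub> d = e"
      unfolding d_def using e(1) w(1) by (simp add: R.minus_eq R.a_lcomm R.r_neg)
    then show False using prim[OF w dR dd w0 d0 wd] by simp
  qed
  moreover have "H \<subseteq> N"
  proof (rule ccontr)
    assume "\<not> H \<subseteq> N"
    then have "w = \<zero>\<^bsub>R\<^esub>" unfolding w_def by (rule psi_eps_eq_zero_if_not_subset[OF H(1,2) N(1)])
    then show False using w0 by (rule notE[rotated])
  qed
  moreover have "cyclic_group (G Mod N)"
  proof (rule ccontr)
    assume "\<not> cyclic_group (G Mod N)"
    then have "eps N = \<zero>\<^bsub>R\<^esub>" by (rule eps_eq_zero_if_not_cyclic[OF N(1)])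
    then have "w = psi G H \<otimes>\<^bsub>R\<^esub> \<zero>\<^bsub>R\<^esub>" unfolding w_def by (simp only:)
    then show False using w0 pR by simp
  qed
  ultimately show ?thesis using that H N(1) by (simp add: w_def)
qed

end

theorem theorem5p11:
  fixes G :: "('a, 'm) monoid_scheme" (structure)
  assumes "comm_group G" and "finite (carrier G)"
  shows "{e. primitive_central_idempotent (gen_char_algebra G) e} =
         {psi G H \<otimes>\<^bsub>gen_char_algebra G\<^esub> check_epsilon G N | H N.
            subgroup H G \<and> subgroup N G \<and> H \<subseteq> N \<and> H \<noteq> carrier G \<and>
            cyclic_group (G Mod N)}"
proof -
  interpret finite_comm_group G
    using assms by (intro finite_comm_group.intro finite_comm_group_axioms.intro)
  show ?thesis
  proof (intro equalityI subsetI)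
    fix e assume "e \<in> {e. primitive_central_idempotent R e}"
    then have "primitive_central_idempotent R e" by simp
    then obtain H N where "subgroup H G" "subgroup N G" "H \<subseteq> N" "H \<noteq> carrier G"
      "cyclic_group (G Mod N)" "e = psi G H \<otimes>\<^bsub>R\<^esub> eps N"
      by (rule primitive_eq_psi_eps)
    then show "e \<in> {psi G H \<otimes>\<^bsub>R\<^esub> eps N | H N.
        subgroup H G \<and> subgroup N G \<and> H \<subseteq> N \<and> H \<noteq> carrier G \<and> cyclic_group (G Mod N)}" by blast
  next
    fix e assume "e \<in> {psi G H \<otimes>\<^bsub>R\<^esub> eps N | H N.
        subgroup H G \<and> subgroup N G \<and> H \<subseteq> N \<and> H \<noteq> carrier G \<and> cyclic_group (G Mod N)}"
    then obtain H N where *: "subgroup H G" "subgroup N G" "H \<subseteq> N" "H \<noteq> carrier G"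
      "cyclic_group (G Mod N)" "e = psi G H \<otimes>\<^bsub>R\<^esub> eps N" by blast
    show "e \<in> {e. primitive_central_idempotent R e}"
      unfolding *(6) using primitive_psi_eps[OF *(1,4,2,3,5)] by simp
  qed
qed

end
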